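(* Let $Z$ be a connected reduced stripped surface with strips $\widehat{S}_\alpha=\xi_\alpha(S_\alpha)$, $\alpha\in A$, and canonical foliation $\mathcal{F}_Z$, and let $h\in\mathcal{H}(\mathcal{F}_Z)$. Then $h\in\mathcal{H}_0(\mathcal{F}_Z)$ if and only if the following three conditions hold: (a) $h(\widehat{S}_\alpha)=\widehat{S}_\alpha$ for all $\alpha\in A$; (b) for each $\alpha\in A$, if $g_\alpha:S_\alpha\to S_\alpha$, $g_\alpha(x,y)=\bigl(\lambda_\alpha(x,y),\mu_\alpha(y)\bigr)$, is the unique lifting of $h|_{\widehat{S}_\alpha}$ (that is, the unique homeomorphism with $\xi_\alpha\circ g_\alpha=h\circ\xi_\alpha$), then $\mu_\alpha$ is increasing and, for each fixed $y\in(-1,1)$, $x\mapsto\lambda_\alpha(x,y)$ is increasing; (c) $h$ leaves invariant each leaf $\omega\subset\Sigma(\mathcal{F}_Z)$ and preserves its orientation. Moreover, $\mathcal{H}_0(\mathcal{F}_Z)'$ is a strong deformation retract of $\mathcal{H}_0(\mathcal{F}_Z)$, and in particular $\mathcal{H}_0(\mathcal{F}_Z)$ is contractible.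
   Context: Model strip: a subset $S\subset\mathbb{R}\times[-1,1]$ such that $\mathbb{R}\times(-1,1)\subset S$ and $S\cap(\mathbb{R}\times\{-1,1\})$ is a (possibly empty) union of open finite intervals with mutually disjoint closures. Put $\partial_-S=S\cap(\mathbb{R}\times\{-1\})$, $\partial_+S=S\cap(\mathbb{R}\times\{1\})$, $\partial S=\partial_-S\cup\partial_+S$. The connected components of $\partial S$ are called boundary intervals. Stripped surface: a quotient space $Z=\bigsqcup_{\alpha\in A}S_\alpha\big/\{Y_\beta\overset{\phi_\beta}{\sim}X_\beta\}_{\beta\in B}$, where the $S_\alpha$ are model strips, $\{X_\beta,Y_\beta\}_{\beta\in B}$ is a family of pairs of boundary intervals of these strips such that all the intervals $X_\beta,Y_\beta$ $(\beta\in B)$ are pairwise distinct, and each $\phi_\beta:Y_\beta\to X_\beta$ is an affine homeomorphism (affine in the first coordinate), preserving or reversing orientation. A stripped surface is considered together with this decomposition. Let $q$ be the quotient map and $\xi_\alpha:S_\alpha\hookrightarrow\bigsqcup_\alpha S_\alpha\xrightarrow{q}Z$ the chart map. Put $\widehat{S}_\alpha=\xi_\alpha(S_\alpha)$ (a strip of $Z$), $\partial_\pm\widehat{S}_\alpha=\xi_\alpha(\partial_\pm S_\alpha)$, $\partial\widehat{S}_\alpha=\xi_\alpha(\partial S_\alpha)$. Canonical foliation: each model strip $S$ has the foliation $\mathcal{F}_S$ whose leaves are the lines $\mathbb{R}\times\{t\}$, $t\in(-1,1)$, and the connected components of $\partial S$. These induce the canonical foliation $\mathcal{F}_Z$ on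 $Z$, whose leaves are the images under $q$ of leaves of the model strips. Types of leaves $\omega$ of $\mathcal{F}_Z$: (a) internal: $\omega\subset\widehat{S}_\gamma\setminus\partial\widehat{S}_\gamma$ for some $\gamma$. (b) boundary: $\omega\subset\partial\widehat{S}_\gamma\cap\partial Z$ for some $\gamma$. (c) $\omega=\xi_\gamma(X_\beta)=\xi_{\gamma'}(Y_\beta)$ for some $\beta\in B$, with $X_\beta\subset\partial_\varepsilon S_\gamma$, $Y_\beta\subset\partial_{\varepsilon'}S_{\gamma'}$, $\varepsilon,\varepsilon'\in\{+,-\}$. Type (c) splits into: (c1) $\gamma=\gamma'$, $X_\beta=\partial_\varepsilon S_\gamma$ and $Y_\beta=\partial_{\varepsilon'}S_\gamma$; (c2) $\gamma\neq\gamma'$, $X_\beta=\partial_\varepsilon S_\gamma$ and $Y_\beta=\partial_{\varepsilon'}S_{\gamma'}$; (c3), called special: $X_\beta\neq\partial_\varepsilon S_\gamma$ or $Y_\beta\neq\partial_{\varepsilon'}S_{\gamma'}$. A stripped surface is reduced if it has no leaves of types (c1) and (c2). $\Sigma(\mathcal{F}_Z)$ is the union of all leaves of types (b) and (c3). $\mathcal{H}(\mathcal{F}_Z)$ is the group of homeomorphisms $h:Z\to Z$ mapping each leaf of $\mathcal{F}_Z$ onto a leaf of $\mathcal{F}_Z$, with the compact open topology. $\mathcal{H}_0(\mathcal{F}_Z)$ is its identity path component, i.e. the set of $h\in\mathcal{H}(\mathcal{F}_Z)$ isotopic to $\mathrm{id}_Z$ within $\mathcal{H}(\mathcal{F}_Z)$.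 $\mathcal{H}_0(\mathcal{F}_Z)'$ is the subgroup of $\mathcal{H}(\mathcal{F}_Z)$ consisting of all $h$ such that $h(\omega)=\omega$ for each leaf $\omega$ of $\mathcal{F}_Z$ and $h$ preserves the orientation of $\omega$. Any homeomorphism $g$ of a model strip $S$ mapping leaves of $\mathcal{F}_S$ onto leaves has the form $g(x,y)=(\lambda(x,y),\mu(y))$, where $\mu:[-1,1]\to[-1,1]$ is a homeomorphism, $\lambda:S\to\mathbb{R}$ is continuous, and $x\mapsto\lambda(x,y)$ is a homeomorphism of $\mathbb{R}$ for each $y\in(-1,1)$. *)

theory Defs
  imports "HOL-Analysis.Analysis"
begin

section \<open>General topology\<close>

definition quotient_topology :: "'a topology \<Rightarrow> ('a \<Rightarrow> 'b) \<Rightarrow> 'b topology" where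
  "quotient_topology T f =
     topology (\<lambda>U. U \<subseteq> f ` topspace T \<and> openin T {x \<in> topspace T. f x \<in> U})"

lemma openin_quotient_topology:
  "openin (quotient_topology T f) U \<longleftrightarrow>
     U \<subseteq> f ` topspace T \<and> openin T {x \<in> topspace T. f x \<in> U}"
proof -
  have "istopology (\<lambda>U. U \<subseteq> f ` topspace T \<and> openin T {x \<in> topspace T. f x \<in> U})"
  proof -
    have 1: "{x \<in> topspace T. f x \<in> U \<inter> V} =
        {x \<in> topspace T. f x \<in> U} \<inter> {x \<in> topspace T. f x \<in> V}" for U V
      by auto
    have 2: "{x \<in> topspace T. f x \<in> \<Union>\<K>} = (\<Union>K\<in>\<K>. {x \<in> topspace T. f x \<in> K})" for \<K>
      by auto
    show ?thesis
      unfolding istopology_def 1 2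
      by (intro conjI allI impI openin_Int openin_Union) auto
  qed
  then show ?thesis
    by (simp add: quotient_topology_def topology_inverse')
qed

lemma topspace_quotient_topology [simp]:
  "topspace (quotient_topology T f) = f ` topspace T"
proof
  show "topspace (quotient_topology T f) \<subseteq> f ` topspace T"
    using openin_quotient_topology[of T f "topspace (quotient_topology T f)"] by simp
  have "{x \<in> topspace T. f x \<in> f ` topspace T} = topspace T"
    by auto
  then have "openin (quotient_topology T f) (f ` topspace T)"
    by (simp add: openin_quotient_topology)
  then show "f ` topspace T \<subseteq> topspace (quotient_topology T f)"
    by (rule openin_subset)
qed

lemma quotient_map_quotient_topology: "quotient_map T (quotient_topology T f) f"
  by (auto simp: quotient_map_def openin_quotient_topology)

text \<open>Maps between spaces are represented by functions that are \<^const>\<open>undefined\<close> outside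
  the space, so that equality of functions is equality of maps.\<close>

definition continuous_maps :: "'a topology \<Rightarrow> 'b topology \<Rightarrow> ('a \<Rightarrow> 'b) set" where
  "continuous_maps S T = {f \<in> extensional (topspace S). continuous_map S T f}"

definition compact_open_topology :: "'a topology \<Rightarrow> 'b topology \<Rightarrow> ('a \<Rightarrow> 'b) topology" where
  "compact_open_topology S T = topology_generated_by
     {{f \<in> continuous_maps S T. f ` K \<subseteq> U} |K U. compactin S K \<and> openin T U}"

lemma topspace_compact_open_topology [simp]:
  "topspace (compact_open_topology S T) = continuous_maps S T"
proof -
  have "continuous_maps S T \<in>
      {{f \<in> continuous_maps S T. f ` K \<subseteq> U} |K U. compactin S K \<and> openin T U}"
    by (intro CollectI exI[of _ "{}"]) auto
  then show ?thesis
    unfolding compact_open_topology_def topology_generated_by_topspace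
    by (intro equalityI Union_upper Union_least) auto
qed

definition strong_deformation_retract :: "'a set \<Rightarrow> 'a topology \<Rightarrow> bool" where
  "strong_deformation_retract S T \<longleftrightarrow>
     S \<subseteq> topspace T \<and>
     (\<exists>r. retraction_maps T (subtopology T S) r id \<and>
          homotopic_with (\<lambda>f. \<forall>s\<in>S. f s = s) T T id r)"

text \<open>The boundary of a two-dimensional manifold: the points without a Euclidean neighbourhood.\<close>

definition surface_boundary :: "'a topology \<Rightarrow> 'a set" where
  "surface_boundary T = {z \<in> topspace T.
     \<not> (\<exists>U W. openin T U \<and> z \<in> U \<and> open (W :: (real \<times> real) set) \<and>
            subtopology T U homeomorphic_space top_of_set W)}"

text \<open>\<open>h\<close> maps \<open>w\<close>, a subspace of \<open>T\<close> homeomorphic to the real line, onto itself with orientation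
  preserved, i.e. \<open>h\<close> becomes an increasing map in a parametrization of \<open>w\<close>. This does
  not depend on the parametrization, nor on which of the two orientations is taken.\<close>

definition preserves_orientation :: "'a topology \<Rightarrow> ('a \<Rightarrow> 'a) \<Rightarrow> 'a set \<Rightarrow> bool" where
  "preserves_orientation T h w \<longleftrightarrow>
     h ` w = w \<and>
     (\<exists>f \<phi>. homeomorphic_map euclideanreal (subtopology T w) f \<and>
            strict_mono (\<phi> :: real \<Rightarrow> real) \<and> (\<forall>s. h (f s) = f (\<phi> s)))"


section \<open>Model strips\<close>

definition model_strip :: "(real \<times> real) set \<Rightarrow> bool" where
  "model_strip S \<longleftrightarrow>
     UNIV \<times> {-1<..<1} \<subseteq> S \<and> S \<subseteq> UNIV \<times> {-1..1} \<and>
     (\<exists>\<J>. (\<forall>J\<in>\<J>. \<exists>a b e. a < b \<and> e \<in> {-1, 1} \<and> J = {a<..<b} \<times> {e}) \<and>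
          pairwise (\<lambda>J K. disjnt (closure J) (closure K)) \<J> \<and>
          S \<inter> (UNIV \<times> {-1, 1}) = \<Union>\<J>)"

text \<open>\<open>strip_side S (-1)\<close> and \<open>strip_side S 1\<close> are \<open>\<partial>\<^sub>-S\<close> and \<open>\<partial>\<^sub>+S\<close>.\<close>

definition strip_side :: "(real \<times> real) set \<Rightarrow> real \<Rightarrow> (real \<times> real) set" where
  "strip_side S e = S \<inter> (UNIV \<times> {e})"

definition strip_boundary :: "(real \<times> real) set \<Rightarrow> (real \<times> real) set" where
  "strip_boundary S = strip_side S (-1) \<union> strip_side S 1"

definition boundary_intervals :: "(real \<times> real) set \<Rightarrow> (real \<times> real) set set" where
  "boundary_intervals S = components (strip_boundary S)"

definition model_leaves :: "(real \<times> real) set \<Rightarrow> (real \<times> real) set set" where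
  "model_leaves S = {UNIV \<times> {t} |t. t \<in> {-1<..<1}} \<union> boundary_intervals S"


section \<open>Stripped surfaces\<close>

text \<open>A boundary interval of the disjoint union is a pair of the index of a strip and a boundary
  interval of that strip; \<open>glue_X \<beta>\<close> and \<open>glue_Y \<beta>\<close> are of this form.\<close>

record ('a, 'b) gluing =
  strip_index :: "'a set"
  strip :: "'a \<Rightarrow> (real \<times> real) set"
  glue_index :: "'b set"
  glue_X :: "'b \<Rightarrow> 'a \<times> (real \<times> real) set"
  glue_Y :: "'b \<Rightarrow> 'a \<times> (real \<times> real) set"
  glue_map :: "'b \<Rightarrow> real \<times> real \<Rightarrow> real \<times> real"

definition interval_of_strips :: "('a, 'b) gluing \<Rightarrow> 'a \<times> (real \<times> real) set \<Rightarrow> bool" where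
  "interval_of_strips Z I \<longleftrightarrow>
     fst I \<in> strip_index Z \<and> snd I \<in> boundary_intervals (strip Z (fst I))"

definition affine_homeomorphism ::
    "(real \<times> real) set \<Rightarrow> (real \<times> real) set \<Rightarrow> (real \<times> real \<Rightarrow> real \<times> real) \<Rightarrow> bool" where
  "affine_homeomorphism J K \<phi> \<longleftrightarrow>
     homeomorphic_map (top_of_set J) (top_of_set K) \<phi> \<and>
     (\<exists>c d. \<forall>p\<in>J. fst (\<phi> p) = c * fst p + d)"

definition stripped_surface :: "('a, 'b) gluing \<Rightarrow> bool" where
  "stripped_surface Z \<longleftrightarrow>
     (\<forall>\<alpha>\<in>strip_index Z. model_strip (strip Z \<alpha>)) \<and>
     (\<forall>\<beta>\<in>glue_index Z. interval_of_strips Z (glue_X Z \<beta>) \<and> interval_of_strips Z (glue_Y Z \<beta>) \<and>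
        affine_homeomorphism (snd (glue_Y Z \<beta>)) (snd (glue_X Z \<beta>)) (glue_map Z \<beta>)) \<and>
     inj_on (glue_X Z) (glue_index Z) \<and> inj_on (glue_Y Z) (glue_index Z) \<and>
     glue_X Z ` glue_index Z \<inter> glue_Y Z ` glue_index Z = {}"

definition glue_rel :: "('a, 'b) gluing \<Rightarrow> ('a \<times> real \<times> real) rel" where
  "glue_rel Z = {((fst (glue_Y Z \<beta>), p), (fst (glue_X Z \<beta>), glue_map Z \<beta> p)) |\<beta> p.
     \<beta> \<in> glue_index Z \<and> p \<in> snd (glue_Y Z \<beta>)}"

text \<open>The points of the surface are the classes of the equivalence relation generated by
  \<^const>\<open>glue_rel\<close>.\<close>

definition quotient_proj :: "('a, 'b) gluing \<Rightarrow> 'a \<times> real \<times> real \<Rightarrow> ('a \<times> real \<times> real) set" where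
  "quotient_proj Z p = (glue_rel Z \<union> (glue_rel Z)\<inverse>)\<^sup>* `` {p}"

definition surface :: "('a, 'b) gluing \<Rightarrow> ('a \<times> real \<times> real) set topology" where
  "surface Z = quotient_topology
     (sum_topology (\<lambda>\<alpha>. top_of_set (strip Z \<alpha>)) (strip_index Z)) (quotient_proj Z)"

definition chart :: "('a, 'b) gluing \<Rightarrow> 'a \<Rightarrow> real \<times> real \<Rightarrow> ('a \<times> real \<times> real) set" where
  "chart Z \<alpha> p = quotient_proj Z (\<alpha>, p)"

definition surface_strip :: "('a, 'b) gluing \<Rightarrow> 'a \<Rightarrow> ('a \<times> real \<times> real) set set" where
  "surface_strip Z \<alpha> = chart Z \<alpha> ` strip Z \<alpha>"

definition surface_strip_boundary :: "('a, 'b) gluing \<Rightarrow> 'a \<Rightarrow> ('a \<times> real \<times> real) set set" where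
  "surface_strip_boundary Z \<alpha> = chart Z \<alpha> ` strip_boundary (strip Z \<alpha>)"

definition leaves :: "('a, 'b) gluing \<Rightarrow> ('a \<times> real \<times> real) set set set" where
  "leaves Z = {chart Z \<alpha> ` L |\<alpha> L. \<alpha> \<in> strip_index Z \<and> L \<in> model_leaves (strip Z \<alpha>)}"

definition boundary_leaf :: "('a, 'b) gluing \<Rightarrow> ('a \<times> real \<times> real) set set \<Rightarrow> bool" where
  "boundary_leaf Z w \<longleftrightarrow> w \<in> leaves Z \<and>
     (\<exists>\<gamma>\<in>strip_index Z. w \<subseteq> surface_strip_boundary Z \<gamma> \<inter> surface_boundary (surface Z))"

text \<open>\<open>w\<close> is the leaf obtained from \<open>X\<^sub>\<beta> = (\<gamma>, J)\<close> and \<open>Y\<^sub>\<beta> = (\<gamma>', J')\<close>, which lie on the sides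
  \<open>e\<close> and \<open>e'\<close> of their strips.\<close>

definition glued_leaf ::
    "('a, 'b) gluing \<Rightarrow> ('a \<times> real \<times> real) set set \<Rightarrow>
     'a \<Rightarrow> (real \<times> real) set \<Rightarrow> real \<Rightarrow> 'a \<Rightarrow> (real \<times> real) set \<Rightarrow> real \<Rightarrow> bool" where
  "glued_leaf Z w \<gamma> J e \<gamma>' J' e' \<longleftrightarrow>
     (\<exists>\<beta>\<in>glue_index Z. glue_X Z \<beta> = (\<gamma>, J) \<and> glue_Y Z \<beta> = (\<gamma>', J')) \<and>
     w = chart Z \<gamma> ` J \<and> w = chart Z \<gamma>' ` J' \<and>
     e \<in> {-1, 1} \<and> J \<subseteq> strip_side (strip Z \<gamma>) e \<and>
     e' \<in> {-1, 1} \<and> J' \<subseteq> strip_side (strip Z \<gamma>') e'"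

definition c1_leaf :: "('a, 'b) gluing \<Rightarrow> ('a \<times> real \<times> real) set set \<Rightarrow> bool" where
  "c1_leaf Z w \<longleftrightarrow> (\<exists>\<gamma> J e \<gamma>' J' e'. glued_leaf Z w \<gamma> J e \<gamma>' J' e' \<and>
     \<gamma> = \<gamma>' \<and> J = strip_side (strip Z \<gamma>) e \<and> J' = strip_side (strip Z \<gamma>') e')"

definition c2_leaf :: "('a, 'b) gluing \<Rightarrow> ('a \<times> real \<times> real) set set \<Rightarrow> bool" where
  "c2_leaf Z w \<longleftrightarrow> (\<exists>\<gamma> J e \<gamma>' J' e'. glued_leaf Z w \<gamma> J e \<gamma>' J' e' \<and>
     \<gamma> \<noteq> \<gamma>' \<and> J = strip_side (strip Z \<gamma>) e \<and> J' = strip_side (strip Z \<gamma>') e')"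

definition special_leaf :: "('a, 'b) gluing \<Rightarrow> ('a \<times> real \<times> real) set set \<Rightarrow> bool" where
  "special_leaf Z w \<longleftrightarrow> (\<exists>\<gamma> J e \<gamma>' J' e'. glued_leaf Z w \<gamma> J e \<gamma>' J' e' \<and>
     (J \<noteq> strip_side (strip Z \<gamma>) e \<or> J' \<noteq> strip_side (strip Z \<gamma>') e'))"

definition reduced :: "('a, 'b) gluing \<Rightarrow> bool" where
  "reduced Z \<longleftrightarrow> (\<forall>w\<in>leaves Z. \<not> c1_leaf Z w \<and> \<not> c2_leaf Z w)"

definition Sigma_leaves :: "('a, 'b) gluing \<Rightarrow> ('a \<times> real \<times> real) set set" where
  "Sigma_leaves Z = \<Union>{w \<in> leaves Z. boundary_leaf Z w \<or> special_leaf Z w}"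


section \<open>Groups of foliated homeomorphisms\<close>

type_synonym 'a surface_map = "('a \<times> real \<times> real) set \<Rightarrow> ('a \<times> real \<times> real) set"

definition Homeo :: "('a, 'b) gluing \<Rightarrow> 'a surface_map set" where
  "Homeo Z = {h \<in> extensional (topspace (surface Z)).
     homeomorphic_map (surface Z) (surface Z) h \<and> (\<forall>w\<in>leaves Z. h ` w \<in> leaves Z)}"

definition Homeo_topology :: "('a, 'b) gluing \<Rightarrow> 'a surface_map topology" where
  "Homeo_topology Z = subtopology (compact_open_topology (surface Z) (surface Z)) (Homeo Z)"

definition Homeo0 :: "('a, 'b) gluing \<Rightarrow> 'a surface_map set" where
  "Homeo0 Z =
     path_component_of_set (Homeo_topology Z) (restrict (\<lambda>z. z) (topspace (surface Z)))"

definition Homeo0' :: "('a, 'b) gluing \<Rightarrow> 'a surface_map set" where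
  "Homeo0' Z = {h \<in> Homeo Z. \<forall>w\<in>leaves Z. h ` w = w \<and> preserves_orientation (surface Z) h w}"

definition is_lifting ::
    "('a, 'b) gluing \<Rightarrow> 'a surface_map \<Rightarrow> 'a \<Rightarrow> (real \<times> real \<Rightarrow> real \<times> real) \<Rightarrow> bool" where
  "is_lifting Z h \<alpha> g \<longleftrightarrow>
     g \<in> extensional (strip Z \<alpha>) \<and>
     homeomorphic_map (top_of_set (strip Z \<alpha>)) (top_of_set (strip Z \<alpha>)) g \<and>
     (\<forall>p\<in>strip Z \<alpha>. chart Z \<alpha> (g p) = h (chart Z \<alpha> p))"

definition lifting ::
    "('a, 'b) gluing \<Rightarrow> 'a surface_map \<Rightarrow> 'a \<Rightarrow> (real \<times> real \<Rightarrow> real \<times> real)" where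
  "lifting Z h \<alpha> = (THE g. is_lifting Z h \<alpha> g)"

text \<open>\<open>g(x, y) = (l(x, y), m(y))\<close>. The map \<open>m\<close> is defined on the whole of \<open>[-1, 1]\<close>, even if the
  strip \<open>S\<close> has no points on one of its sides; it is determined by \<open>g\<close>.\<close>

definition strip_coordinates ::
    "(real \<times> real) set \<Rightarrow> (real \<times> real \<Rightarrow> real \<times> real) \<Rightarrow>
     (real \<times> real \<Rightarrow> real) \<Rightarrow> (real \<Rightarrow> real) \<Rightarrow> bool" where
  "strip_coordinates S g l m \<longleftrightarrow>
     homeomorphic_map (top_of_set {-1..1}) (top_of_set {-1..1}) m \<and>
     continuous_on S l \<and>
     (\<forall>(x, y)\<in>S. g (x, y) = (l (x, y), m y))"

end

theory Submission
  imports Defs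
begin

text \<open>
  The quotient map from the disjoint union of the strips is proper, because the boundary intervals
  of a strip form a locally finite family of closed sets and fibres have at most two points. Hence
  charts are closed maps and \<open>id \<times> q\<close> is a quotient map for every factor.

  A foliated homeomorphism of a reduced surface preserves the set of special and boundary leaves:
  boundary leaves are detected by invariance of domain, and special leaves by leaf segments escaping
  to the missing end points of boundary intervals. Along an isotopy each of these leaves and each
  open strip is therefore invariant, and the liftings stay increasing in both coordinates.

  Conversely, let the liftings \<open>g = (\<lambda>, \<mu>)\<close> of \<open>h\<close> be increasing in this sense. Then so are the maps
  \<open>(x, y) \<mapsto> ((1 - s) \<lambda>(x, y) + s x, (1 - t) \<mu>(y) + t y)\<close>, and they fit together because the gluing
  maps are affine. Letting \<open>t\<close> run from \<open>0\<close> to \<open>1\<close> with \<open>s = 0\<close> retracts onto the maps that fix every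
  leaf, and \<open>s = t\<close> contracts everything to the identity. The deformation is continuous in \<open>h\<close> because
  liftings depend continuously on \<open>h\<close> in the compact-open topology.
\<close>

section \<open>Model strips\<close>

text \<open>The obstacle throughout is that a chart need not be injective: two boundary intervals of
  one strip may be glued to each other. So a lifting cannot be read off by conjugating
  \<open>h\<close> with a chart; it is built over \<open>open_strip\<close>, where charts are open
  embeddings, and then extended to the boundary. For the same reason invariance of a leaf of the
  surface does not at once give invariance of its intervals in the strip, since a lifting might
  exchange two intervals glued together. Monotonicity of \<mu> excludes this for intervals on
  opposite sides, monotonicity of \<lambda> for intervals on one side.

  Everything is proved for one set, \<open>liftable\<close>, whose members have liftings that are
  increasing and carry each boundary interval onto itself. These properties survive linear
  interpolation with the identity, which is why a straight-line deformation works. Reducedness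
  enters through one fact: every boundary interval then gives a leaf that is special or lies in the
  boundary of the surface, so an isotopy can neither move such a leaf nor push a point across it
  into another strip.\<close>

abbreviation open_strip :: "(real \<times> real) set" where
  "open_strip \<equiv> UNIV \<times> {-1<..<1}"

lemma
  assumes "model_strip S"
  shows open_strip_subset: "open_strip \<subseteq> S" and model_strip_subset: "S \<subseteq> UNIV \<times> {-1..1}"
  using assms by (auto simp: model_strip_def)

lemma open_open_strip: "open open_strip"
  by (simp add: open_Times)

lemma mem_strip_boundary: "p \<in> strip_boundary S \<longleftrightarrow> p \<in> S \<and> snd p \<in> {-1, 1}"
  by (cases p) (auto simp: strip_boundary_def strip_side_def)

lemma strip_boundary_eq: "model_strip S \<Longrightarrow> strip_boundary S = S - open_strip"
  using model_strip_subset[of S] by (force simp: mem_strip_boundary)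

text \<open>The intervals of the given family are the connected components: the disjoint closures
  make a member closed in the boundary, a box around it makes it open, so it is clopen in its
  component. The absence of the end points from \<open>S\<close> is a by-product of the same
  closedness.\<close>

lemma boundary_intervals_cases:
  assumes S: "model_strip S" and J: "J \<in> boundary_intervals S"
  obtains a b e where "a < b" "e \<in> {-1, 1}" "J = {a<..<b} \<times> {e}" "J \<subseteq> S"
    "(a, e) \<notin> S" "(b, e) \<notin> S"
proof -
  from S obtain \<J> where 1: "\<forall>J\<in>\<J>. \<exists>a b e. a < b \<and> e \<in> {-1, 1} \<and> J = {a<..<b} \<times> {e::real}"
    and 2: "pairwise (\<lambda>J K. disjnt (closure J) (closure K)) \<J>"
    and 3: "S \<inter> (UNIV \<times> {-1, 1}) = \<Union>\<J>"
    unfolding model_strip_def by (elim conjE exE) (rule that)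
  have bd: "strip_boundary S = \<Union>\<J>"
    using 3 by (auto simp: strip_boundary_def strip_side_def)
  obtain p where p: "p \<in> J" "J \<subseteq> strip_boundary S"
    using J in_components_nonempty in_components_subset unfolding boundary_intervals_def by blast
  then obtain K where K: "K \<in> \<J>" "p \<in> K" using bd by auto
  obtain a b e where abe: "a < b" "e \<in> {-1, 1}" "K = {a<..<b} \<times> {e}" using 1 K by blast
  have clK: "closure K = {a..b} \<times> {e}" using abe by (simp add: closure_Times)
  \<comment> \<open>A boundary point in the closure of \<open>K\<close> lies in some member
    \<open>L\<close>; were \<open>L\<close> different from \<open>K\<close>, their closures would
    meet.\<close>
  have cl: "strip_boundary S \<inter> closure K = K"
  proof
    show "strip_boundary S \<inter> closure K \<subseteq> K"
    proof clarify
      fix x y assume xy: "(x, y) \<in> strip_boundary S" "(x, y) \<in> closure K"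
      then obtain L where L: "L \<in> \<J>" "(x, y) \<in> L" using bd by auto
      then have "(x, y) \<in> closure L" using closure_subset by blast
      then have "L = K" using 2 xy L K by (auto simp: pairwise_def disjnt_iff)
      then show "(x, y) \<in> K" using L by simp
    qed
  qed (use K bd closure_subset in auto)
  \<comment> \<open>Half-height 1 misses the opposite side, since the two sides are at distance
    2.\<close>
  have op: "strip_boundary S \<inter> {a<..<b} \<times> {e-1<..<e+1} = K"
  proof -
    have "y = e" if "(x, y) \<in> strip_boundary S" "e - 1 < y" "y < e + 1" for x y
      using that abe(2) by (auto simp: mem_strip_boundary)
    moreover have "K \<subseteq> strip_boundary S" using K bd by blast
    ultimately show ?thesis using abe(3) by auto
  qed
  have "connected K" unfolding abe(3) by (intro connected_Times) auto
  then have KJ: "K \<subseteq> J"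
    using K bd p J components_maximal[of J "strip_boundary S" K]
    unfolding boundary_intervals_def by (metis Union_upper disjoint_iff)
  have Js: "J \<subseteq> strip_boundary S" "connected J"
    using J in_components_subset in_components_connected unfolding boundary_intervals_def by auto
  have "openin (top_of_set J) K"
    unfolding openin_open using op KJ Js
      by (intro exI[of _ "{a<..<b} \<times> {e-1<..<e+1}"]) (auto simp: open_Times)
  moreover have "closedin (top_of_set J) K"
    unfolding closedin_closed using cl KJ Js by (intro exI[of _ "closure K"]) auto
  ultimately have "K = J" using Js(2) K(2) unfolding connected_clopen by blast
  moreover have "(a, e) \<notin> S" "(b, e) \<notin> S"
  proof -
    have "(c, e) \<notin> strip_boundary S" if "c \<in> {a, b}" for c
    proof
      assume "(c, e) \<in> strip_boundary S"
      then have "(c, e) \<in> K" using cl clK that abe(1) by auto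
      then show False using abe that by auto
    qed
    then show "(a, e) \<notin> S" "(b, e) \<notin> S" using abe by (auto simp: mem_strip_boundary)
  qed
  ultimately show ?thesis using that[OF abe(1,2)] abe(3) Js
    unfolding subset_iff mem_strip_boundary by blast
qed

lemma boundary_interval_of_point:
  assumes "p \<in> strip_boundary S"
  obtains J where "J \<in> boundary_intervals S" "p \<in> J"
  using assms Union_components[of "strip_boundary S"] unfolding boundary_intervals_def by blast

lemma boundary_intervals_subset: "J \<in> boundary_intervals S \<Longrightarrow> J \<subseteq> strip_boundary S"
  unfolding boundary_intervals_def by (rule in_components_subset)

lemma boundary_intervals_unique:
  "\<lbrakk>J \<in> boundary_intervals S; K \<in> boundary_intervals S; p \<in> J; p \<in> K\<rbrakk> \<Longrightarrow> J = K"
  unfolding boundary_intervals_def using components_nonoverlap by blast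

lemma boundary_interval_convex:
  assumes "model_strip S" "J \<in> boundary_intervals S" shows "convex J"
proof -
  obtain a b e where "J = {a<..<b} \<times> {e}" using boundary_intervals_cases[OF assms] by metis
  then show ?thesis by (simp add: convex_Times)
qed

text \<open>The open box over the interval, of half-height 1, reaches neither the opposite side nor
  another interval of the same side. A disc inside it expresses the local finiteness on which
  closedness of the quotient map rests.\<close>

lemma boundary_interval_nhd:
  assumes S: "model_strip S" and J: "J \<in> boundary_intervals S" and p: "p \<in> J"
  obtains d where "d > 0" "ball p d \<inter> (UNIV \<times> {-1..1}) \<subseteq> S" "ball p d \<inter> strip_boundary S \<subseteq> J"
proof -
  obtain a b e where abe: "a < b" "e \<in> {-1, 1}" "J = {a<..<b} \<times> {e}" "J \<subseteq> S"
    using boundary_intervals_cases[OF S J] by metis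
  have "open ({a<..<b} \<times> {e-1<..<e+1})" "p \<in> {a<..<b} \<times> {e-1<..<e+1}"
    using p abe by (auto simp: open_Times)
  then obtain d where d: "d > 0" "ball p d \<subseteq> {a<..<b} \<times> {e-1<..<e+1}"
    using openE by blast
  have *: "q \<in> J" if "q \<in> ball p d" "snd q \<in> {-1,1}" for q
    using subsetD[OF d(2) that(1)] that(2) abe by (cases q) auto
  have "q \<in> S" if q: "q \<in> ball p d" "snd q \<in> {-1..1}" for q
  proof (cases "snd q \<in> {-1,1}")
    case True then show ?thesis using *[OF q(1)] abe(4) by blast
  next
    case False then have "q \<in> open_strip" using q by (cases q) auto
    then show ?thesis using open_strip_subset[OF S] by blast
  qed
  then have "ball p d \<inter> (UNIV \<times> {-1..1}) \<subseteq> S" by auto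
  moreover have "ball p d \<inter> strip_boundary S \<subseteq> J"
    using * unfolding subset_iff Int_iff mem_strip_boundary by blast
  ultimately show ?thesis using that[OF d(1)] by blast
qed

text \<open>Supplies the compact convex neighbourhoods (discs cut by the closed band) that serve
  later as the compact sets in subbasic neighbourhoods of the compact-open topology.\<close>

lemma strip_nhd:
  assumes S: "model_strip S" and p: "p \<in> S"
  obtains d where "d > 0" "cball p d \<inter> (UNIV \<times> {-1..1}) \<subseteq> S"
proof (cases "p \<in> strip_boundary S")
  case True
  then obtain J where "J \<in> boundary_intervals S" "p \<in> J" by (rule boundary_interval_of_point)
  then obtain d where d: "d > 0" "ball p d \<inter> (UNIV \<times> {-1..1}) \<subseteq> S"
    using boundary_interval_nhd[OF S] by metis
  moreover have "cball p (d/2) \<subseteq> ball p d" using d by auto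
  ultimately show ?thesis using that[of "d/2"] by auto
next
  case False
  then have "p \<in> open_strip" using p strip_boundary_eq[OF S] by auto
  then obtain d where "d > 0" "cball p d \<subseteq> open_strip"
    using open_open_strip open_contains_cball by blast
  then show ?thesis using that[of d] open_strip_subset[OF S] by auto
qed

lemma strip_boundary_closedin:
  assumes "model_strip S" shows "closedin (top_of_set S) (strip_boundary S)"
  unfolding strip_boundary_eq[OF assms] Diff_eq
  by (rule closedin_closed_Int) (rule closed_Compl[OF open_open_strip])

text \<open>Both an interval and the union of the others are relatively open in the boundary, by
  local finiteness. The second claim is what allows one interval to be separated from all the rest
  at once.\<close>

lemma boundary_interval_closedin:
  assumes S: "model_strip S" and J: "J \<in> boundary_intervals S"
  shows "closedin (top_of_set S) J" "closedin (top_of_set S) (strip_boundary S - J)"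
proof -
  have nh: "\<exists>d>0. ball p d \<inter> strip_boundary S \<subseteq> K" if "p \<in> K" "K \<in> boundary_intervals S" for p K
    using boundary_interval_nhd[OF S that(2,1)] by metis
  have 1: "openin (top_of_set (strip_boundary S)) J"
    unfolding openin_euclidean_subtopology_iff
  proof (intro conjI ballI)
    fix p assume "p \<in> J"
    then obtain d where "d > 0" "ball p d \<inter> strip_boundary S \<subseteq> J" using nh[OF _ J] by blast
    then show "\<exists>e>0. \<forall>x'\<in>strip_boundary S. dist x' p < e \<longrightarrow> x' \<in> J"
      by (intro exI[of _ d]) (auto simp: subset_iff dist_commute)
  qed (use boundary_intervals_subset[OF J] in auto)
  have 2: "openin (top_of_set (strip_boundary S)) (strip_boundary S - J)"
    unfolding openin_euclidean_subtopology_iff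
  proof (intro conjI ballI)
    fix p assume p: "p \<in> strip_boundary S - J"
    then obtain K where K: "K \<in> boundary_intervals S" "p \<in> K"
      using boundary_interval_of_point by blast
    then have "K \<inter> J = {}" using p J boundary_intervals_unique by blast
    moreover obtain d where "d > 0" "ball p d \<inter> strip_boundary S \<subseteq> K" using nh[OF K(2,1)] by blast
    ultimately show "\<exists>e>0. \<forall>x'\<in>strip_boundary S. dist x' p < e \<longrightarrow> x' \<in> strip_boundary S - J"
      by (intro exI[of _ d]) (fastforce simp: subset_iff dist_commute)
  qed auto
  have "closedin (top_of_set (strip_boundary S)) J"
    using 2 boundary_intervals_subset[OF J] by (auto simp: closedin_def)
  moreover have "closedin (top_of_set (strip_boundary S)) (strip_boundary S - J)"
    using 1 by auto
  ultimately show "closedin (top_of_set S) J" "closedin (top_of_set S) (strip_boundary S - J)"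
    using strip_boundary_closedin[OF S] by (auto intro: closedin_trans)
qed

lemma strip_subset_closure:
  assumes "model_strip S" shows "S \<subseteq> closure open_strip"
  using model_strip_subset[OF assms] by (simp add: closure_Times)

section \<open>Gluing\<close>

text \<open>The symmetric version of the gluing: \<open>\<phi>\<close> identifies the interval \<open>J\<close> of the strip \<open>\<alpha>\<close> with
  the interval \<open>J'\<close> of the strip \<open>\<alpha>'\<close>.\<close>

definition glued_by ::
    "('a, 'b) gluing \<Rightarrow> 'a \<Rightarrow> (real \<times> real) set \<Rightarrow> 'a \<Rightarrow> (real \<times> real) set \<Rightarrow> (real \<times> real \<Rightarrow> real \<times> real) \<Rightarrow> bool"
  where "glued_by Z \<alpha> J \<alpha>' J' \<phi> \<longleftrightarrow> (\<exists>\<beta>\<in>glue_index Z.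
    glue_Y Z \<beta> = (\<alpha>, J) \<and> glue_X Z \<beta> = (\<alpha>', J') \<and> \<phi> = glue_map Z \<beta> \<or>
    glue_X Z \<beta> = (\<alpha>, J) \<and> glue_Y Z \<beta> = (\<alpha>', J') \<and> \<phi> = inv_into J' (glue_map Z \<beta>))"

locale stripped =
  fixes Z :: "('a, 'b) gluing"
  assumes stripped: "stripped_surface Z"
begin

abbreviation "A \<equiv> strip_index Z"
abbreviation "S \<equiv> strip Z"
abbreviation "q \<equiv> quotient_proj Z"
abbreviation "\<xi> \<equiv> chart Z"

lemma model: "\<alpha> \<in> A \<Longrightarrow> model_strip (S \<alpha>)"
  using stripped by (auto simp: stripped_surface_def)

lemma glue_intervals:
  assumes "\<beta> \<in> glue_index Z"
  shows "fst (glue_X Z \<beta>) \<in> A" "snd (glue_X Z \<beta>) \<in> boundary_intervals (S (fst (glue_X Z \<beta>)))"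
    "fst (glue_Y Z \<beta>) \<in> A" "snd (glue_Y Z \<beta>) \<in> boundary_intervals (S (fst (glue_Y Z \<beta>)))"
    "affine_homeomorphism (snd (glue_Y Z \<beta>)) (snd (glue_X Z \<beta>)) (glue_map Z \<beta>)"
  using stripped assms by (auto simp: stripped_surface_def interval_of_strips_def)

lemma glued_by_intervals:
  assumes "glued_by Z \<alpha> J \<alpha>' J' \<phi>"
  shows "\<alpha> \<in> A" "\<alpha>' \<in> A" "J \<in> boundary_intervals (S \<alpha>)" "J' \<in> boundary_intervals (S \<alpha>')"
  using assms glue_intervals unfolding glued_by_def by (metis fst_conv snd_conv)+

text \<open>Affinity is part of the definition for the first coordinate only. The second coordinate
  is constant because the target lies on one horizontal line, and the slope is nonzero by
  injectivity.\<close>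

lemma glue_map_affine:
  assumes \<beta>: "\<beta> \<in> glue_index Z"
  obtains c d e e' where "c \<noteq> 0" "snd (glue_Y Z \<beta>) \<subseteq> UNIV \<times> {e}" "snd (glue_X Z \<beta>) \<subseteq> UNIV \<times> {e'}"
    "bij_betw (glue_map Z \<beta>) (snd (glue_Y Z \<beta>)) (snd (glue_X Z \<beta>))"
    "\<And>p. p \<in> snd (glue_Y Z \<beta>) \<Longrightarrow> glue_map Z \<beta> p = (c * fst p + d, e')"
proof -
  let ?Y = "snd (glue_Y Z \<beta>)" and ?X = "snd (glue_X Z \<beta>)" and ?\<phi> = "glue_map Z \<beta>"
  obtain a b e where Y: "a < b" "?Y = {a<..<b} \<times> {e}"
    using boundary_intervals_cases[OF model[OF glue_intervals(3)[OF \<beta>]] glue_intervals(4)[OF \<beta>]]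
      by metis
  obtain a' b' e' where X: "a' < b'" "?X = {a'<..<b'} \<times> {e'}"
    using boundary_intervals_cases[OF model[OF glue_intervals(1)[OF \<beta>]] glue_intervals(2)[OF \<beta>]]
      by metis
  obtain c d where cd: "\<And>p. p \<in> ?Y \<Longrightarrow> fst (?\<phi> p) = c * fst p + d"
    and h: "homeomorphic_map (top_of_set ?Y) (top_of_set ?X) ?\<phi>"
    using glue_intervals(5)[OF \<beta>] unfolding affine_homeomorphism_def by blast
  have bij: "bij_betw ?\<phi> ?Y ?X"
    using homeomorphic_imp_injective_map[OF h] homeomorphic_imp_surjective_map[OF h]
      by (auto simp: bij_betw_def)
  have \<phi>: "?\<phi> p = (c * fst p + d, e')" if "p \<in> ?Y" for p
    using cd[OF that] bij_betwE[OF bij] that X by (metis mem_Times_iff prod.collapse singletonD)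
  have "c \<noteq> 0"
  proof
    assume c: "c = 0"
    obtain m where m: "a < m" "m < b" using dense[OF Y(1)] by blast
    then obtain n where n: "a < n" "n < m" using dense by blast
    have mem: "(m, e) \<in> ?Y" "(n, e) \<in> ?Y" using Y m n by auto
    then have "?\<phi> (m, e) = ?\<phi> (n, e)" using \<phi>[OF mem(1)] \<phi>[OF mem(2)] c by simp
    then have "(m, e) = (n, e)" using inj_onD[OF bij_betw_imp_inj_on[OF bij]] mem by blast
    then show False using n by simp
  qed
  then show ?thesis by (rule that[OF _ _ _ bij \<phi>]) (use X Y in auto)
qed

lemma glued_byE:
  assumes "glued_by Z \<alpha> J \<alpha>' J' \<phi>"
  obtains (forward) \<beta> where "\<beta> \<in> glue_index Z" "glue_Y Z \<beta> = (\<alpha>, J)" "glue_X Z \<beta> = (\<alpha>', J')"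
      "\<phi> = glue_map Z \<beta>"
  | (backward) \<beta> where "\<beta> \<in> glue_index Z" "glue_X Z \<beta> = (\<alpha>, J)" "glue_Y Z \<beta> = (\<alpha>', J')"
      "\<phi> = inv_into J' (glue_map Z \<beta>)"
  using assms unfolding glued_by_def by blast

lemma glued_by_affine:
  assumes "glued_by Z \<alpha> J \<alpha>' J' \<phi>"
  obtains c d e' where "J' \<subseteq> UNIV \<times> {e'}" "bij_betw \<phi> J J'" "\<And>p. p \<in> J \<Longrightarrow> \<phi> p = (c * fst p + d, e')"
  using assms
proof (cases rule: glued_byE)
  case (forward \<beta>)
  obtain c d e e' where "c \<noteq> 0" "snd (glue_Y Z \<beta>) \<subseteq> UNIV \<times> {e}" "snd (glue_X Z \<beta>) \<subseteq> UNIV \<times> {e'}"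
    "bij_betw (glue_map Z \<beta>) (snd (glue_Y Z \<beta>)) (snd (glue_X Z \<beta>))"
    "\<And>p. p \<in> snd (glue_Y Z \<beta>) \<Longrightarrow> glue_map Z \<beta> p = (c * fst p + d, e')"
    by (rule glue_map_affine[OF forward(1)]) (rule that)
  then show ?thesis using that[of e' c d] forward by auto
next
  case (backward \<beta>)
  obtain c d e e' where c: "c \<noteq> 0" and Y: "snd (glue_Y Z \<beta>) \<subseteq> UNIV \<times> {e}"
    "snd (glue_X Z \<beta>) \<subseteq> UNIV \<times> {e'}"
    and "bij_betw (glue_map Z \<beta>) (snd (glue_Y Z \<beta>)) (snd (glue_X Z \<beta>))"
    and eq: "\<And>p. p \<in> snd (glue_Y Z \<beta>) \<Longrightarrow> glue_map Z \<beta> p = (c * fst p + d, e')"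
    by (rule glue_map_affine[OF backward(1)]) (rule that)
  then have b: "bij_betw (glue_map Z \<beta>) J' J" using backward by simp
  \<comment> \<open>Solving c x + d = fst p for x gives slope 1/c and intercept -d/c.\<close>
  have "\<phi> p = (1/c * fst p + (- d/c), e)" if p: "p \<in> J" for p
  proof -
    have *: "\<phi> p \<in> J'" "glue_map Z \<beta> (\<phi> p) = p"
      using backward(4) p bij_betw_inv_into_right[OF b p] bij_betwE[OF bij_betw_inv_into[OF b]]
        by auto
    then have "p = (c * fst (\<phi> p) + d, e')" using eq[of "\<phi> p"] backward(3) by simp
    then have "fst p = c * fst (\<phi> p) + d" by (metis fst_conv)
    moreover have "snd (\<phi> p) = e" using * backward(3) Y(1) by (auto simp: mem_Times_iff)
    ultimately show ?thesis using c by (auto simp: prod_eq_iff field_simps)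
  qed
  then show ?thesis using that[of e "1/c" "-d/c"] Y backward bij_betw_inv_into[OF b] by auto
qed

lemma glued_by_bij:
  assumes "glued_by Z \<alpha> J \<alpha>' J' \<phi>" shows "bij_betw \<phi> J J'"
  by (rule glued_by_affine[OF assms])

lemma glued_by_sym:
  assumes "glued_by Z \<alpha> J \<alpha>' J' \<phi>"
  obtains \<psi> where "glued_by Z \<alpha>' J' \<alpha> J \<psi>" "\<And>p. p \<in> J \<Longrightarrow> \<psi> (\<phi> p) = p"
    "\<And>p. p \<in> J' \<Longrightarrow> \<phi> (\<psi> p) = p"
  using assms
proof (cases rule: glued_byE)
  case (forward \<beta>)
  then have "glued_by Z \<alpha>' J' \<alpha> J (inv_into J (glue_map Z \<beta>))" unfolding glued_by_def by blast
  then show ?thesis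
    using that forward(4) bij_betw_inv_into_right[OF glued_by_bij[OF assms]]
      bij_betw_inv_into_left[OF glued_by_bij[OF assms]] by auto
next
  case (backward \<beta>)
  have bij: "bij_betw (glue_map Z \<beta>) J' J"
    using glue_map_affine[OF backward(1)] backward(2,3) by (metis snd_conv)
  have "glued_by Z \<alpha>' J' \<alpha> J (glue_map Z \<beta>)" using backward unfolding glued_by_def by blast
  then show ?thesis
    using that backward(4) bij_betw_inv_into_right[OF bij] bij_betw_inv_into_left[OF bij] by auto
qed

text \<open>Since all intervals X and Y are pairwise distinct, an interval occurs at most once and
  in only one of the two roles; the gluing is therefore a partial involution on intervals.\<close>

lemma glued_by_unique:
  assumes "glued_by Z \<alpha> J \<alpha>1 J1 \<phi>1" "glued_by Z \<alpha> J \<alpha>2 J2 \<phi>2"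
  shows "\<alpha>1 = \<alpha>2" "J1 = J2" "\<phi>1 = \<phi>2"
proof -
  have inj: "\<And>\<beta> \<beta>'. \<beta> \<in> glue_index Z \<Longrightarrow> \<beta>' \<in> glue_index Z \<Longrightarrow> glue_X Z \<beta> = glue_X Z \<beta>' \<Longrightarrow> \<beta> = \<beta>'"
    "\<And>\<beta> \<beta>'. \<beta> \<in> glue_index Z \<Longrightarrow> \<beta>' \<in> glue_index Z \<Longrightarrow> glue_Y Z \<beta> = glue_Y Z \<beta>' \<Longrightarrow> \<beta> = \<beta>'"
    "\<And>\<beta> \<beta>'. \<beta> \<in> glue_index Z \<Longrightarrow> \<beta>' \<in> glue_index Z \<Longrightarrow> glue_X Z \<beta> \<noteq> glue_Y Z \<beta>'"
    using stripped unfolding stripped_surface_def by (blast dest: inj_onD)+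
  show "\<alpha>1 = \<alpha>2" "J1 = J2" "\<phi>1 = \<phi>2"
    using assms inj unfolding glued_by_def by (metis fst_conv snd_conv)+
qed

lemma glued_by_distinct: "glued_by Z \<alpha> J \<alpha>' J' \<phi> \<Longrightarrow> (\<alpha>, J) \<noteq> (\<alpha>', J')"
  using stripped unfolding stripped_surface_def glued_by_def by (metis Int_iff empty_iff imageI)

abbreviation "glued \<equiv> glue_rel Z \<union> (glue_rel Z)\<inverse>"

lemma glued_iff:
  "((\<alpha>, p), (\<alpha>', p')) \<in> glued \<longleftrightarrow> (\<exists>J J' \<phi>. glued_by Z \<alpha> J \<alpha>' J' \<phi> \<and> p \<in> J \<and> p' = \<phi> p)"
proof
  assume "((\<alpha>, p), (\<alpha>', p')) \<in> glued"
  then consider "((\<alpha>, p), (\<alpha>', p')) \<in> glue_rel Z" | "((\<alpha>', p'), (\<alpha>, p)) \<in> glue_rel Z" by auto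
  then show "\<exists>J J' \<phi>. glued_by Z \<alpha> J \<alpha>' J' \<phi> \<and> p \<in> J \<and> p' = \<phi> p"
  proof cases
    case 1
    then obtain \<beta> where \<beta>: "\<beta> \<in> glue_index Z" "\<alpha> = fst (glue_Y Z \<beta>)" "\<alpha>' = fst (glue_X Z \<beta>)"
      "p \<in> snd (glue_Y Z \<beta>)" "p' = glue_map Z \<beta> p"
      unfolding glue_rel_def by auto
    then have "glued_by Z \<alpha> (snd (glue_Y Z \<beta>)) \<alpha>' (snd (glue_X Z \<beta>)) (glue_map Z \<beta>)"
      unfolding glued_by_def by (metis prod.collapse)
    then show ?thesis using \<beta> by blast
  next
    case 2
    then obtain \<beta> where \<beta>: "\<beta> \<in> glue_index Z" "\<alpha>' = fst (glue_Y Z \<beta>)" "\<alpha> = fst (glue_X Z \<beta>)"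
      "p' \<in> snd (glue_Y Z \<beta>)" "p = glue_map Z \<beta> p'"
      unfolding glue_rel_def by auto
    then have "glued_by Z \<alpha>' (snd (glue_Y Z \<beta>)) \<alpha> (snd (glue_X Z \<beta>)) (glue_map Z \<beta>)"
      unfolding glued_by_def by (metis prod.collapse)
    moreover from this have "p \<in> snd (glue_X Z \<beta>)"
      using \<beta> glue_map_affine[OF \<beta>(1)] bij_betwE by metis
    ultimately show ?thesis using glued_by_sym \<beta>(4,5) by metis
  qed
next
  assume "\<exists>J J' \<phi>. glued_by Z \<alpha> J \<alpha>' J' \<phi> \<and> p \<in> J \<and> p' = \<phi> p"
  then obtain J J' \<phi> where g: "glued_by Z \<alpha> J \<alpha>' J' \<phi>" "p \<in> J" "p' = \<phi> p" by blast
  from g(1) show "((\<alpha>, p), (\<alpha>', p')) \<in> glued"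
  proof (cases rule: glued_byE)
    case (forward \<beta>)
    then have "((\<alpha>, p), (\<alpha>', p')) \<in> glue_rel Z" unfolding glue_rel_def using g
      by (intro CollectI exI[of _ \<beta>]) auto
    then show ?thesis by simp
  next
    case (backward \<beta>)
    have bij: "bij_betw (glue_map Z \<beta>) J' J"
      using glue_map_affine[OF backward(1)] backward(2,3) by (metis snd_conv)
    then have "p' \<in> J'" "glue_map Z \<beta> p' = p"
      using g backward(4) bij_betw_inv_into_right[OF bij] bij_betwE[OF bij_betw_inv_into[OF bij]]
        by auto
    then have "((\<alpha>', p'), (\<alpha>, p)) \<in> glue_rel Z" unfolding glue_rel_def using backward
      by (intro CollectI exI[of _ \<beta>] exI[of _ p']) auto
    then show ?thesis by simp
  qed
qed

text \<open>A point determines its boundary interval, because the intervals are disjoint, and the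
  interval determines the gluing map. This is the source of the bound two on the size of
  fibres.\<close>

lemma glued_functional:
  assumes "(P, Q) \<in> glued" "(P, R) \<in> glued" shows "Q = R"
proof -
  obtain \<alpha> p \<beta> u \<gamma> v where eq: "P = (\<alpha>, p)" "Q = (\<beta>, u)" "R = (\<gamma>, v)"
    by (meson surj_pair)
  obtain J J' \<phi> K K' \<psi> where *: "glued_by Z \<alpha> J \<beta> J' \<phi>" "p \<in> J" "u = \<phi> p"
    "glued_by Z \<alpha> K \<gamma> K' \<psi>" "p \<in> K" "v = \<psi> p"
    using assms unfolding eq glued_iff by blast
  then have "K = J" using boundary_intervals_unique glued_by_intervals by metis
  then show ?thesis using * glued_by_unique eq by metis
qed

text \<open>For a symmetric functional relation a second step leads back to the start, so the
  generated equivalence relation adds nothing beyond one step.\<close>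

lemma proj_eq_insert: "q P = insert P {Q. (P, Q) \<in> glued}"
proof -
  have "Q = P \<or> (P, Q) \<in> glued" if "(P, Q) \<in> glued\<^sup>*" for Q
    using that
  proof induction
    case (step Q R)
    then consider "Q = P" | "(P, Q) \<in> glued" by blast
    then show ?case
    proof cases
      case 2
      have "(Q, P) \<in> glued" using 2 by auto
      then show ?thesis using glued_functional step by blast
    qed (use step in auto)
  qed auto
  then show ?thesis unfolding quotient_proj_def by auto
qed

lemma proj_eq_iff: "q P = q Q \<longleftrightarrow> P = Q \<or> (P, Q) \<in> glued"
proof
  assume "q P = q Q"
  moreover have "Q \<in> q Q" by (simp add: proj_eq_insert)
  ultimately show "P = Q \<or> (P, Q) \<in> glued" unfolding proj_eq_insert by blast
next
  assume r: "P = Q \<or> (P, Q) \<in> glued"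
  have "q P = q Q" if pq: "(P, Q) \<in> glued"
  proof -
    have qp: "(Q, P) \<in> glued" using pq by auto
    show ?thesis unfolding proj_eq_insert
      using glued_functional[OF pq] glued_functional[OF qp] pq qp by blast
  qed
  then show "q P = q Q" using r by blast
qed

lemma chart_eq_iff: "\<xi> \<alpha> p = \<xi> \<alpha>' p' \<longleftrightarrow>
    \<alpha> = \<alpha>' \<and> p = p' \<or> (\<exists>J J' \<phi>. glued_by Z \<alpha> J \<alpha>' J' \<phi> \<and> p \<in> J \<and> p' = \<phi> p)"
  by (simp add: chart_def proj_eq_iff glued_iff[symmetric])

lemma chart_glued: "\<lbrakk>glued_by Z \<alpha> J \<alpha>' J' \<phi>; p \<in> J\<rbrakk> \<Longrightarrow> \<xi> \<alpha>' (\<phi> p) = \<xi> \<alpha> p"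
  by (metis chart_eq_iff)

lemma chart_eq_interior:
  assumes "\<xi> \<alpha> p = \<xi> \<alpha>' p'" "p \<in> open_strip" shows "\<alpha>' = \<alpha> \<and> p' = p"
proof -
  have False if "glued_by Z \<alpha> J \<alpha>' J' \<phi>" "p \<in> J" for J J' \<phi>
  proof -
    have "p \<in> strip_boundary (S \<alpha>)"
      using that boundary_intervals_subset glued_by_intervals(3) by blast
    then show False using assms(2) by (auto simp: mem_strip_boundary)
  qed
  then show ?thesis using assms(1) unfolding chart_eq_iff by blast
qed

text \<open>No interval is glued to itself, by \<open>glued_by_distinct\<close>; a chart can only
  identify points of two different intervals.\<close>

lemma chart_inj_interval: 
  assumes "J \<in> boundary_intervals (S \<alpha>)" shows "inj_on (\<xi> \<alpha>) J"
proof (rule inj_onI)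
  fix p p' assume p: "p \<in> J" "p' \<in> J" "\<xi> \<alpha> p = \<xi> \<alpha> p'"
  have False if g: "glued_by Z \<alpha> K \<alpha> K' \<phi>" "p \<in> K" "p' = \<phi> p" for K K' \<phi>
  proof -
    have "K = J" using g p glued_by_intervals(3) boundary_intervals_unique assms by metis
    moreover have "p' \<in> K'" using g glued_by_affine[OF g(1)] bij_betwE by metis
    then have "K' = J" using g p glued_by_intervals(4) boundary_intervals_unique assms by metis
    ultimately show False using glued_by_distinct[OF g(1)] by simp
  qed
  then show "p = p'" using p(3) unfolding chart_eq_iff by blast
qed

section \<open>The topology of the surface\<close>

abbreviation "T \<equiv> surface Z"
abbreviation "\<D> \<equiv> sum_topology (\<lambda>\<alpha>. top_of_set (S \<alpha>)) A"

lemma quotient_map_proj: "quotient_map \<D> T q"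
  unfolding surface_def by (rule quotient_map_quotient_topology)

lemma topspace_surface: "topspace T = (\<Union>\<alpha>\<in>A. \<xi> \<alpha> ` S \<alpha>)"
  by (auto simp: surface_def chart_def)

lemma chart_in_topspace: "\<lbrakk>\<alpha> \<in> A; p \<in> S \<alpha>\<rbrakk> \<Longrightarrow> \<xi> \<alpha> p \<in> topspace T"
  by (auto simp: topspace_surface)

lemma chart_eq_comp: "\<xi> \<alpha> = q \<circ> Pair \<alpha>"
  by (auto simp: chart_def)

lemma continuous_chart: "\<alpha> \<in> A \<Longrightarrow> continuous_map (top_of_set (S \<alpha>)) T (\<xi> \<alpha>)"
  unfolding chart_eq_comp
  by (rule continuous_map_compose[OF continuous_map_component_injection quotient_imp_continuous_map[OF quotient_map_proj]])

lemma openin_surface: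
  "openin T U \<longleftrightarrow> U \<subseteq> topspace T \<and> (\<forall>\<alpha>\<in>A. openin (top_of_set (S \<alpha>)) {p \<in> S \<alpha>. \<xi> \<alpha> p \<in> U})"
proof -
  have "{P \<in> Sigma A S. q P \<in> U} \<subseteq> Sigma A S" by auto
  moreover have "{x. (i, x) \<in> {P \<in> Sigma A S. q P \<in> U}} = {p \<in> S i. \<xi> i p \<in> U}" if "i \<in> A" for i
    using that by (auto simp: chart_def)
  ultimately show ?thesis
    by (simp add: surface_def openin_quotient_topology openin_sum_topology comp_def)
qed

text \<open>The saturation of \<open>C\<close> consists of \<open>C\<close> and of the points whose
  glued partner lies in \<open>C\<close>. Near a given point at most one boundary interval is
  present, hence at most one gluing map matters, and it is continuous because it is affine. So a
  point off the saturation has a whole disc off it.\<close>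

lemma closed_map_proj: "closed_map \<D> T q"
  unfolding closed_map_def
proof (intro allI impI)
  fix C assume C: "closedin \<D> C"
  have sub: "C \<subseteq> Sigma A S" using closedin_subset[OF C] by (auto simp: comp_def)
  have opn: "openin (top_of_set (S \<alpha>)) {p \<in> S \<alpha>. (\<alpha>, p) \<notin> C}" if "\<alpha> \<in> A" for \<alpha>
  proof -
    have "closedin (top_of_set (S \<alpha>)) {x. (\<alpha>, x) \<in> C}"
      using C that by (auto simp: closedin_sum_topology)
    moreover have "{p \<in> S \<alpha>. (\<alpha>, p) \<notin> C} = S \<alpha> - {x. (\<alpha>, x) \<in> C}" by auto
    ultimately show ?thesis by auto
  qed
  have key: "\<xi> \<alpha> p \<in> q ` C \<longleftrightarrow> (\<alpha>, p) \<in> C \<or> (\<exists>J \<alpha>' J' \<phi>. glued_by Z \<alpha> J \<alpha>' J' \<phi> \<and> p \<in> J \<and> (\<alpha>', \<phi> p) \<in> C)"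
    (is "?l \<longleftrightarrow> ?r") for \<alpha> p
  proof
    assume ?l
    then obtain \<alpha>' p' where c: "(\<alpha>', p') \<in> C" "\<xi> \<alpha> p = \<xi> \<alpha>' p'" by (auto simp: chart_def)
    then show ?r unfolding chart_eq_iff by blast
  next
    assume ?r
    then show ?l
    proof (elim disjE exE conjE)
      fix J \<alpha>' J' \<phi> assume "glued_by Z \<alpha> J \<alpha>' J' \<phi>" "p \<in> J" "(\<alpha>', \<phi> p) \<in> C"
      then show ?l using chart_glued by (metis chart_def image_eqI)
    qed (simp add: chart_def)
  qed
  have "openin T (topspace T - q ` C)"
    unfolding openin_surface
  proof (intro conjI ballI)
    fix \<alpha> assume \<alpha>: "\<alpha> \<in> A"
    show "openin (top_of_set (S \<alpha>)) {p \<in> S \<alpha>. \<xi> \<alpha> p \<in> topspace T - q ` C}"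
      unfolding openin_euclidean_subtopology_iff
    proof (intro conjI ballI)
      fix p assume "p \<in> {p \<in> S \<alpha>. \<xi> \<alpha> p \<in> topspace T - q ` C}"
      then have p: "p \<in> S \<alpha>" and pC: "\<xi> \<alpha> p \<notin> q ` C" by auto
      obtain d1 where d1: "d1 > 0" "\<And>p'. p' \<in> S \<alpha> \<Longrightarrow> dist p' p < d1 \<Longrightarrow> (\<alpha>, p') \<notin> C"
        using opn[OF \<alpha>] p pC unfolding openin_euclidean_subtopology_iff key by blast
      \<comment> \<open>The radius \<open>d1\<close> keeps the nearby points themselves out of
        \<open>C\<close>; the radius \<open>d2\<close> keeps their glued partners out of
        \<open>C\<close>.\<close>
      have "\<exists>d2>0. \<forall>p'\<in>S \<alpha>. dist p' p < d2 \<longrightarrow>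
          (\<forall>J \<alpha>' J' \<phi>. glued_by Z \<alpha> J \<alpha>' J' \<phi> \<and> p' \<in> J \<longrightarrow> (\<alpha>', \<phi> p') \<notin> C)"
      proof (cases "p \<in> strip_boundary (S \<alpha>)")
        case False
        then have "p \<in> open_strip" using p strip_boundary_eq[OF model[OF \<alpha>]] by auto
        then obtain d where d: "d > 0" "ball p d \<subseteq> open_strip" using open_open_strip openE by blast
        have "p' \<notin> J" if "dist p' p < d" "glued_by Z \<alpha> J \<alpha>' J' \<phi>" for p' J \<alpha>' J' \<phi>
        proof
          assume "p' \<in> J"
          then have "p' \<in> strip_boundary (S \<alpha>)"
            using that(2) boundary_intervals_subset glued_by_intervals(3) by blast
          moreover have "p' \<in> open_strip"
            using d(2) that(1) by (metis dist_commute in_mono mem_ball)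
          ultimately show False using strip_boundary_eq[OF model[OF \<alpha>]] by blast
        qed
        then show ?thesis using d(1) by blast
      next
        case True
        then obtain J where J: "J \<in> boundary_intervals (S \<alpha>)" "p \<in> J"
          using boundary_interval_of_point by blast
        obtain d where d: "d > 0" "ball p d \<inter> strip_boundary (S \<alpha>) \<subseteq> J"
          using boundary_interval_nhd[OF model[OF \<alpha>] J] by metis
        have K: "K = J" if "dist p' p < d" "glued_by Z \<alpha> K \<alpha>' J' \<phi>" "p' \<in> K" for p' K \<alpha>' J' \<phi>
        proof -
          have "p' \<in> ball p d \<inter> strip_boundary (S \<alpha>)"
            using that boundary_intervals_subset glued_by_intervals(3)
              by (fastforce simp: dist_commute)
          then have "p' \<in> J" using d(2) by blast
          then show ?thesis using that glued_by_intervals(3) J(1) boundary_intervals_unique by metis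
        qed
        show ?thesis
        proof (cases "\<exists>\<alpha>' J' \<phi>. glued_by Z \<alpha> J \<alpha>' J' \<phi>")
          case False
          then show ?thesis using d(1) K by (intro exI[of _ d]) blast
        next
          case True
          then obtain \<alpha>' J' \<phi> where g: "glued_by Z \<alpha> J \<alpha>' J' \<phi>" by blast
          then have nC: "(\<alpha>', \<phi> p) \<notin> C" using pC J key by blast
          obtain c b e' where bij: "bij_betw \<phi> J J'" and \<phi>: "\<And>p. p \<in> J \<Longrightarrow> \<phi> p = (c * fst p + b, e')"
            using glued_by_affine[OF g] by metis
          have J': "J' \<subseteq> S \<alpha>'"
            using glued_by_intervals(4)[OF g] boundary_intervals_subset
              by (force simp: mem_strip_boundary)
          have \<phi>S: "\<phi> p' \<in> S \<alpha>'" if "p' \<in> J" for p' using bij J' that bij_betwE by blast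
          have "continuous_on J (\<lambda>p. (c * fst p + b, e'))" by (intro continuous_intros)
          then have cont: "continuous_on J \<phi>" by (rule continuous_on_eq) (simp add: \<phi>)
          obtain e where e: "e > 0" "\<And>u. u \<in> S \<alpha>' \<Longrightarrow> dist u (\<phi> p) < e \<Longrightarrow> (\<alpha>', u) \<notin> C"
            using opn[OF glued_by_intervals(2)[OF g]] \<phi>S[OF J(2)] nC
            unfolding openin_euclidean_subtopology_iff by blast
          obtain d3 where d3: "d3 > 0" "\<And>p'. p' \<in> J \<Longrightarrow> dist p' p < d3 \<Longrightarrow> dist (\<phi> p') (\<phi> p) < e"
            using cont J(2) e(1) unfolding continuous_on_iff by blast
          have "(\<alpha>2, \<psi> p') \<notin> C" if "dist p' p < min d d3" "glued_by Z \<alpha> K \<alpha>2 J2 \<psi>" "p' \<in> K"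
            for p' K \<alpha>2 J2 \<psi>
          proof -
            have "K = J" using K[OF _ that(2,3)] that(1) by simp
            then have "\<alpha>2 = \<alpha>'" "\<psi> = \<phi>" "p' \<in> J" using glued_by_unique[OF g] that(2,3) by metis+
            then show ?thesis using e(2)[OF \<phi>S d3(2)] that by simp
          qed
          then show ?thesis using d(1) d3(1) by (intro exI[of _ "min d d3"]) auto
        qed
      qed
      then obtain d2 where d2: "d2 > 0"
        "\<And>p' J \<alpha>' J' \<phi>. \<lbrakk>p' \<in> S \<alpha>; dist p' p < d2; glued_by Z \<alpha> J \<alpha>' J' \<phi>; p' \<in> J\<rbrakk>
          \<Longrightarrow> (\<alpha>', \<phi> p') \<notin> C" by blast
      have "\<xi> \<alpha> p' \<in> topspace T - q ` C" if "p' \<in> S \<alpha>" "dist p' p < min d1 d2" for p'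
      proof -
        have "\<xi> \<alpha> p' \<notin> q ` C" unfolding key using d1(2) d2(2) that by (metis min_less_iff_conj)
        then show ?thesis using chart_in_topspace[OF \<alpha> that(1)] by blast
      qed
      then show "\<exists>e>0. \<forall>x'\<in>S \<alpha>. dist x' p < e \<longrightarrow> x' \<in> {p \<in> S \<alpha>. \<xi> \<alpha> p \<in> topspace T - q ` C}"
        using d1(1) d2(1) by (intro exI[of _ "min d1 d2"]) auto
    qed auto
  qed auto
  moreover have "q ` C \<subseteq> topspace T" using sub by (auto simp: topspace_surface chart_def)
  ultimately show "closedin T (q ` C)" by (simp add: closedin_def)
qed

lemma finite_fibre: "finite {P. q P = z}"
proof (cases "\<exists>P. q P = z")
  case True
  then obtain P where P: "q P = z" by blast
  have "{Q. (P, Q) \<in> glued} \<subseteq> {SOME Q. (P, Q) \<in> glued}"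
    using glued_functional by (metis (mono_tags, lifting) mem_Collect_eq singletonI someI subsetI)
  moreover have "{Q. q Q = z} \<subseteq> insert P {Q. (P, Q) \<in> glued}"
    unfolding P[symmetric] using proj_eq_iff[of P]
      by (metis (mono_tags, lifting) insertCI mem_Collect_eq subsetI)
  ultimately show ?thesis by (meson finite.emptyI finite_insert finite_subset)
next
  case False
  then have empty: "{P. q P = z} = {}" by blast
  show ?thesis unfolding empty by simp
qed

lemma proper_map_proj: "proper_map \<D> T q"
  unfolding proper_map_def
  by (intro conjI ballI closed_map_proj finite_imp_compactin) (auto intro: finite_subset[OF _ finite_fibre])

lemma finite_chart_fibre: "finite {p. \<xi> \<alpha> p = z}"
proof -
  have "{p. \<xi> \<alpha> p = z} = Pair \<alpha> -` {P. q P = z}" by (auto simp: chart_def)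
  then show ?thesis using finite_vimageI[OF finite_fibre, of "Pair \<alpha>" z] by (simp add: inj_on_def)
qed

lemma closed_map_chart: "\<alpha> \<in> A \<Longrightarrow> closed_map (top_of_set (S \<alpha>)) T (\<xi> \<alpha>)"
  unfolding chart_eq_comp using closed_map_component_injection closed_map_proj
    by (rule closed_map_compose)

lemma proper_map_chart: "\<alpha> \<in> A \<Longrightarrow> proper_map (top_of_set (S \<alpha>)) T (\<xi> \<alpha>)"
  unfolding proper_map_def
  by (intro conjI ballI closed_map_chart finite_imp_compactin) (auto intro: finite_subset[OF _ finite_chart_fibre])

text \<open>Closedness of the chart in the form of a tube lemma: the closed image of the complement
  of \<open>E\<close> is removed from the surface.\<close>

lemma chart_nhd:
  assumes "\<alpha> \<in> A" "z \<in> topspace T" "openin (top_of_set (S \<alpha>)) E"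
    and "\<And>p. p \<in> S \<alpha> \<Longrightarrow> \<xi> \<alpha> p = z \<Longrightarrow> p \<in> E"
  obtains U where "openin T U" "z \<in> U" "\<And>p. p \<in> S \<alpha> \<Longrightarrow> \<xi> \<alpha> p \<in> U \<Longrightarrow> p \<in> E"
proof
  have "closedin T (\<xi> \<alpha> ` (S \<alpha> - E))"
    using closed_map_chart[OF assms(1)] assms(3)
      unfolding closed_map_def by (simp add: closedin_diff)
  then show "openin T (topspace T - \<xi> \<alpha> ` (S \<alpha> - E))" by blast
qed (use assms in auto)

text \<open>A chart is closed even where it identifies points, so injectivity on a closed set
  suffices for an embedding. This covers single leaves, glued ones included.\<close>

lemma embedding_chart_closed:
  assumes "\<alpha> \<in> A" "closedin (top_of_set (S \<alpha>)) L" "inj_on (\<xi> \<alpha>) L"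
  shows "homeomorphic_map (top_of_set L) (subtopology T (\<xi> \<alpha> ` L)) (\<xi> \<alpha>)"
proof -
  have L: "L \<subseteq> S \<alpha>" using assms(2) closedin_imp_subset by blast
  then have eq: "subtopology (top_of_set (S \<alpha>)) L = top_of_set L"
    by (simp add: subtopology_subtopology Int_absorb1)
  have "embedding_map (top_of_set L) T (\<xi> \<alpha>)"
    using closed_map_from_subtopology[OF closed_map_chart[OF assms(1)] assms(2)]
      continuous_map_from_subtopology[OF continuous_chart[OF assms(1)], of L] assms(3)
    unfolding eq by (intro injective_closed_imp_embedding_map) auto
  then show ?thesis by (simp add: embedding_map_def)
qed

text \<open>The hypothesis \<open>sat\<close> says that no point of \<open>W\<close> is identified
  with any other point, so the preimage of the image is \<open>W\<close> in its own strip and empty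
  in all others.\<close>

lemma openin_chart_image:
  assumes \<alpha>: "\<alpha> \<in> A" and W: "openin (top_of_set (S \<alpha>)) W"
    and sat: "\<And>p \<beta> p'. \<lbrakk>p \<in> W; \<xi> \<alpha> p = \<xi> \<beta> p'\<rbrakk> \<Longrightarrow> \<beta> = \<alpha> \<and> p' = p"
  shows "openin T (\<xi> \<alpha> ` W)"
proof -
  have WS: "W \<subseteq> S \<alpha>" using W openin_imp_subset by blast
  have "{p \<in> S \<beta>. \<xi> \<beta> p \<in> \<xi> \<alpha> ` W} = (if \<beta> = \<alpha> then W else {})" for \<beta>
    using sat WS by (auto simp: image_iff) metis+
  then show ?thesis unfolding openin_surface using W WS chart_in_topspace[OF \<alpha>] by auto
qed

lemma openin_chart_interior:
  assumes "\<alpha> \<in> A" "open W" "W \<subseteq> open_strip" shows "openin T (\<xi> \<alpha> ` W)"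
proof (rule openin_chart_image[OF assms(1)])
  have "W \<subseteq> S \<alpha>" using assms open_strip_subset[OF model] by blast
  then show "openin (top_of_set (S \<alpha>)) W" using assms(2) by (rule open_subset)
next
  fix p \<beta> p' assume "p \<in> W" "\<xi> \<alpha> p = \<xi> \<beta> p'"
  then show "\<beta> = \<alpha> \<and> p' = p" using chart_eq_interior assms(3) by blast
qed

lemma inj_chart_interior: "inj_on (\<xi> \<alpha>) open_strip"
  by (rule inj_onI) (metis chart_eq_interior)

lemma embedding_chart_open:
  assumes \<alpha>: "\<alpha> \<in> A" and W: "openin (top_of_set (S \<alpha>)) W"
    and sat: "\<And>p \<beta> p'. \<lbrakk>p \<in> W; \<xi> \<alpha> p = \<xi> \<beta> p'\<rbrakk> \<Longrightarrow> \<beta> = \<alpha> \<and> p' = p"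
  shows "homeomorphic_map (top_of_set W) (subtopology T (\<xi> \<alpha> ` W)) (\<xi> \<alpha>)"
proof -
  have eq: "subtopology (top_of_set (S \<alpha>)) W = top_of_set W"
    using openin_imp_subset[OF W] by (simp add: subtopology_subtopology Int_absorb1)
  have "open_map (top_of_set W) T (\<xi> \<alpha>)"
    unfolding open_map_def
  proof (intro allI impI)
    fix V assume V: "openin (top_of_set W) V"
    then have "openin (top_of_set (S \<alpha>)) V" using W openin_trans by blast
    moreover have "V \<subseteq> W" using V openin_imp_subset by blast
    ultimately show "openin T (\<xi> \<alpha> ` V)"
      by (intro openin_chart_image[OF \<alpha>]) (use sat in blast)+
  qed
  moreover have "inj_on (\<xi> \<alpha>) W" by (rule inj_onI) (use sat in metis)
  ultimately have "embedding_map (top_of_set W) T (\<xi> \<alpha>)"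
    using continuous_map_from_subtopology[OF continuous_chart[OF \<alpha>], of W]
    unfolding eq by (intro injective_open_imp_embedding_map) auto
  then show ?thesis by (simp add: embedding_map_def)
qed

lemma embedding_chart_interior:
  assumes \<alpha>: "\<alpha> \<in> A"
  shows "homeomorphic_map (top_of_set open_strip) (subtopology T (\<xi> \<alpha> ` open_strip)) (\<xi> \<alpha>)"
proof (rule embedding_chart_open[OF \<alpha>])
  show "openin (top_of_set (S \<alpha>)) open_strip"
    using open_strip_subset[OF model[OF \<alpha>]] open_open_strip by (rule open_subset)
qed (use chart_eq_interior in blast)

text \<open>Since the quotient map is proper, so is its product with the identity of \<open>X\<close>, which is
  therefore a quotient map without any assumption on \<open>X\<close>.\<close>

lemma continuous_map_prod_surface:
  assumes F: "\<And>\<alpha>. \<alpha> \<in> A \<Longrightarrow> continuous_map (prod_topology X (top_of_set (S \<alpha>))) Y (\<lambda>(x, p). F (x, \<xi> \<alpha> p))"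
  shows "continuous_map (prod_topology X T) Y F"
proof -
  let ?k = "\<lambda>(x, P). (x, q P)"
  have "proper_map (prod_topology X \<D>) (prod_topology X T) ?k"
    using proper_map_prod[of X \<D> X T "\<lambda>x. x" q] proper_map_proj proper_map_id[of X, unfolded id_def]
      by simp
  then have "closed_map (prod_topology X \<D>) (prod_topology X T) ?k" by (rule proper_imp_closed_map)
  moreover have "continuous_map (prod_topology X \<D>) (prod_topology X T) ?k"
    using continuous_map_prod_top[of X \<D> X T "\<lambda>x. x" q] quotient_imp_continuous_map[OF quotient_map_proj] by simp
  moreover have "?k ` topspace (prod_topology X \<D>) = topspace (prod_topology X T)"
    using quotient_imp_surjective_map[OF quotient_map_proj] map_prod_surj_on[of "\<lambda>x. x" "topspace X"
      "topspace X" q]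
    by (simp only: topspace_prod_topology map_prod_def image_ident)
  ultimately have quo: "quotient_map (prod_topology X \<D>) (prod_topology X T) ?k"
    by (intro continuous_closed_imp_quotient_map)
  have "continuous_map (prod_topology X \<D>) Y (F \<circ> ?k)"
    unfolding continuous_map
  proof (intro conjI allI impI)
    show "(F \<circ> ?k) ` topspace (prod_topology X \<D>) \<subseteq> topspace Y"
    proof clarsimp
      fix x \<alpha> p assume "x \<in> topspace X" "\<alpha> \<in> A" "p \<in> S \<alpha>"
      then show "F (x, q (\<alpha>, p)) \<in> topspace Y"
        using continuous_map_funspace[OF F[of \<alpha>]] by (auto simp: chart_def Pi_iff)
    qed
    fix V assume V: "openin Y V"
    let ?O = "{w \<in> topspace (prod_topology X \<D>). (F \<circ> ?k) w \<in> V}"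
    show "openin (prod_topology X \<D>) ?O"
      unfolding openin_prod_topology_alt
    proof (intro allI impI)
      fix x P assume xP: "(x, P) \<in> ?O"
      obtain \<alpha> p where P: "P = (\<alpha>, p)" by (cases P)
      have \<alpha>: "\<alpha> \<in> A"
        and mem: "(x, p) \<in> {w \<in> topspace (prod_topology X (top_of_set (S \<alpha>))). (case w of (x, p) \<Rightarrow> F (x, \<xi> \<alpha> p)) \<in> V}"
        using xP P by (auto simp: chart_def)
      have "openin (prod_topology X (top_of_set (S \<alpha>))) {w \<in> topspace (prod_topology X (top_of_set (S \<alpha>))). (case w of (x, p) \<Rightarrow> F (x, \<xi> \<alpha> p)) \<in> V}"
        using F[OF \<alpha>] V unfolding continuous_map by blast
      then obtain U1 U2 where U: "openin X U1" "openin (top_of_set (S \<alpha>)) U2" "x \<in> U1" "p \<in> U2"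
        "U1 \<times> U2 \<subseteq> {w \<in> topspace (prod_topology X (top_of_set (S \<alpha>))). (case w of (x, p) \<Rightarrow> F (x, \<xi> \<alpha> p)) \<in> V}"
        using mem unfolding openin_prod_topology_alt by meson
      \<comment> \<open>Each strip is open in the disjoint union, so a product box inside one strip
        is a box for the whole sum.\<close>
      have "openin \<D> (Pair \<alpha> ` U2)"
        using open_map_component_injection[OF \<alpha>, of "\<lambda>\<alpha>. top_of_set (S \<alpha>)"] U(2)
          unfolding open_map_def by blast
      moreover have "U1 \<times> Pair \<alpha> ` U2 \<subseteq> ?O" using U(5) \<alpha> by (auto simp: chart_def)
      ultimately show "\<exists>U V. openin X U \<and> openin \<D> V \<and> x \<in> U \<and> P \<in> V \<and> U \<times> V \<subseteq> ?O"
        using U P by (intro exI[of _ U1] exI[of _ "Pair \<alpha> ` U2"]) auto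
    qed
  qed
  then show ?thesis by (rule continuous_compose_quotient_map[OF quo])
qed

lemma continuous_map_surface:
  assumes "\<And>\<alpha>. \<alpha> \<in> A \<Longrightarrow> continuous_map (top_of_set (S \<alpha>)) Y (F \<circ> \<xi> \<alpha>)"
  shows "continuous_map T Y F"
  unfolding continuous_map
proof (intro conjI allI impI)
  show "F ` topspace T \<subseteq> topspace Y"
    using assms unfolding continuous_map topspace_surface by fastforce
  fix V assume V: "openin Y V"
  have "openin (top_of_set (S \<alpha>)) {p \<in> S \<alpha>. \<xi> \<alpha> p \<in> {z \<in> topspace T. F z \<in> V}}" if \<alpha>: "\<alpha> \<in> A" for \<alpha>
  proof -
    have eq: "{p \<in> S \<alpha>. \<xi> \<alpha> p \<in> {z \<in> topspace T. F z \<in> V}} = {p \<in> topspace (top_of_set (S \<alpha>)). (F \<circ> \<xi> \<alpha>) p \<in> V}"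
      using chart_in_topspace[OF \<alpha>] by auto
    show ?thesis unfolding eq using assms[OF \<alpha>] V by (simp only: continuous_map)
  qed
  then show "openin T {z \<in> topspace T. F z \<in> V}" unfolding openin_surface by blast
qed

end

text \<open>Used to force a connected piece of a leaf to pass over the missing end point of a
  boundary interval.\<close>

lemma connected_horizontal_segment:
  assumes "connected (K :: (real \<times> real) set)" "K \<subseteq> UNIV \<times> {t}" "(a, t) \<in> K" "(b, t) \<in> K" "a \<le> c"
    "c \<le> b"
  shows "(c, t) \<in> K"
proof -
  have "connected (fst ` K)" using assms(1) by (intro connected_continuous_image continuous_intros)
  moreover have "a \<in> fst ` K" "b \<in> fst ` K" using assms(3,4) by force+
  ultimately have "c \<in> fst ` K" using connected_contains_Icc[of "fst ` K" a b] assms(5,6) by auto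
  then show ?thesis using assms(2) by auto
qed

context stripped
begin

section \<open>Leaves\<close>

text \<open>In a reduced surface this set equals \<open>Sigma_leaves\<close>. It is defined without
  the types of leaves, so that its elementary properties hold for every stripped surface.\<close>

definition singular :: "('a \<times> real \<times> real) set set" where
  "singular = (\<Union>\<alpha>\<in>A. \<xi> \<alpha> ` strip_boundary (S \<alpha>))"

lemma chart_singular_iff:
  assumes "\<alpha> \<in> A" "p \<in> S \<alpha>" shows "\<xi> \<alpha> p \<in> singular \<longleftrightarrow> p \<in> strip_boundary (S \<alpha>)"
proof
  assume "\<xi> \<alpha> p \<in> singular"
  then obtain \<beta> p' where "\<beta> \<in> A" "p' \<in> strip_boundary (S \<beta>)" "\<xi> \<alpha> p = \<xi> \<beta> p'"
    by (auto simp: singular_def)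
  then show "p \<in> strip_boundary (S \<alpha>)"
    using chart_eq_interior[of \<alpha> p \<beta> p'] assms strip_boundary_eq[OF model[OF assms(1)]] by auto
qed (use assms in \<open>auto simp: singular_def\<close>)

lemma leaves_cases:
  assumes "w \<in> leaves Z"
  obtains (internal) \<alpha> t where "\<alpha> \<in> A" "-1 < t" "t < 1" "w = \<xi> \<alpha> ` (UNIV \<times> {t})"
  | (singular) \<alpha> J where "\<alpha> \<in> A" "J \<in> boundary_intervals (S \<alpha>)" "w = \<xi> \<alpha> ` J"
  using assms unfolding leaves_def model_leaves_def by auto

lemma internal_leaf: "\<lbrakk>\<alpha> \<in> A; -1 < t; t < 1\<rbrakk> \<Longrightarrow> \<xi> \<alpha> ` (UNIV \<times> {t}) \<in> leaves Z"
  unfolding leaves_def model_leaves_def by auto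

lemma interval_leaf: "\<lbrakk>\<alpha> \<in> A; J \<in> boundary_intervals (S \<alpha>)\<rbrakk> \<Longrightarrow> \<xi> \<alpha> ` J \<in> leaves Z"
  unfolding leaves_def model_leaves_def by auto

lemma interval_subset_strip: "J \<in> boundary_intervals (S \<alpha>) \<Longrightarrow> J \<subseteq> S \<alpha>"
  using boundary_intervals_subset by (force simp: mem_strip_boundary)

lemma glued_leaf_image:
  assumes "glued_by Z \<alpha> J \<alpha>' J' \<phi>" shows "\<xi> \<alpha>' ` J' = \<xi> \<alpha> ` J"
proof -
  have "J' = \<phi> ` J" using glued_by_bij[OF assms] by (auto simp: bij_betw_def)
  then show ?thesis using chart_glued[OF assms] by (auto simp: image_iff)
qed

text \<open>Interior points are never glued, which settles the internal leaves. Two boundary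
  intervals sharing a point of the surface are equal or are the two members of one gluing, and then
  their images coincide.\<close>

lemma leaves_unique:
  assumes w: "w \<in> leaves Z" and w': "w' \<in> leaves Z" and z: "z \<in> w" "z \<in> w'"
  shows "w = w'"
proof -
  have int: "w2 = w1" if int: "\<alpha> \<in> A" "-1 < t" "t < 1" "w1 = \<xi> \<alpha> ` (UNIV \<times> {t})" "w2 \<in> leaves Z"
    "z \<in> w1" "z \<in> w2"
    for \<alpha> t w1 w2 z
  proof -
    obtain x where x: "z = \<xi> \<alpha> (x, t)" using int(4,6) by auto
    from int(5) show ?thesis
    proof (cases rule: leaves_cases)
      case (internal \<beta> s)
      then obtain u where u: "z = \<xi> \<beta> (u, s)" using int(7) by auto
      have "\<xi> \<alpha> (x, t) = \<xi> \<beta> (u, s)" "(x, t) \<in> open_strip" using x u int(2,3) by simp_all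
      then have "\<beta> = \<alpha> \<and> (u, s) = (x, t)" by (rule chart_eq_interior)
      then show ?thesis using int(4) internal(4) by simp
    next
      case (singular \<beta> J)
      then obtain p where p: "z = \<xi> \<beta> p" "p \<in> J" using int(7) by auto
      have "\<xi> \<alpha> (x, t) = \<xi> \<beta> p" "(x, t) \<in> open_strip" using x p int(2,3) by simp_all
      then have "\<beta> = \<alpha> \<and> p = (x, t)" by (rule chart_eq_interior)
      then have "(x, t) \<in> strip_boundary (S \<beta>)"
        using boundary_intervals_subset[OF singular(2)] p(2) by blast
      then show ?thesis using int(2,3) by (auto simp: mem_strip_boundary)
    qed
  qed
  from w show ?thesis
  proof (cases rule: leaves_cases)
    case internal then show ?thesis using int w' z by metis
  next
    case sing: (singular \<alpha> J)
    from w' show ?thesis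
    proof (cases rule: leaves_cases)
      case internal then show ?thesis using int w z by metis
    next
      case (singular \<beta> K)
      obtain p p' where p: "p \<in> J" "p' \<in> K" "\<xi> \<alpha> p = \<xi> \<beta> p'" using z sing(3) singular(3) by auto
      from p(3) show ?thesis unfolding chart_eq_iff
      proof (elim disjE exE conjE)
        assume "\<alpha> = \<beta>" "p = p'"
        then show ?thesis using p sing singular boundary_intervals_unique by metis
      next
        fix J1 K1 \<phi> assume g: "glued_by Z \<alpha> J1 \<beta> K1 \<phi>" "p \<in> J1" "p' = \<phi> p"
        have "p' \<in> K1" using glued_by_bij[OF g(1)] g bij_betwE by blast
        then have "J1 = J" "K1 = K"
          using boundary_intervals_unique glued_by_intervals[OF g(1)] g(2) p sing(2) singular(2)
            by metis+
        then show ?thesis using glued_leaf_image[OF g(1)] sing(3) singular(3) by simp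
      qed
    qed
  qed
qed

lemma leaf_of_point:
  assumes "z \<in> topspace T" obtains w where "w \<in> leaves Z" "z \<in> w"
proof -
  obtain \<alpha> p where p: "\<alpha> \<in> A" "p \<in> S \<alpha>" "z = \<xi> \<alpha> p" using assms by (auto simp: topspace_surface)
  show ?thesis
  proof (cases "p \<in> strip_boundary (S \<alpha>)")
    case True
    then show ?thesis using that p interval_leaf boundary_interval_of_point by (metis image_eqI)
  next
    case False
    then have "p \<in> open_strip" using p strip_boundary_eq[OF model[OF p(1)]] by auto
    then have "-1 < snd p" "snd p < 1" "z \<in> \<xi> \<alpha> ` (UNIV \<times> {snd p})"
      using p(3) by (auto simp: mem_Times_iff)
    then show ?thesis using that[OF internal_leaf[OF p(1)]] by blast
  qed
qed

lemma leaf_subset: "w \<in> leaves Z \<Longrightarrow> w \<subseteq> topspace T"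
proof (erule leaves_cases)
  fix \<alpha> t assume *: "\<alpha> \<in> A" "-1 < t" "t < 1" "w = \<xi> \<alpha> ` (UNIV \<times> {t})"
  then have "UNIV \<times> {t} \<subseteq> S \<alpha>" using open_strip_subset[OF model[OF *(1)]] by auto
  then show "w \<subseteq> topspace T" using * chart_in_topspace by blast
next
  fix \<alpha> J assume "\<alpha> \<in> A" "J \<in> boundary_intervals (S \<alpha>)" "w = \<xi> \<alpha> ` J"
  then show "w \<subseteq> topspace T" using chart_in_topspace interval_subset_strip by blast
qed

lemma leaf_nonempty: "w \<in> leaves Z \<Longrightarrow> w \<noteq> {}"
  using in_components_nonempty unfolding boundary_intervals_def
  by (elim leaves_cases) (auto simp: boundary_intervals_def dest: in_components_nonempty)

lemma HomeoD:
  assumes "h \<in> Homeo Z"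
  shows "h \<in> extensional (topspace T)" "homeomorphic_map T T h"
    "\<And>w. w \<in> leaves Z \<Longrightarrow> h ` w \<in> leaves Z"
    "continuous_map T T h" "inj_on h (topspace T)" "h ` topspace T = topspace T"
proof -
  show "h \<in> extensional (topspace T)" and h: "homeomorphic_map T T h"
    and "\<And>w. w \<in> leaves Z \<Longrightarrow> h ` w \<in> leaves Z"
    using assms unfolding Homeo_def by auto
  show "continuous_map T T h" "inj_on h (topspace T)" "h ` topspace T = topspace T"
    using homeomorphic_imp_continuous_map[OF h] homeomorphic_imp_injective_map[OF h]
      homeomorphic_imp_surjective_map[OF h] by auto
qed

text \<open>\<open>Homeo\<close> asks only that leaves go to leaves. Since leaves partition the
  surface and \<open>h\<close> is onto, every leaf is the image of a leaf, which makes the inverse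
  foliated as well.\<close>

lemma Homeo_leaf_preimage:
  assumes h: "h \<in> Homeo Z" and w: "w \<in> leaves Z"
  obtains v where "v \<in> leaves Z" "h ` v = w"
proof -
  obtain z where z: "z \<in> w" using leaf_nonempty[OF w] by auto
  then have "z \<in> h ` topspace T" using HomeoD(6)[OF h] leaf_subset[OF w] by auto
  then obtain y where y: "y \<in> topspace T" "h y = z" by blast
  obtain v where v: "v \<in> leaves Z" "y \<in> v" using leaf_of_point[OF y(1)] .
  then show ?thesis using that[of v] leaves_unique[OF HomeoD(3)[OF h v(1)] w] y z by blast
qed

lemma Homeo_inverse:
  assumes h: "h \<in> Homeo Z"
  obtains k where "k \<in> Homeo Z" "\<And>z. z \<in> topspace T \<Longrightarrow> k (h z) = z"
    "\<And>z. z \<in> topspace T \<Longrightarrow> h (k z) = z"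
proof -
  obtain k0 where k0: "homeomorphic_maps T T h k0"
    using HomeoD(2)[OF h] homeomorphic_map_maps by blast
  define k where "k = restrict k0 (topspace T)"
  have k: "homeomorphic_maps T T h k"
    using k0 by (rule homeomorphic_maps_eq) (auto simp: k_def)
  have inv: "\<And>z. z \<in> topspace T \<Longrightarrow> k (h z) = z" "\<And>z. z \<in> topspace T \<Longrightarrow> h (k z) = z"
    using k unfolding homeomorphic_maps_def by auto
  have "k ` w \<in> leaves Z" if w: "w \<in> leaves Z" for w
  proof -
    obtain v where v: "v \<in> leaves Z" "h ` v = w" using Homeo_leaf_preimage[OF h w] .
    have "(\<lambda>z. k (h z)) ` v = (\<lambda>z. z) ` v"
      using leaf_subset[OF v(1)] inv(1) by (intro image_cong) auto
    then have "k ` w = v" unfolding v(2)[symmetric] by (simp add: image_image)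
    then show ?thesis using v by simp
  qed
  then have "k \<in> Homeo Z"
    using k homeomorphic_maps_map[of T T h k] unfolding Homeo_def k_def by auto
  then show ?thesis using that inv by blast
qed

section \<open>Internal leaves are distinguished from the other leaves\<close>

text \<open>A special leaf need not be a branch point of the leaf space: its two intervals may be the only
  ones on the same side of one strip. But leaf segments near it, with converging end points,
  have to pass the missing end point of one of the intervals, and so they leave every compact set.\<close>

definition leafwise_joined :: "('a \<times> real \<times> real) set set \<Rightarrow> ('a \<times> real \<times> real) set \<Rightarrow> ('a \<times> real \<times> real) set \<Rightarrow> bool" where
  "leafwise_joined C x y \<longleftrightarrow> (\<exists>K v. v \<in> leaves Z \<and> K \<subseteq> v \<inter> C \<and> connectedin T K \<and> x \<in> K \<and> y \<in> K)"

text \<open>Only \<open>x0\<close> has to lie on \<open>w\<close>; the other limit \<open>y0\<close>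
  may lie on a different leaf. The notion uses limits, compactness, connectedness and leaves alone,
  so that foliated homeomorphisms preserve it.\<close>

definition escaping :: "('a \<times> real \<times> real) set set \<Rightarrow> bool" where
  "escaping w \<longleftrightarrow> (\<exists>x y x0 y0. x0 \<in> w \<and> limitin T x x0 sequentially \<and> limitin T y y0 sequentially \<and>
     (\<forall>n::nat. \<exists>v\<in>leaves Z. x n \<in> v \<and> y n \<in> v) \<and>
     (\<forall>C. compactin T C \<longrightarrow> \<not> (\<forall>\<^sub>F n in sequentially. leafwise_joined C (x n) (y n))))"

lemma escaping_homeo:
  assumes h: "h \<in> Homeo Z" and w: "escaping w" shows "escaping (h ` w)"
proof -
  obtain k where k: "k \<in> Homeo Z" "\<And>z. z \<in> topspace T \<Longrightarrow> k (h z) = z"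
    "\<And>z. z \<in> topspace T \<Longrightarrow> h (k z) = z"
    using Homeo_inverse[OF h] by metis
  from w obtain x y x0 y0 where xy: "x0 \<in> w" "limitin T x x0 sequentially"
    "limitin T y y0 sequentially"
    "\<forall>n::nat. \<exists>v\<in>leaves Z. x n \<in> v \<and> y n \<in> v" and
    nC: "\<forall>C. compactin T C \<longrightarrow> \<not> (\<forall>\<^sub>F n in sequentially. leafwise_joined C (x n) (y n))"
    unfolding escaping_def by (elim exE conjE) (rule that)
  have xT: "x n \<in> topspace T" "y n \<in> topspace T" for n
    using xy(4) leaf_subset by blast+
  show ?thesis unfolding escaping_def
  proof (rule exI[of _ "h \<circ> x"], rule exI[of _ "h \<circ> y"], rule exI[of _ "h x0"], rule exI[of _ "h y0"],
      intro conjI allI)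
    show "limitin T (h \<circ> x) (h x0) sequentially" "limitin T (h \<circ> y) (h y0) sequentially"
      by (rule continuous_map_limit[OF HomeoD(4)[OF h]], fact xy)+
    show "\<exists>v\<in>leaves Z. (h \<circ> x) n \<in> v \<and> (h \<circ> y) n \<in> v" for n
    proof -
      obtain v where "v \<in> leaves Z" "x n \<in> v" "y n \<in> v" using xy(4) by blast
      then show ?thesis using HomeoD(3)[OF h, of v] by (intro bexI[of _ "h ` v"]) auto
    qed
    show "compactin T C \<longrightarrow> \<not> (\<forall>\<^sub>F n in sequentially. leafwise_joined C ((h \<circ> x) n) ((h \<circ> y) n))"
      for C
    proof (intro impI notI)
      assume C: "compactin T C"
        and ev: "\<forall>\<^sub>F n in sequentially. leafwise_joined C ((h \<circ> x) n) ((h \<circ> y) n)"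
      \<comment> \<open>A compact set joining the images is carried back by the inverse
        \<open>k\<close>, which again maps leaves onto leaves.\<close>
      have "compactin T (k ` C)" using image_compactin[OF C HomeoD(4)[OF k(1)]] .
      moreover have "leafwise_joined (k ` C) (x n) (y n)"
        if j: "leafwise_joined C ((h \<circ> x) n) ((h \<circ> y) n)" for n
      proof -
        from j obtain K v where *: "v \<in> leaves Z" "K \<subseteq> v \<inter> C" "connectedin T K" "h (x n) \<in> K"
          "h (y n) \<in> K"
          unfolding leafwise_joined_def by auto
        have "connectedin T (k ` K)"
          using connectedin_continuous_map_image[OF HomeoD(4)[OF k(1)] *(3)] .
        moreover have "x n \<in> k ` K" "y n \<in> k ` K"
          using *(4,5) k(2)[OF xT(1)[of n]] k(2)[OF xT(2)[of n]] by (metis image_eqI)+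
        moreover have "k ` K \<subseteq> k ` v \<inter> k ` C" using *(2) by blast
        ultimately show ?thesis using HomeoD(3)[OF k(1) *(1)] unfolding leafwise_joined_def by blast
      qed
      ultimately have "\<forall>\<^sub>F n in sequentially. leafwise_joined (k ` C) (x n) (y n)"
        using eventually_mono[OF ev] by simp
      then show False using nC \<open>compactin T (k ` C)\<close> by simp
    qed
    show "h x0 \<in> h ` w" using xy(1) by (rule imageI)
  qed
qed

lemma limitin_chart_interior:
  assumes \<alpha>: "\<alpha> \<in> A" and lim: "limitin T (\<lambda>n. \<xi> \<alpha> (f n)) (\<xi> \<alpha> p) sequentially"
    and p: "p \<in> open_strip"
    and f: "\<forall>\<^sub>F n in sequentially. f n \<in> open_strip"
  shows "f \<longlonglongrightarrow> p"
proof (rule topological_tendstoI)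
  fix W assume W: "open W" "p \<in> W"
  have "openin T (\<xi> \<alpha> ` (W \<inter> open_strip))"
    using W open_open_strip by (intro openin_chart_interior[OF \<alpha>]) auto
  moreover have "\<xi> \<alpha> p \<in> \<xi> \<alpha> ` (W \<inter> open_strip)" using W p by auto
  ultimately have "\<forall>\<^sub>F n in sequentially. \<xi> \<alpha> (f n) \<in> \<xi> \<alpha> ` (W \<inter> open_strip)"
    using lim unfolding limitin_def by blast
  then show "\<forall>\<^sub>F n in sequentially. f n \<in> W"
    using f by eventually_elim (auto dest: inj_onD[OF inj_chart_interior])
qed

text \<open>Near an internal leaf everything happens in a closed band of the open strip: both
  sequences of end points converge there, so they are bounded, and one compact box contains
  horizontal segments joining them.\<close>

lemma internal_not_escaping:
  assumes \<alpha>: "\<alpha> \<in> A" and t: "-1 < t" "t < 1"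
  shows "\<not> escaping (\<xi> \<alpha> ` (UNIV \<times> {t}))"
proof
  assume "escaping (\<xi> \<alpha> ` (UNIV \<times> {t}))"
  then obtain x y x0 y0 where x0: "x0 \<in> \<xi> \<alpha> ` (UNIV \<times> {t})"
    and x: "limitin T x x0 sequentially" and y: "limitin T y y0 sequentially"
    and v: "\<forall>n::nat. \<exists>v\<in>leaves Z. x n \<in> v \<and> y n \<in> v" and
    nC: "\<forall>C. compactin T C \<longrightarrow> \<not> (\<forall>\<^sub>F n in sequentially. leafwise_joined C (x n) (y n))"
    unfolding escaping_def by (elim exE conjE) (rule that)
  obtain a where a: "x0 = \<xi> \<alpha> (a, t)" using x0 by auto
  \<comment> \<open>Half the distance from \<open>t\<close> to the nearer side, so that the closed
    band of half-height \<open>s\<close> stays in the open strip.\<close>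
  obtain s where s: "0 < s" "-1 < t - s" "t + s < 1"
  proof
    show "0 < min (t + 1) (1 - t) / 2" "-1 < t - min (t + 1) (1 - t) / 2"
      "t + min (t + 1) (1 - t) / 2 < 1"
      using t by (auto simp: min_def field_simps)
  qed
  let ?B = "UNIV \<times> {t-s..t+s} :: (real \<times> real) set"
  have B: "?B \<subseteq> open_strip" using s by auto
  have SI: "open_strip \<subseteq> S \<alpha>" using open_strip_subset[OF model[OF \<alpha>]] .
  have "openin T (\<xi> \<alpha> ` (UNIV \<times> {t-s<..<t+s}))"
    using s by (intro openin_chart_interior[OF \<alpha>]) (auto simp: open_Times)
  moreover have "x0 \<in> \<xi> \<alpha> ` (UNIV \<times> {t-s<..<t+s})" using a s by auto
  ultimately have "\<forall>\<^sub>F n in sequentially. x n \<in> \<xi> \<alpha> ` (UNIV \<times> {t-s<..<t+s})"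
    using x unfolding limitin_def by blast
  then obtain N where "\<And>n. n \<ge> N \<Longrightarrow> x n \<in> \<xi> \<alpha> ` (UNIV \<times> {t-s<..<t+s})"
    unfolding eventually_sequentially by blast
  then have "\<exists>f. x n = \<xi> \<alpha> f \<and> snd f \<in> {t-s..t+s}" if "n \<ge> N" for n using that by force
  then obtain f where f: "\<And>n. n \<ge> N \<Longrightarrow> x n = \<xi> \<alpha> (f n)" "\<And>n. n \<ge> N \<Longrightarrow> snd (f n) \<in> {t-s..t+s}" by metis
  have "\<exists>g. y n = \<xi> \<alpha> g \<and> snd g = snd (f n)" if n: "n \<ge> N" for n
  proof -
    obtain v' where v': "v' \<in> leaves Z" "x n \<in> v'" "y n \<in> v'" using v by blast
    have bds: "-1 < snd (f n)" "snd (f n) < 1" using f(2)[OF n] s by auto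
    have "x n \<in> \<xi> \<alpha> ` (UNIV \<times> {snd (f n)})"
      unfolding f(1)[OF n] by (rule imageI) (simp add: mem_Times_iff)
    then have "v' = \<xi> \<alpha> ` (UNIV \<times> {snd (f n)})"
      using leaves_unique[OF v'(1) internal_leaf[OF \<alpha> bds] v'(2)] by blast
    then show ?thesis using v'(3) by auto
  qed
  then obtain g where g: "\<And>n. n \<ge> N \<Longrightarrow> y n = \<xi> \<alpha> (g n)" "\<And>n. n \<ge> N \<Longrightarrow> snd (g n) = snd (f n)" by metis
  have "closedin (top_of_set (S \<alpha>)) ?B"
    using B SI by (intro closed_subset) (auto simp: closed_Times)
  \<comment> \<open>Because the chart is closed, the limit of the second sequence still lies over
    the band; so both sequences converge in the strip itself and not only in the surface.\<close>
  then have clB: "closedin T (\<xi> \<alpha> ` ?B)" using closed_map_chart[OF \<alpha>]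
    unfolding closed_map_def by blast
  have "y n \<in> \<xi> \<alpha> ` ?B" if "n \<ge> N" for n
    unfolding g(1)[OF that] using g(2)[OF that] f(2)[OF that]
      by (intro imageI) (simp add: mem_Times_iff)
  then have "\<forall>\<^sub>F n in sequentially. y n \<in> \<xi> \<alpha> ` ?B" unfolding eventually_sequentially by blast
  then have "y0 \<in> \<xi> \<alpha> ` ?B" using limitin_closedin[OF y clB] by simp
  then obtain b where b: "y0 = \<xi> \<alpha> b" "b \<in> open_strip" using B by blast
  have fg: "\<forall>\<^sub>F n in sequentially. f n \<in> open_strip" "\<forall>\<^sub>F n in sequentially. g n \<in> open_strip"
    unfolding eventually_sequentially using f(2) g(2) s by (force simp: mem_Times_iff)+
  have "limitin T (\<lambda>n. \<xi> \<alpha> (f n)) (\<xi> \<alpha> (a, t)) sequentially"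
    "limitin T (\<lambda>n. \<xi> \<alpha> (g n)) (\<xi> \<alpha> b) sequentially"
    using limitin_transform_eventually[OF _ x] limitin_transform_eventually[OF _ y] f(1) g(1) a b
    unfolding eventually_sequentially by metis+
  then have lims: "f \<longlonglongrightarrow> (a, t)" "g \<longlonglongrightarrow> b"
    using limitin_chart_interior[OF \<alpha>] fg b(2) t by auto
  have "Bseq (\<lambda>n. fst (f n))" "Bseq (\<lambda>n. fst (g n))"
    using lims tendsto_fst convergentI convergent_imp_Bseq by blast+
  then obtain M M' where M: "\<And>n. \<bar>fst (f n)\<bar> \<le> M" "\<And>n. \<bar>fst (g n)\<bar> \<le> M'"
    unfolding Bseq_def by auto
  \<comment> \<open>Convergent sequences are bounded, so one half-width serves for all leaf
    segments.\<close>
  define R where "R = max M M'"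
  have R: "fst (f n) \<in> {-R..R}" "fst (g n) \<in> {-R..R}" for n
    using M(1)[of n] M(2)[of n] unfolding R_def by auto
  have cont: "continuous_map (top_of_set (S \<alpha>)) T (\<xi> \<alpha>)" using continuous_chart[OF \<alpha>] .
  have "compactin (top_of_set (S \<alpha>)) ({-R..R} \<times> {t-s..t+s})"
    using B SI by (auto simp: compactin_subtopology intro!: compact_Times)
  then have comp: "compactin T (\<xi> \<alpha> ` ({-R..R} \<times> {t-s..t+s}))" using cont image_compactin by blast
  have "leafwise_joined (\<xi> \<alpha> ` ({-R..R} \<times> {t-s..t+s})) (x n) (y n)" if n: "n \<ge> N" for n
  proof -
    let ?L = "{-R..R} \<times> {snd (f n)}"
    have bds: "-1 < snd (f n)" "snd (f n) < 1" using f(2)[OF n] s by auto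
    then have "?L \<subseteq> S \<alpha>" using SI by auto
    then have "connectedin (top_of_set (S \<alpha>)) ?L"
      by (auto simp: connectedin_subtopology intro!: connected_Times)
    then have "connectedin T (\<xi> \<alpha> ` ?L)" using cont connectedin_continuous_map_image by blast
    moreover have "x n \<in> \<xi> \<alpha> ` ?L" unfolding f(1)[OF n]
      using R by (intro imageI) (simp add: mem_Times_iff)
    moreover have "y n \<in> \<xi> \<alpha> ` ?L"
      unfolding g(1)[OF n] using R g(2)[OF n] by (intro imageI) (simp add: mem_Times_iff)
    moreover have "\<xi> \<alpha> ` ?L \<subseteq> \<xi> \<alpha> ` (UNIV \<times> {snd (f n)}) \<inter> \<xi> \<alpha> ` ({-R..R} \<times> {t-s..t+s})"
      using f(2)[OF n] by auto
    ultimately show ?thesis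
      using internal_leaf[OF \<alpha> bds] unfolding leafwise_joined_def
      by (intro exI[of _ "\<xi> \<alpha> ` ?L"] exI[of _ "\<xi> \<alpha> ` (UNIV \<times> {snd (f n)})"] conjI)
  qed
  then have "\<forall>\<^sub>F n in sequentially. leafwise_joined (\<xi> \<alpha> ` ({-R..R} \<times> {t-s..t+s})) (x n) (y n)"
    using eventually_sequentiallyI[of N] by simp
  then show False using nC comp by simp
qed

text \<open>If \<open>J\<close> is not its whole side, an end point of \<open>J\<close>, which is
  missing from the strip, lies between a point of \<open>J\<close> and another point of that side.
  The internal leaves tending to the side have to cross the vertical line over this end point, and
  the crossing points have no limit in the strip.\<close>

lemma interval_escaping:
  assumes \<alpha>: "\<alpha> \<in> A" and J: "J \<in> boundary_intervals (S \<alpha>)" and e: "J \<subseteq> strip_side (S \<alpha>) e"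
    "J \<noteq> strip_side (S \<alpha>) e"
  shows "escaping (\<xi> \<alpha> ` J)"
proof -
  note mod = model[OF \<alpha>]
  obtain a b e1 where J1: "a < b" "e1 \<in> {-1, 1}" "J = {a<..<b} \<times> {e1}" "(a, e1) \<notin> S \<alpha>"
    "(b, e1) \<notin> S \<alpha>"
    using boundary_intervals_cases[OF mod J] by metis
  obtain x1 where x1: "a < x1" "x1 < b" using dense[OF J1(1)] by blast
  have "(x1, e1) \<in> J" using J1 x1 by auto
  then have e1: "e1 = e" using e(1) by (auto simp: strip_side_def)
  obtain p where p: "p \<in> strip_side (S \<alpha>) e" "p \<notin> J" using e by blast
  define x2 where "x2 = fst p"
  have pe: "p = (x2, e)" "p \<in> S \<alpha>" using p by (auto simp: strip_side_def x2_def)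
  \<comment> \<open>The abscissa \<open>c\<close> is the end point of \<open>J\<close> that faces
    \<open>x2\<close>.\<close>
  obtain c where c: "(c, e) \<notin> S \<alpha>" "x1 \<le> c \<and> c \<le> x2 \<or> x2 \<le> c \<and> c \<le> x1"
  proof (cases "x2 \<le> a")
    case True
    then show ?thesis using that[of a] J1 e1 x1 by auto
  next
    case False
    then have "x2 \<ge> b" using p(2) pe J1 e1 by auto
    then show ?thesis using that[of b] J1 e1 x1 by auto
  qed
  \<comment> \<open>The factor runs from 1/2 up to 1 without reaching it, so these are heights of
    internal leaves tending to the side \<open>e\<close>.\<close>
  define t where "t n = e * (1 - inverse (real (Suc n)) / 2)" for n
  have t1: "\<bar>t n\<bar> < 1" for n
  proof -
    have "0 < inverse (real (Suc n))" "inverse (real (Suc n)) \<le> 1" by (auto simp: inverse_le_1_iff)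
    then have "\<bar>1 - inverse (real (Suc n)) / 2\<bar> < 1" by linarith
    moreover have "\<bar>e\<bar> = 1" using J1(2) e1 by auto
    ultimately show ?thesis by (simp add: t_def abs_mult)
  qed
  then have tb: "-1 < t n" "t n < 1" for n using t1[of n] by linarith+
  have tlim: "t \<longlonglongrightarrow> e"
  proof -
    have "t \<longlonglongrightarrow> e * (1 - 0 / 2)" unfolding t_def
      by (intro tendsto_intros LIMSEQ_inverse_real_of_nat) auto
    then show ?thesis by simp
  qed
  have inS: "(u, t n) \<in> S \<alpha>" for u n using open_strip_subset[OF mod] tb[of n] by auto
  have lim: "limitin T (\<lambda>n. \<xi> \<alpha> (u, t n)) (\<xi> \<alpha> (u, e)) sequentially" if "(u, e) \<in> S \<alpha>" for u
  proof -
    have "(\<lambda>n. (u, t n)) \<longlonglongrightarrow> (u, e)" using tlim by (intro tendsto_intros)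
    then have "limitin (top_of_set (S \<alpha>)) (\<lambda>n. (u, t n)) (u, e) sequentially"
      using that inS by (simp add: limitin_subtopology)
    then show ?thesis using continuous_map_limit[OF continuous_chart[OF \<alpha>]] by (auto simp: comp_def)
  qed
  have x1S: "(x1, e) \<in> S \<alpha>" using \<open>(x1, e1) \<in> J\<close> e1 interval_subset_strip[OF J] by auto
  show ?thesis unfolding escaping_def
  proof (rule exI[of _ "\<lambda>n. \<xi> \<alpha> (x1, t n)"], rule exI[of _ "\<lambda>n. \<xi> \<alpha> (x2, t n)"],
      rule exI[of _ "\<xi> \<alpha> (x1, e)"], rule exI[of _ "\<xi> \<alpha> (x2, e)"], intro conjI allI)
    show "\<xi> \<alpha> (x1, e) \<in> \<xi> \<alpha> ` J" using \<open>(x1, e1) \<in> J\<close> e1 by auto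
    show "\<exists>v\<in>leaves Z. \<xi> \<alpha> (x1, t n) \<in> v \<and> \<xi> \<alpha> (x2, t n) \<in> v" for n
      by (rule bexI[OF _ internal_leaf[OF \<alpha> tb[of n]]]) simp
    show "compactin T C \<longrightarrow> \<not> (\<forall>\<^sub>F n in sequentially. leafwise_joined C (\<xi> \<alpha> (x1, t n)) (\<xi> \<alpha> (x2, t n)))" for C
    proof (intro impI notI)
      assume C: "compactin T C"
        and "\<forall>\<^sub>F n in sequentially. leafwise_joined C (\<xi> \<alpha> (x1, t n)) (\<xi> \<alpha> (x2, t n))"
      then obtain N where K: "\<And>n. n \<ge> N \<Longrightarrow> leafwise_joined C (\<xi> \<alpha> (x1, t n)) (\<xi> \<alpha> (x2, t n))"
        unfolding eventually_sequentially by blast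
      let ?P = "{p \<in> S \<alpha>. \<xi> \<alpha> p \<in> C}"
      \<comment> \<open>Properness of the chart makes the preimage compact, hence closed in the
        plane and not merely in the strip. The limit point over \<open>c\<close> would then have to
        belong to the strip.\<close>
      have "compactin (top_of_set (S \<alpha>)) ?P"
        using compactin_proper_map_preimage[OF proper_map_chart[OF \<alpha>] C] by simp
      then have P: "closed ?P" by (simp add: compactin_subtopology compact_imp_closed)
      have "(c, t n) \<in> ?P" if n: "n \<ge> N" for n
      proof -
        obtain K v where *: "v \<in> leaves Z" "K \<subseteq> v" "K \<subseteq> C" "connectedin T K" "\<xi> \<alpha> (x1, t n) \<in> K"
          "\<xi> \<alpha> (x2, t n) \<in> K"
          using K[OF n] unfolding leafwise_joined_def by blast
        have v: "v = \<xi> \<alpha> ` (UNIV \<times> {t n})"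
          using leaves_unique[OF *(1) internal_leaf[OF \<alpha> tb[of n]], of "\<xi> \<alpha> (x1, t n)"] * by auto
        \<comment> \<open>The leaf segment is pulled back to the open strip, where the chart is an
          embedding. There it is a connected subset of a horizontal line containing the abscissas
          \<open>x1\<close> and \<open>x2\<close>, hence also \<open>c\<close>.\<close>
        define K' where "K' = {p \<in> open_strip. \<xi> \<alpha> p \<in> K}"
        have KI: "K \<subseteq> \<xi> \<alpha> ` open_strip" using *(2) v tb[of n] by auto
        then have img: "\<xi> \<alpha> ` K' = K" unfolding K'_def by auto
        have "connectedin (top_of_set open_strip) K'"
          using homeomorphic_map_connectedness[OF embedding_chart_interior[OF \<alpha>], of K'] *(4) img KI
          by (auto simp: connectedin_subtopology K'_def)
        then have con: "connected K'" by (simp add: connectedin_subtopology)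
        have "K' \<subseteq> UNIV \<times> {t n}"
        proof
          fix r assume r: "r \<in> K'"
          then obtain u where "\<xi> \<alpha> r = \<xi> \<alpha> (u, t n)" using *(2) v unfolding K'_def by auto
          then have "(u, t n) = r" using chart_eq_interior r unfolding K'_def by blast
          then show "r \<in> UNIV \<times> {t n}" by auto
        qed
        moreover have "(x1, t n) \<in> K'" "(x2, t n) \<in> K'" using * tb[of n] unfolding K'_def by auto
        ultimately have "(c, t n) \<in> K'" using connected_horizontal_segment[OF con] c(2) by blast
        then show ?thesis using *(3) inS unfolding K'_def by auto
      qed
      moreover have "(\<lambda>n. (c, t n)) \<longlonglongrightarrow> (c, e)" using tlim by (intro tendsto_intros)
      ultimately have "(c, e) \<in> ?P"
        using P Lim_in_closed_set[of ?P "\<lambda>n. (c, t n)" sequentially "(c, e)"]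
          by (auto simp: eventually_sequentially)
      then show False using c(1) by simp
    qed
  qed (use lim x1S pe in auto)
qed

section \<open>The boundary of the surface and invariance of domain\<close>

lemma surface_boundary_homeo:
  assumes h: "homeomorphic_map T T h" and z: "z \<in> surface_boundary T"
    shows "h z \<in> surface_boundary T"
proof (rule ccontr)
  assume n: "h z \<notin> surface_boundary T"
  have zT: "z \<in> topspace T" using z by (simp add: surface_boundary_def)
  have hT: "h z \<in> topspace T" using h zT homeomorphic_imp_surjective_map by blast
  then obtain U W where U: "openin T U" "h z \<in> U" "open (W :: (real \<times> real) set)"
    "subtopology T U homeomorphic_space top_of_set W"
    using n unfolding surface_boundary_def by blast
  let ?V = "{x \<in> topspace T. h x \<in> U}"
  have V: "openin T ?V" using homeomorphic_imp_continuous_map[OF h] U(1)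
    unfolding continuous_map by blast
  have "h ` (topspace T \<inter> ?V) = topspace T \<inter> U"
  proof -
    have "\<exists>y\<in>topspace T. x = h y" if "x \<in> topspace T" for x
      using homeomorphic_imp_surjective_map[OF h] that by blast
    then show ?thesis using homeomorphic_imp_surjective_map[OF h] by fast
  qed
  then have "homeomorphic_map (subtopology T ?V) (subtopology T U) h"
    by (rule homeomorphic_map_subtopologies[OF h])
  then have "subtopology T ?V homeomorphic_space top_of_set W"
    using U(4) homeomorphic_map_imp_homeomorphic_space homeomorphic_space_trans by blast
  then show False using z zT V U by (auto simp: surface_boundary_def)
qed

lemma interior_not_boundary:
  assumes \<alpha>: "\<alpha> \<in> A" and p: "p \<in> open_strip" shows "\<xi> \<alpha> p \<notin> surface_boundary T"
proof -
  have "subtopology T (\<xi> \<alpha> ` open_strip) homeomorphic_space top_of_set open_strip"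
    using homeomorphic_map_imp_homeomorphic_space[OF embedding_chart_interior[OF \<alpha>]] homeomorphic_space_sym by blast
  moreover have "openin T (\<xi> \<alpha> ` open_strip)"
    using openin_chart_interior[OF \<alpha> open_open_strip] by simp
  ultimately show ?thesis using p open_open_strip unfolding surface_boundary_def by blast
qed

text \<open>A planar chart of the surface at such a point would make a relatively open part of the
  strip homeomorphic to an open set of the plane. By invariance of domain that part would be open in
  the plane, although it contains a point on the edge of the band.\<close>

lemma unglued_interval_boundary:
  assumes \<alpha>: "\<alpha> \<in> A" and J: "J \<in> boundary_intervals (S \<alpha>)"
    and n: "\<not> (\<exists>\<alpha>' J' \<phi>. glued_by Z \<alpha> J \<alpha>' J' \<phi>)"
    and p: "p \<in> J"
  shows "\<xi> \<alpha> p \<in> surface_boundary T"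
proof (rule ccontr)
  assume nb: "\<xi> \<alpha> p \<notin> surface_boundary T"
  note mod = model[OF \<alpha>]
  have pS: "p \<in> S \<alpha>" using p interval_subset_strip[OF J] by blast
  have pb: "p \<in> strip_boundary (S \<alpha>)" using p boundary_intervals_subset[OF J] by blast
  obtain U W' where U: "openin T U" "\<xi> \<alpha> p \<in> U" "open (W' :: (real \<times> real) set)"
    "subtopology T U homeomorphic_space top_of_set W'"
    using nb chart_in_topspace[OF \<alpha> pS] unfolding surface_boundary_def by blast
  \<comment> \<open>Removing all other boundary intervals leaves a relatively open part of the strip
    none of whose points is glued, so the chart embeds it as an open set of the surface.\<close>
  let ?W = "S \<alpha> - (strip_boundary (S \<alpha>) - J)"
  have W: "openin (top_of_set (S \<alpha>)) ?W"
    using boundary_interval_closedin(2)[OF mod J] by auto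
  have sat: "\<beta> = \<alpha> \<and> p' = r" if r: "r \<in> ?W" "\<xi> \<alpha> r = \<xi> \<beta> p'" for r \<beta> p'
  proof (cases "r \<in> J")
    case True
    have False if g: "glued_by Z \<alpha> K \<beta> K' \<phi>" "r \<in> K" for K K' \<phi>
    proof -
      have "K = J" using boundary_intervals_unique[OF glued_by_intervals(3)[OF g(1)] J g(2) True] .
      then show False using n g(1) by blast
    qed
    then show ?thesis using r(2) unfolding chart_eq_iff by blast
  next
    case False
    then have "r \<in> open_strip" using r strip_boundary_eq[OF mod] by auto
    then show ?thesis using chart_eq_interior r(2) by blast
  qed
  have hm: "homeomorphic_map (top_of_set ?W) (subtopology T (\<xi> \<alpha> ` ?W)) (\<xi> \<alpha>)"
    by (rule embedding_chart_open[OF \<alpha> W sat])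
  define N where "N = U \<inter> \<xi> \<alpha> ` ?W"
  have N: "openin T N" unfolding N_def using U(1) openin_chart_image[OF \<alpha> W sat] by blast
  define W1 where "W1 = {r \<in> ?W. \<xi> \<alpha> r \<in> U}"
  have "\<xi> \<alpha> ` (topspace (top_of_set ?W) \<inter> W1) = topspace (subtopology T (\<xi> \<alpha> ` ?W)) \<inter> N"
    using openin_subset[OF N] unfolding N_def W1_def by auto
  then have "homeomorphic_map (subtopology (top_of_set ?W) W1) (subtopology (subtopology T (\<xi> \<alpha> ` ?W)) N) (\<xi> \<alpha>)"
    by (rule homeomorphic_map_subtopologies[OF hm])
  moreover have "?W \<inter> W1 = W1" "\<xi> \<alpha> ` ?W \<inter> N = N" unfolding N_def W1_def by auto
  ultimately have h1: "top_of_set W1 homeomorphic_space subtopology T N"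
    using homeomorphic_map_imp_homeomorphic_space by (fastforce simp: subtopology_subtopology)
  obtain k where k: "homeomorphic_map (subtopology T U) (top_of_set W') k"
    using U(4) homeomorphic_space by blast
  define M where "M = k ` N"
  have NU: "N \<subseteq> U" unfolding N_def by auto
  have kU: "k ` U = W'" using homeomorphic_imp_surjective_map[OF k] openin_subset[OF U(1)]
    by (simp add: Int_absorb1)
  have "openin (subtopology T U) N"
    using N NU by (metis openin_subtopology_Int openin_subtopology Int_absorb2)
  then have "openin (top_of_set W') M"
    using k unfolding M_def by (metis homeomorphic_imp_open_map open_map_def)
  then have M: "open M" using U(3) openin_open_trans by blast
  have "k ` (topspace (subtopology T U) \<inter> N) = topspace (top_of_set W') \<inter> M"
    using NU kU openin_subset[OF N] unfolding M_def by auto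
  then have "homeomorphic_map (subtopology (subtopology T U) N) (subtopology (top_of_set W') M) k"
    by (rule homeomorphic_map_subtopologies[OF k])
  moreover have "U \<inter> N = N" "W' \<inter> M = M" using NU kU unfolding M_def by auto
  ultimately have "subtopology T N homeomorphic_space top_of_set M"
    using homeomorphic_map_imp_homeomorphic_space by (fastforce simp: subtopology_subtopology)
  then have "top_of_set M homeomorphic_space top_of_set W1"
    using h1 homeomorphic_space_trans homeomorphic_space_sym by blast
  then obtain g where g: "homeomorphic_map (top_of_set M) (top_of_set W1) g"
    using homeomorphic_space by blast
  \<comment> \<open>Invariance of domain for the composite of the two charts, restricted to the
    common neighbourhood \<open>N\<close>.\<close>
  have "open (g ` M)"
    using homeomorphic_imp_continuous_map[OF g] homeomorphic_imp_injective_map[OF g] M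
    by (intro invariance_of_domain) auto
  then have "open W1" using homeomorphic_imp_surjective_map[OF g] by simp
  moreover have "p \<in> W1" using U(2) p pS unfolding W1_def by auto
  ultimately obtain d where d: "d > 0" "cball p d \<subseteq> W1" using open_contains_cball by blast
  \<comment> \<open>As the ordinate of \<open>p\<close> is 1 or -1, this moves \<open>p\<close>
    vertically by \<open>d\<close>, out of the closed band.\<close>
  let ?r = "(fst p, snd p + d * snd p)"
  have s: "snd p \<in> {-1, 1}" using pb by (simp add: mem_strip_boundary)
  have "dist p ?r = d" using s d(1) by (cases p) (auto simp: dist_Pair_Pair dist_real_def)
  then have "?r \<in> W1" using d(2) by (metis mem_cball order_refl subsetD)
  then have "?r \<in> S \<alpha>" unfolding W1_def by auto
  then show False using model_strip_subset[OF mod] s d(1) by auto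
qed

end

section \<open>Consequences of reducedness: recognition of the singular leaves\<close>

locale reduced_stripped = stripped +
  assumes reduced: "reduced Z"
begin

text \<open>A gluing of two entire sides is of type (c1) or (c2), which reducedness forbids. So one
  of the two intervals is not its whole side, and \<open>interval_escaping\<close> applies to it;
  both intervals have the same image in the surface.\<close>

lemma glued_interval_special:
  assumes g: "glued_by Z \<alpha> J \<alpha>' J' \<phi>"
  shows "special_leaf Z (\<xi> \<alpha> ` J)" "escaping (\<xi> \<alpha> ` J)"
proof -
  note I = glued_by_intervals[OF g]
  obtain \<beta> where \<beta>: "\<beta> \<in> glue_index Z" and
    or: "glue_Y Z \<beta> = (\<alpha>, J) \<and> glue_X Z \<beta> = (\<alpha>', J') \<or> glue_X Z \<beta> = (\<alpha>, J) \<and> glue_Y Z \<beta> = (\<alpha>', J')"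
    using g unfolding glued_by_def by blast
  have side: "\<exists>e\<in>{-1,1}. J \<subseteq> strip_side (S \<alpha>) e" if in_A: "\<alpha> \<in> A" "J \<in> boundary_intervals (S \<alpha>)"
    for \<alpha> J
  proof -
    obtain a b e where "e \<in> {-1, 1}" "J = {a<..<b} \<times> {e}" "J \<subseteq> S \<alpha>"
      using boundary_intervals_cases[OF model[OF in_A(1)] in_A(2)] by metis
    then show ?thesis by (auto simp: strip_side_def)
  qed
  obtain e where e: "e \<in> {-1,1}" "J \<subseteq> strip_side (S \<alpha>) e" using side I by blast
  obtain e' where e': "e' \<in> {-1,1}" "J' \<subseteq> strip_side (S \<alpha>') e'" using side I by blast
  note eq = glued_leaf_image[OF g]
  let ?w = "\<xi> \<alpha> ` J"
  \<comment> \<open>\<open>glued_by\<close> is symmetric, whereas \<open>glued_leaf\<close> puts the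
    interval X first, so both orders have to be kept.\<close>
  have gl: "glued_leaf Z ?w \<alpha> J e \<alpha>' J' e' \<or> glued_leaf Z ?w \<alpha>' J' e' \<alpha> J e"
    unfolding glued_leaf_def using or \<beta> e e' eq by blast
  have "?w \<in> leaves Z" using interval_leaf I by blast
  then have "\<not> c1_leaf Z ?w" "\<not> c2_leaf Z ?w" using reduced unfolding reduced_def by auto
  then have ne: "J \<noteq> strip_side (S \<alpha>) e \<or> J' \<noteq> strip_side (S \<alpha>') e'"
    using gl unfolding c1_leaf_def c2_leaf_def by metis
  show "special_leaf Z ?w" using gl ne unfolding special_leaf_def by blast
  show "escaping ?w" using interval_escaping I e(2) e'(2) ne eq by metis
qed

text \<open>Each alternative couples the type of the leaf with a property that foliated
  homeomorphisms preserve and internal leaves lack.\<close>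

lemma interval_boundary_or_escaping:
  assumes "\<alpha> \<in> A" "J \<in> boundary_intervals (S \<alpha>)"
  shows "boundary_leaf Z (\<xi> \<alpha> ` J) \<and> \<xi> \<alpha> ` J \<subseteq> surface_boundary T \<or>
    special_leaf Z (\<xi> \<alpha> ` J) \<and> escaping (\<xi> \<alpha> ` J)"
proof (cases "\<exists>\<alpha>' J' \<phi>. glued_by Z \<alpha> J \<alpha>' J' \<phi>")
  case False
  then have "\<xi> \<alpha> ` J \<subseteq> surface_boundary T" using unglued_interval_boundary[OF assms] by blast
  moreover have "\<xi> \<alpha> ` J \<subseteq> surface_strip_boundary Z \<alpha>"
    using boundary_intervals_subset[OF assms(2)] unfolding surface_strip_boundary_def by blast
  ultimately show ?thesis using interval_leaf[OF assms] assms(1)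
    unfolding boundary_leaf_def by blast
qed (use glued_interval_special in blast)

text \<open>Translates condition (c), stated through the types of leaves, into a condition on
  boundary intervals, which is the form used from here on.\<close>

lemma subset_Sigma_leaves_iff:
  assumes w: "w \<in> leaves Z"
  shows "w \<subseteq> Sigma_leaves Z \<longleftrightarrow> (\<exists>\<alpha>\<in>A. \<exists>J\<in>boundary_intervals (S \<alpha>). w = \<xi> \<alpha> ` J)"
proof
  assume sub: "w \<subseteq> Sigma_leaves Z"
  have sing: "v \<subseteq> singular" if v: "boundary_leaf Z v \<or> special_leaf Z v" for v
    using v
  proof
    assume "boundary_leaf Z v"
    then show ?thesis unfolding boundary_leaf_def surface_strip_boundary_def singular_def by blast
  next
    assume "special_leaf Z v"
    then obtain \<gamma> J where "\<gamma> \<in> A" "J \<in> boundary_intervals (S \<gamma>)" "v = \<xi> \<gamma> ` J"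
      unfolding special_leaf_def glued_leaf_def using glue_intervals by (metis fst_conv snd_conv)
    then show ?thesis using boundary_intervals_subset unfolding singular_def by blast
  qed
  have ws: "w \<subseteq> singular" using sub sing unfolding Sigma_leaves_def by blast
  from w show "\<exists>\<alpha>\<in>A. \<exists>J\<in>boundary_intervals (S \<alpha>). w = \<xi> \<alpha> ` J"
  proof (cases rule: leaves_cases)
    case (internal \<alpha> t)
    have "(0, t) \<in> S \<alpha>" using open_strip_subset[OF model[OF internal(1)]] internal by auto
    moreover have "\<xi> \<alpha> (0, t) \<in> singular" using ws internal by auto
    ultimately show ?thesis using chart_singular_iff internal by (auto simp: mem_strip_boundary)
  qed blast
next
  assume "\<exists>\<alpha>\<in>A. \<exists>J\<in>boundary_intervals (S \<alpha>). w = \<xi> \<alpha> ` J"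
  then show "w \<subseteq> Sigma_leaves Z" using w interval_boundary_or_escaping
    unfolding Sigma_leaves_def by blast
qed

text \<open>An internal leaf is not escaping and does not meet the boundary of the surface, while an
  interval leaf is escaping or lies in that boundary. So no interval leaf can be mapped onto an
  internal one.\<close>

lemma Homeo_singular_subset:
  assumes h: "h \<in> Homeo Z" shows "h ` singular \<subseteq> singular"
proof clarify
  fix z assume "z \<in> singular"
  then obtain \<alpha> p where p: "\<alpha> \<in> A" "p \<in> strip_boundary (S \<alpha>)" "z = \<xi> \<alpha> p"
    unfolding singular_def by blast
  obtain J where J: "J \<in> boundary_intervals (S \<alpha>)" "p \<in> J"
    using boundary_interval_of_point[OF p(2)] .
  have "h ` \<xi> \<alpha> ` J \<in> leaves Z" using HomeoD(3)[OF h] interval_leaf[OF p(1) J(1)] by blast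
  then show "h z \<in> singular"
  proof (cases rule: leaves_cases)
    case (internal \<beta> t)
    have "\<not> escaping (\<xi> \<alpha> ` J)"
      using escaping_homeo[OF h] internal_not_escaping internal by metis
    then have "z \<in> surface_boundary T"
      using interval_boundary_or_escaping[OF p(1) J(1)] p(3) J(2) by blast
    then have "h z \<in> surface_boundary T" using surface_boundary_homeo HomeoD(2)[OF h] by blast
    moreover obtain x where "h z = \<xi> \<beta> (x, t)" using internal(4) p(3) J(2) by blast
    ultimately show ?thesis using interior_not_boundary[OF internal(1), of "(x, t)"] internal
      by auto
  next
    case (singular \<beta> K)
    moreover have "h z \<in> h ` \<xi> \<alpha> ` J" using p(3) J(2) by blast
    ultimately have "h z \<in> \<xi> \<beta> ` K" by simp
    then show ?thesis using boundary_intervals_subset[OF singular(2)] singular(1)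
      unfolding singular_def by blast
  qed
qed

lemma Homeo_singular_iff:
  assumes h: "h \<in> Homeo Z" and z: "z \<in> topspace T" shows "h z \<in> singular \<longleftrightarrow> z \<in> singular"
proof -
  obtain k where k: "k \<in> Homeo Z" "\<And>z. z \<in> topspace T \<Longrightarrow> k (h z) = z"
    using Homeo_inverse[OF h] by metis
  show ?thesis using Homeo_singular_subset[OF h] Homeo_singular_subset[OF k(1)] k(2)[OF z]
    by (metis image_subset_iff)
qed

end

text \<open>The balls are open and, by the separation, pairwise disjoint, so a connected set covered
  by them lies in one. This is what keeps a lifting from jumping between the points of a
  fibre.\<close>

lemma connected_subset_ball:
  fixes C :: "'a :: metric_space set"
  assumes C: "connected C" and cover: "\<And>c. c \<in> C \<Longrightarrow> \<exists>q\<in>F. dist c q < \<epsilon>"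
    and sep: "\<And>q q'. \<lbrakk>q \<in> F; q' \<in> F; q \<noteq> q'\<rbrakk> \<Longrightarrow> 2 * \<epsilon> \<le> dist q q'"
    and c0: "c0 \<in> C" "dist c0 q0 < \<epsilon>" "q0 \<in> F" and c: "c \<in> C"
  shows "dist c q0 < \<epsilon>"
proof (rule ccontr)
  assume n: "\<not> dist c q0 < \<epsilon>"
  let ?U = "ball q0 \<epsilon>" and ?V = "\<Union>q\<in>F - {q0}. ball q \<epsilon>"
  have "C \<subseteq> ?U \<union> ?V" using cover by (fastforce simp: dist_commute)
  moreover have "?U \<inter> ?V = {}"
  proof -
    have False if "dist q0 x < \<epsilon>" "dist q x < \<epsilon>" "q \<in> F" "q \<noteq> q0" for q x
      using sep[OF that(3) c0(3) that(4)] dist_triangle2[of q q0 x] that(1,2)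
        by (simp add: dist_commute)
    then show ?thesis unfolding disjoint_iff mem_ball UN_iff by blast
  qed
  moreover have "c0 \<in> ?U \<inter> C" using c0 by (simp add: dist_commute)
  then have "?U \<inter> C \<noteq> {}" by blast
  moreover have "?V \<inter> C \<noteq> {}" using cover[OF c] n c by (fastforce simp: dist_commute)
  ultimately show False using connectedD[OF C, of ?U ?V] by blast
qed

lemma finite_set_separated:
  fixes F :: "'a :: metric_space set"
  assumes "finite F"
  obtains \<epsilon> where "\<epsilon> > 0" "\<And>q q'. \<lbrakk>q \<in> F; q' \<in> F; q \<noteq> q'\<rbrakk> \<Longrightarrow> 2 * \<epsilon> \<le> dist q q'"
proof
  \<comment> \<open>The element 1 only keeps the set nonempty when \<open>F\<close> has fewer than
    two points.\<close>
  let ?M = "insert 1 ((\<lambda>(q, q'). dist q q' / 2) ` {(q, q') \<in> F \<times> F. q \<noteq> q'})"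
  have fin: "finite ?M" using assms by (auto intro: finite_subset[of _ "F \<times> F"])
  show "Min ?M > 0" using fin by (subst Min_gr_iff) auto
  show "2 * Min ?M \<le> dist q q'" if "q \<in> F" "q' \<in> F" "q \<noteq> q'" for q q'
  proof -
    have "dist q q' / 2 \<in> ?M" using that by (intro insertI2 image_eqI[of _ _ "(q, q')"]) auto
    then have "Min ?M \<le> dist q q' / 2" using fin by (rule Min_le[rotated])
    then show ?thesis by simp
  qed
qed

context stripped
begin

section \<open>Liftings\<close>

text \<open>Separation comes from finiteness of the fibre, the neighbourhoods from closedness of the
  chart. The constant \<epsilon>0 is fixed before \<epsilon>, so the radius can be shrunk later
  without losing the separation.\<close>

lemma fibre_nhd:
  assumes \<alpha>: "\<alpha> \<in> A" and z: "z \<in> topspace T"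
  obtains \<epsilon>0 where "\<epsilon>0 > 0"
    "\<And>q q'. \<lbrakk>q \<in> S \<alpha>; q' \<in> S \<alpha>; \<xi> \<alpha> q = z; \<xi> \<alpha> q' = z; q \<noteq> q'\<rbrakk> \<Longrightarrow> 2 * \<epsilon>0 \<le> dist q q'"
    "\<And>\<epsilon>. \<epsilon> > 0 \<Longrightarrow> \<exists>U. openin T U \<and> z \<in> U \<and>
        (\<forall>p\<in>S \<alpha>. \<xi> \<alpha> p \<in> U \<longrightarrow> (\<exists>q\<in>{q \<in> S \<alpha>. \<xi> \<alpha> q = z}. dist p q < \<epsilon>))"
proof -
  let ?F = "{q \<in> S \<alpha>. \<xi> \<alpha> q = z}"
  have "finite ?F" by (rule finite_subset[OF _ finite_chart_fibre[of \<alpha> z]]) auto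
  then obtain \<epsilon>0 where "\<epsilon>0 > 0" "\<And>q q'. \<lbrakk>q \<in> ?F; q' \<in> ?F; q \<noteq> q'\<rbrakk> \<Longrightarrow> 2 * \<epsilon>0 \<le> dist q q'"
    by (rule finite_set_separated) (rule that)
  moreover have "\<exists>U. openin T U \<and> z \<in> U \<and> (\<forall>p\<in>S \<alpha>. \<xi> \<alpha> p \<in> U \<longrightarrow> (\<exists>q\<in>?F. dist p q < \<epsilon>))"
    if \<epsilon>: "\<epsilon> > 0" for \<epsilon>
  proof -
    let ?E = "S \<alpha> \<inter> (\<Union>q\<in>?F. ball q \<epsilon>)"
    have "openin (top_of_set (S \<alpha>)) ?E" by (intro openin_open_Int open_UN) auto
    moreover have "p \<in> ?E" if "p \<in> S \<alpha>" "\<xi> \<alpha> p = z" for p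
      using that \<epsilon> by (intro IntI UN_I[of p]) simp_all
    ultimately obtain U where "openin T U" "z \<in> U" "\<And>p. p \<in> S \<alpha> \<Longrightarrow> \<xi> \<alpha> p \<in> U \<Longrightarrow> p \<in> ?E"
      using chart_nhd[OF \<alpha> z] by blast
    then show ?thesis by (intro exI[of _ U]) (fastforce simp: dist_commute)
  qed
  ultimately show ?thesis using that by blast
qed

lemma open_strip_ball:
  assumes \<alpha>: "\<alpha> \<in> A" and p: "p \<in> S \<alpha>" and d: "d > 0"
  obtains r where "r \<in> open_strip" "dist r p < d"
proof -
  have "p \<in> closure open_strip" using strip_subset_closure[OF model[OF \<alpha>]] p by blast
  then show ?thesis using that d unfolding closure_approachable by blast
qed

text \<open>Near a boundary point the values of the lift over the interior are close to one of finitely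
  many points; which one does not vary, since half discs are connected.\<close>

lemma lift_extends:
  assumes \<alpha>: "\<alpha> \<in> A" and h: "continuous_map T T h"
    and inv: "h ` surface_strip Z \<alpha> \<subseteq> surface_strip Z \<alpha>"
    and int: "h ` \<xi> \<alpha> ` open_strip \<subseteq> \<xi> \<alpha> ` open_strip"
  obtains g where "continuous_on (S \<alpha>) g" "g ` S \<alpha> \<subseteq> S \<alpha>" "g ` open_strip \<subseteq> open_strip"
    "\<And>p. p \<in> S \<alpha> \<Longrightarrow> \<xi> \<alpha> (g p) = h (\<xi> \<alpha> p)"
proof -
  let ?I = open_strip
  have IS: "?I \<subseteq> S \<alpha>" using open_strip_subset[OF model[OF \<alpha>]] .
  have cont: "continuous_map (top_of_set (S \<alpha>)) T (h \<circ> \<xi> \<alpha>)"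
    using continuous_chart[OF \<alpha>] h by (rule continuous_map_compose)
  have "\<exists>r\<in>?I. \<xi> \<alpha> r = h (\<xi> \<alpha> p)" if "p \<in> ?I" for p
  proof -
    have "h (\<xi> \<alpha> p) \<in> \<xi> \<alpha> ` ?I" using int that by blast
    then show ?thesis by (metis imageE)
  qed
  then obtain g0 where g0: "\<And>p. p \<in> ?I \<Longrightarrow> g0 p \<in> ?I" "\<And>p. p \<in> ?I \<Longrightarrow> \<xi> \<alpha> (g0 p) = h (\<xi> \<alpha> p)"
    by metis
  have g0c: "continuous_on ?I g0"
  proof -
    have "openin (top_of_set ?I) {p \<in> ?I. g0 p \<in> W}" if W: "open W" for W
    proof -
      have eq: "{p \<in> ?I. g0 p \<in> W} = ?I \<inter> {p \<in> S \<alpha>. (h \<circ> \<xi> \<alpha>) p \<in> \<xi> \<alpha> ` (W \<inter> ?I)}" (is "?l = ?r")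
      proof (intro set_eqI iffI)
        fix p assume "p \<in> ?l" then show "p \<in> ?r" using g0[of p] IS by (auto simp: image_iff) 
      next
        fix p assume p: "p \<in> ?r"
        then obtain r where r: "r \<in> W" "r \<in> ?I" "h (\<xi> \<alpha> p) = \<xi> \<alpha> r" by auto
        have "g0 p = r" using inj_onD[OF inj_chart_interior, of \<alpha> "g0 p" r] g0[of p] p r by auto
        then show "p \<in> ?l" using p r by auto
      qed
      have "openin T (\<xi> \<alpha> ` (W \<inter> ?I))"
        using W open_open_strip by (intro openin_chart_interior[OF \<alpha>] open_Int) auto
      then have "openin (top_of_set (S \<alpha>)) {p \<in> S \<alpha>. (h \<circ> \<xi> \<alpha>) p \<in> \<xi> \<alpha> ` (W \<inter> ?I)}"
        using cont unfolding continuous_map by simp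
      then obtain O' where O': "open O'" "{p \<in> S \<alpha>. (h \<circ> \<xi> \<alpha>) p \<in> \<xi> \<alpha> ` (W \<inter> ?I)} = S \<alpha> \<inter> O'"
        unfolding openin_open by (elim exE conjE) (rule that)
      have "?I \<inter> (S \<alpha> \<inter> O') = ?I \<inter> O'" using IS by blast
      then show ?thesis unfolding eq O'(2) using O'(1) by (simp add: openin_open_Int)
    qed
    then have "\<exists>O'. open O' \<and> {p \<in> ?I. g0 p \<in> W} = ?I \<inter> O'" if "open W" for W
      using that unfolding openin_open by blast
    moreover have "{p \<in> ?I. g0 p \<in> W} = g0 -` W \<inter> ?I" for W by blast
    ultimately show ?thesis unfolding continuous_on_open_invariant by (metis Int_commute)
  qed
  have lim: "\<exists>l\<in>S \<alpha>. (g0 \<longlongrightarrow> l) (at p0 within ?I) \<and> \<xi> \<alpha> l = h (\<xi> \<alpha> p0)" if p0: "p0 \<in> S \<alpha>" for p0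
  proof -
    define z where "z = h (\<xi> \<alpha> p0)"
    let ?F = "{q \<in> S \<alpha>. \<xi> \<alpha> q = z}"
    have zT: "z \<in> topspace T"
      using continuous_map_funspace[OF h] chart_in_topspace[OF \<alpha> p0] unfolding z_def by auto
    obtain \<epsilon>0 where \<epsilon>0: "\<epsilon>0 > 0"
      "\<And>q q'. \<lbrakk>q \<in> S \<alpha>; q' \<in> S \<alpha>; \<xi> \<alpha> q = z; \<xi> \<alpha> q' = z; q \<noteq> q'\<rbrakk> \<Longrightarrow> 2 * \<epsilon>0 \<le> dist q q'"
      "\<And>\<epsilon>. \<epsilon> > 0 \<Longrightarrow> \<exists>U. openin T U \<and> z \<in> U \<and> (\<forall>p\<in>S \<alpha>. \<xi> \<alpha> p \<in> U \<longrightarrow> (\<exists>q\<in>?F. dist p q < \<epsilon>))"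
      using fibre_nhd[OF \<alpha> zT] by blast
    have near: "\<exists>d>0. \<forall>p\<in>?I. dist p p0 < d \<longrightarrow> (\<exists>q\<in>?F. dist (g0 p) q < \<epsilon>)" if \<epsilon>: "\<epsilon> > 0" for \<epsilon>
    proof -
      obtain U where U: "openin T U" "z \<in> U" "\<forall>p\<in>S \<alpha>. \<xi> \<alpha> p \<in> U \<longrightarrow> (\<exists>q\<in>?F. dist p q < \<epsilon>)"
        using \<epsilon>0(3)[OF \<epsilon>] by (elim exE conjE) (rule that)
      have "openin (top_of_set (S \<alpha>)) {p \<in> S \<alpha>. (h \<circ> \<xi> \<alpha>) p \<in> U}" using cont U(1)
        unfolding continuous_map by simp
      moreover have "p0 \<in> {p \<in> S \<alpha>. (h \<circ> \<xi> \<alpha>) p \<in> U}" using p0 U(2) by (simp add: z_def)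
      ultimately obtain d where d: "d > 0" "\<forall>p\<in>S \<alpha>. dist p p0 < d \<longrightarrow> p \<in> {p \<in> S \<alpha>. (h \<circ> \<xi> \<alpha>) p \<in> U}"
        unfolding openin_euclidean_subtopology_iff by blast
      have "\<exists>q\<in>?F. dist (g0 p) q < \<epsilon>" if p: "p \<in> ?I" "dist p p0 < d" for p
      proof -
        have "p \<in> S \<alpha>" using p(1) IS by blast
        then have "h (\<xi> \<alpha> p) \<in> U" using d(2) p(2) by simp
        then have "\<xi> \<alpha> (g0 p) \<in> U" using g0(2)[OF p(1)] by simp
        moreover have "g0 p \<in> S \<alpha>" by (rule subsetD[OF IS g0(1)[OF p(1)]])
        ultimately show ?thesis using U(3) by simp
      qed
      then show ?thesis using d(1) by blast
    qed
    obtain d0 where d0: "d0 > 0" "\<forall>p\<in>?I. dist p p0 < d0 \<longrightarrow> (\<exists>q\<in>?F. dist (g0 p) q < \<epsilon>0)"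
      using near[OF \<epsilon>0(1)] by (elim exE conjE) (rule that)
    obtain r where r: "r \<in> ?I" "dist r p0 < d0" using open_strip_ball[OF \<alpha> p0 d0(1)] .
    obtain l where l: "l \<in> ?F" "dist (g0 r) l < \<epsilon>0" using d0(2) r by blast
    let ?D = "ball p0 d0 \<inter> ?I"
    have "connected ?D"
      by (intro convex_connected convex_Int convex_ball convex_Times) auto
    then have con: "connected (g0 ` ?D)"
      using g0c continuous_on_subset connected_continuous_image by blast
    have in_l: "dist (g0 p) l < \<epsilon>0" if "p \<in> ?I" "dist p p0 < d0" for p
    proof (rule connected_subset_ball[OF con, where F = ?F])
      show "\<exists>q\<in>?F. dist c q < \<epsilon>0" if "c \<in> g0 ` ?D" for c
        using that d0(2) by (auto simp: dist_commute)
      show "2 * \<epsilon>0 \<le> dist q q'" if "q \<in> ?F" "q' \<in> ?F" "q \<noteq> q'" for q q' using \<epsilon>0(2) that by blast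
      show "g0 r \<in> g0 ` ?D" "g0 p \<in> g0 ` ?D" using r that by (auto simp: dist_commute)
    qed (use l in auto)
    have "(g0 \<longlongrightarrow> l) (at p0 within ?I)"
    proof (rule tendstoI)
      fix e :: real assume e: "e > 0"
      then obtain d where d: "d > 0" "\<forall>p\<in>?I. dist p p0 < d \<longrightarrow> (\<exists>q\<in>?F. dist (g0 p) q < min e \<epsilon>0)"
        using near[of "min e \<epsilon>0"] \<epsilon>0(1) by auto
      have "dist (g0 p) l < e" if p: "p \<in> ?I" "dist p p0 < min d d0" for p
      proof -
        have "\<exists>q\<in>?F. dist (g0 p) q < min e \<epsilon>0"
          by (rule mp[OF bspec[OF d(2) p(1)]]) (use p(2) in simp)
        then obtain q' where q': "q' \<in> ?F" "dist (g0 p) q' < min e \<epsilon>0" by (elim bexE) (rule that)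
        \<comment> \<open>Points of the fibre closer than the separation constant coincide, so the
          approximations found for all smaller radii name the same point \<open>l\<close>.\<close>
        have "dist q' l < 2 * \<epsilon>0"
          using in_l[OF p(1)] p(2) q'(2) dist_triangle3[of q' l "g0 p"] by simp
        then have "q' = l" using \<epsilon>0(2)[of q' l] q'(1) l(1) by force
        then show ?thesis using q'(2) by simp
      qed
      then show "\<forall>\<^sub>F p in at p0 within ?I. dist (g0 p) l < e"
        unfolding eventually_at using d(1) d0(1) by (intro exI[of _ "min d d0"]) auto
    qed
    then show ?thesis using l(1) unfolding z_def by blast
  qed
  then obtain l where l: "\<And>p. p \<in> S \<alpha> \<Longrightarrow> l p \<in> S \<alpha>" "\<And>p. p \<in> S \<alpha> \<Longrightarrow> (g0 \<longlongrightarrow> l p) (at p within ?I)"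
    "\<And>p. p \<in> S \<alpha> \<Longrightarrow> \<xi> \<alpha> (l p) = h (\<xi> \<alpha> p)" by metis
  obtain g where g: "continuous_map (subtopology euclidean (S \<alpha>)) (top_of_set (S \<alpha>)) g"
    "\<And>x. x \<in> ?I \<Longrightarrow> g x = g0 x"
  proof (rule continuous_map_extension_pointwise_alt[of "top_of_set (S \<alpha>)" ?I "S \<alpha>" euclidean g0])
    show "regular_space (top_of_set (S \<alpha>))"
      using metrizable_imp_regular_space metrizable_space_subtopology metrizable_space_euclidean
        by blast
    show "?I \<subseteq> S \<alpha>" by (rule IS)
    show "S \<alpha> \<subseteq> euclidean closure_of ?I" using strip_subset_closure[OF model[OF \<alpha>]] by simp
    show "continuous_map (subtopology euclidean ?I) (top_of_set (S \<alpha>)) g0"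
      using g0c g0(1) IS by auto
    show "\<exists>l. limitin (top_of_set (S \<alpha>)) g0 l (atin_within euclidean t ?I)" if t: "t \<in> S \<alpha> - ?I"
      for t
    proof -
      have "\<forall>\<^sub>F p in at t within ?I. g0 p \<in> S \<alpha>"
        unfolding eventually_at using g0(1) IS by (intro exI[of _ 1]) auto
      moreover have "atin_within euclidean t ?I = at t within ?I"
        by (simp add: filter_eq_iff eventually_atin_within eventually_at_topological) meson
      ultimately show ?thesis using l(1,2)[of t] t
        by (intro exI[of _ "l t"]) (auto simp: limitin_subtopology)
    qed
  qed (use that in blast)
  have gc: "continuous_on (S \<alpha>) g" and gS: "g ` S \<alpha> \<subseteq> S \<alpha>"
    using g(1) by (auto simp: continuous_map_in_subtopology)
  \<comment> \<open>The extension is known explicitly only over the interior; uniqueness of limits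
    identifies its boundary values with the points \<open>l p\<close>, which are known to lie over
    the right points of the surface.\<close>
  have "g p = l p" if p: "p \<in> S \<alpha>" for p
  proof (rule tendsto_unique)
    have "p \<in> closure ?I" using strip_subset_closure[OF model[OF \<alpha>]] p by blast
    have "p islimpt ?I"
    proof (cases "p \<in> ?I")
      case True then show ?thesis
        using open_open_strip interior_limit_point by (metis interior_open)
    next
      case False then show ?thesis using \<open>p \<in> closure ?I\<close> by (simp add: closure_def)
    qed
    then show "at p within ?I \<noteq> bot" by (simp add: trivial_limit_within)
    have "(g \<longlongrightarrow> g p) (at p within ?I)"
      using gc p IS unfolding continuous_on_def by (meson tendsto_within_subset)
    then show "(g0 \<longlongrightarrow> g p) (at p within ?I)"
      by (rule Lim_transform_eventually) (use g(2) in \<open>auto simp: eventually_at_filter\<close>)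
    show "(g0 \<longlongrightarrow> l p) (at p within ?I)" using l(2)[OF p] .
  qed
  then show ?thesis using that[OF gc gS] l(3) g(2) g0(1) by (simp add: image_subset_iff)
qed

lemma continuous_eq_on_strip:
  fixes f g :: "real \<times> real \<Rightarrow> real \<times> real"
  assumes \<alpha>: "\<alpha> \<in> A" and f: "continuous_on (S \<alpha>) f" and g: "continuous_on (S \<alpha>) g"
    and eq: "\<And>p. p \<in> open_strip \<Longrightarrow> f p = g p" and p: "p \<in> S \<alpha>"
  shows "f p = g p"
proof (rule forall_in_closure_of_eq[of p "top_of_set (S \<alpha>)" open_strip euclidean f g])
  show "p \<in> top_of_set (S \<alpha>) closure_of open_strip"
    using p strip_subset_closure[OF model[OF \<alpha>]] open_strip_subset[OF model[OF \<alpha>]]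
    by (auto simp: closure_of_subtopology Int_absorb1)
qed (use f g eq in auto)

end

context reduced_stripped
begin

section \<open>Existence and uniqueness of liftings\<close>

abbreviation strips_invariant where
  "strips_invariant h \<equiv> \<forall>\<alpha>\<in>A. h ` surface_strip Z \<alpha> = surface_strip Z \<alpha>"

lemma strip_minus_singular: "\<alpha> \<in> A \<Longrightarrow> \<xi> \<alpha> ` open_strip = surface_strip Z \<alpha> - singular"
  using chart_singular_iff strip_boundary_eq[OF model] open_strip_subset[OF model]
    unfolding surface_strip_def by blast

lemma Homeo_interior:
  assumes h: "h \<in> Homeo Z" and \<alpha>: "\<alpha> \<in> A" and inv: "h ` surface_strip Z \<alpha> = surface_strip Z \<alpha>"
  shows "h ` \<xi> \<alpha> ` open_strip = \<xi> \<alpha> ` open_strip"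
proof -
  have sub: "surface_strip Z \<alpha> \<subseteq> topspace T" using \<alpha>
    unfolding surface_strip_def topspace_surface by blast
  show ?thesis unfolding strip_minus_singular[OF \<alpha>]
  proof (intro equalityI subsetI)
    fix y assume "y \<in> h ` (surface_strip Z \<alpha> - singular)"
    then obtain z where z: "z \<in> surface_strip Z \<alpha>" "z \<notin> singular" "y = h z" by blast
    then show "y \<in> surface_strip Z \<alpha> - singular"
      using inv Homeo_singular_iff[OF h, of z] sub by blast
  next
    fix y assume y: "y \<in> surface_strip Z \<alpha> - singular"
    then obtain z where z: "z \<in> surface_strip Z \<alpha>" "y = h z" using inv by blast
    then show "y \<in> h ` (surface_strip Z \<alpha> - singular)"
      using y Homeo_singular_iff[OF h, of z] sub by blast
  qed
qed

text \<open>Both \<open>h\<close> and its inverse are lifted. The composites of the two lifts are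
  the identity over the open strip, where the chart is injective, and hence everywhere by density.
  Density also gives uniqueness, although boundary points may have two preimages.\<close>

lemma ex1_lifting:
  assumes h: "h \<in> Homeo Z" and \<alpha>: "\<alpha> \<in> A" and inv: "h ` surface_strip Z \<alpha> = surface_strip Z \<alpha>"
  shows "\<exists>!g. is_lifting Z h \<alpha> g"
proof (rule ex_ex1I)
  have IS: "open_strip \<subseteq> S \<alpha>" using open_strip_subset[OF model[OF \<alpha>]] .
  have sub: "surface_strip Z \<alpha> \<subseteq> topspace T" using \<alpha>
    unfolding surface_strip_def topspace_surface by blast
  note int = Homeo_interior[OF h \<alpha> inv]
  obtain k where k: "k \<in> Homeo Z" "\<And>z. z \<in> topspace T \<Longrightarrow> k (h z) = z"
    "\<And>z. z \<in> topspace T \<Longrightarrow> h (k z) = z"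
    using Homeo_inverse[OF h] by metis
  have kinv: "k ` surface_strip Z \<alpha> = surface_strip Z \<alpha>"
  proof -
    have "(\<lambda>z. k (h z)) ` surface_strip Z \<alpha> = (\<lambda>z. z) ` surface_strip Z \<alpha>"
      using k(2) sub by (intro image_cong) auto
    then have "k ` h ` surface_strip Z \<alpha> = surface_strip Z \<alpha>" by (simp add: image_image)
    then show ?thesis using inv by simp
  qed
  note kint = Homeo_interior[OF k(1) \<alpha> kinv]
  obtain g where g: "continuous_on (S \<alpha>) g" "g ` S \<alpha> \<subseteq> S \<alpha>" "g ` open_strip \<subseteq> open_strip"
    "\<And>p. p \<in> S \<alpha> \<Longrightarrow> \<xi> \<alpha> (g p) = h (\<xi> \<alpha> p)"
    using lift_extends[OF \<alpha> HomeoD(4)[OF h]] inv int by blast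
  obtain g' where g': "continuous_on (S \<alpha>) g'" "g' ` S \<alpha> \<subseteq> S \<alpha>" "g' ` open_strip \<subseteq> open_strip"
    "\<And>p. p \<in> S \<alpha> \<Longrightarrow> \<xi> \<alpha> (g' p) = k (\<xi> \<alpha> p)"
    using lift_extends[OF \<alpha> HomeoD(4)[OF k(1)]] kinv kint by blast
  have "(g' \<circ> g) p = id p" if "p \<in> S \<alpha>" for p
  proof (rule continuous_eq_on_strip[OF \<alpha> _ _ _ that])
    show "continuous_on (S \<alpha>) (g' \<circ> g)"
      using g(1,2) g'(1) continuous_on_compose continuous_on_subset by blast
    show "(g' \<circ> g) p = id p" if p: "p \<in> open_strip" for p
    proof -
      have gp: "g p \<in> open_strip" "p \<in> S \<alpha>"
        by (rule subsetD[OF g(3) imageI[OF p]], rule subsetD[OF IS p])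
      note gp = gp subsetD[OF IS gp(1)]
      have eq: "\<xi> \<alpha> (g' (g p)) = \<xi> \<alpha> p"
        unfolding g'(4)[OF gp(3)] g(4)[OF gp(2)] by (rule k(2)[OF chart_in_topspace[OF \<alpha> gp(2)]])
      have "g' (g p) \<in> open_strip" by (rule subsetD[OF g'(3) imageI[OF gp(1)]])
      then show ?thesis using inj_onD[OF inj_chart_interior eq _ p] by simp
    qed
  qed (auto simp: continuous_on_id)
  moreover have "(g \<circ> g') p = id p" if "p \<in> S \<alpha>" for p
  proof (rule continuous_eq_on_strip[OF \<alpha> _ _ _ that])
    show "continuous_on (S \<alpha>) (g \<circ> g')"
      using g'(1,2) g(1) continuous_on_compose continuous_on_subset by blast
    show "(g \<circ> g') p = id p" if p: "p \<in> open_strip" for p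
    proof -
      have gp: "g' p \<in> open_strip" "p \<in> S \<alpha>"
        by (rule subsetD[OF g'(3) imageI[OF p]], rule subsetD[OF IS p])
      note gp = gp subsetD[OF IS gp(1)]
      have eq: "\<xi> \<alpha> (g (g' p)) = \<xi> \<alpha> p"
        unfolding g(4)[OF gp(3)] g'(4)[OF gp(2)] by (rule k(3)[OF chart_in_topspace[OF \<alpha> gp(2)]])
      have "g (g' p) \<in> open_strip" by (rule subsetD[OF g(3) imageI[OF gp(1)]])
      then show ?thesis using inj_onD[OF inj_chart_interior eq _ p] by simp
    qed
  qed (auto simp: continuous_on_id)
  ultimately have "homeomorphic_maps (top_of_set (S \<alpha>)) (top_of_set (S \<alpha>)) g g'"
    using g(1,2) g'(1,2) by (auto simp: homeomorphic_maps_def)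
  then have "homeomorphic_maps (top_of_set (S \<alpha>)) (top_of_set (S \<alpha>)) (restrict g (S \<alpha>)) g'"
    by (rule homeomorphic_maps_eq) auto
  then have "homeomorphic_map (top_of_set (S \<alpha>)) (top_of_set (S \<alpha>)) (restrict g (S \<alpha>))"
    using homeomorphic_map_maps by blast
  then have "is_lifting Z h \<alpha> (restrict g (S \<alpha>))"
    using g(4) unfolding is_lifting_def by simp
  then show "\<exists>g. is_lifting Z h \<alpha> g" by blast
next
  have IS: "open_strip \<subseteq> S \<alpha>" using open_strip_subset[OF model[OF \<alpha>]] .
  fix g g' assume g: "is_lifting Z h \<alpha> g" and g': "is_lifting Z h \<alpha> g'"
  have int: "u p \<in> open_strip" if "is_lifting Z h \<alpha> u" "p \<in> open_strip" for u p
  proof -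
    have "p \<in> S \<alpha>" by (rule subsetD[OF IS that(2)])
    then have "\<xi> \<alpha> (u p) = h (\<xi> \<alpha> p)" using that(1) unfolding is_lifting_def by blast
    also have "\<dots> \<in> \<xi> \<alpha> ` open_strip"
      using imageI[OF imageI[OF that(2)], of h "\<xi> \<alpha>"] unfolding Homeo_interior[OF h \<alpha> inv] .
    finally obtain r where r: "r \<in> open_strip" "\<xi> \<alpha> (u p) = \<xi> \<alpha> r" by (elim imageE) (rule that)
    have "u p = r" using chart_eq_interior[OF r(2)[symmetric] r(1)] by simp
    then show ?thesis using r(1) by simp
  qed
  have "g p = g' p" if p: "p \<in> S \<alpha>" for p
  proof (rule continuous_eq_on_strip[OF \<alpha> _ _ _ p])
    show "continuous_on (S \<alpha>) g" "continuous_on (S \<alpha>) g'"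
      using g g' homeomorphic_imp_continuous_map[of "top_of_set (S \<alpha>)" "top_of_set (S \<alpha>)"]
      unfolding is_lifting_def by (auto simp: continuous_map_in_subtopology)
    show "g p = g' p" if "p \<in> open_strip" for p
    proof -
      have "\<xi> \<alpha> (g p) = \<xi> \<alpha> (g' p)" using g g' that IS unfolding is_lifting_def by auto
      then show ?thesis using inj_onD[OF inj_chart_interior] int g g' that by blast
    qed
  qed
  then show "g = g'" using g g' unfolding is_lifting_def by (metis extensionalityI)
qed

lemma lifting:
  assumes "h \<in> Homeo Z" "\<alpha> \<in> A" "strips_invariant h"
  shows "is_lifting Z h \<alpha> (lifting Z h \<alpha>)"
proof -
  have "h ` surface_strip Z \<alpha> = surface_strip Z \<alpha>" using assms(2,3) by blast
  then show ?thesis unfolding lifting_def by (rule theI'[OF ex1_lifting[OF assms(1,2)]])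
qed

lemma lifting_unique:
  assumes "h \<in> Homeo Z" "\<alpha> \<in> A" "strips_invariant h" "is_lifting Z h \<alpha> g"
  shows "lifting Z h \<alpha> = g"
  using ex1_lifting lifting assms by blast

lemma liftingD:
  assumes h: "h \<in> Homeo Z" "\<alpha> \<in> A" "strips_invariant h"
  shows "continuous_on (S \<alpha>) (lifting Z h \<alpha>)" "lifting Z h \<alpha> ` S \<alpha> = S \<alpha>"
    "inj_on (lifting Z h \<alpha>) (S \<alpha>)"
    "\<And>p. p \<in> S \<alpha> \<Longrightarrow> \<xi> \<alpha> (lifting Z h \<alpha> p) = h (\<xi> \<alpha> p)"
    "\<And>p. p \<in> S \<alpha> \<Longrightarrow> lifting Z h \<alpha> p \<in> open_strip \<longleftrightarrow> p \<in> open_strip"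
proof -
  note l = lifting[OF h, unfolded is_lifting_def]
  have hm: "homeomorphic_map (top_of_set (S \<alpha>)) (top_of_set (S \<alpha>)) (lifting Z h \<alpha>)" using l by blast
  show "continuous_on (S \<alpha>) (lifting Z h \<alpha>)"
    using homeomorphic_imp_continuous_map[OF hm] by (simp add: continuous_map_in_subtopology)
  show img: "lifting Z h \<alpha> ` S \<alpha> = S \<alpha>" "inj_on (lifting Z h \<alpha>) (S \<alpha>)"
    using homeomorphic_imp_surjective_map[OF hm] homeomorphic_imp_injective_map[OF hm] by simp_all
  show eq: "\<xi> \<alpha> (lifting Z h \<alpha> p) = h (\<xi> \<alpha> p)" if "p \<in> S \<alpha>" for p using l that by blast
  show "lifting Z h \<alpha> p \<in> open_strip \<longleftrightarrow> p \<in> open_strip" if p: "p \<in> S \<alpha>" for p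
  proof -
    have lp: "lifting Z h \<alpha> p \<in> S \<alpha>" using img(1) p by blast
    have "\<xi> \<alpha> (lifting Z h \<alpha> p) \<in> singular \<longleftrightarrow> \<xi> \<alpha> p \<in> singular"
      using eq[OF p] Homeo_singular_iff[OF h(1)] chart_in_topspace[OF h(2) p] by simp
    then show ?thesis
      unfolding chart_singular_iff[OF h(2) lp] chart_singular_iff[OF h(2) p] strip_boundary_eq[OF model[OF h(2)]]
      using lp p by simp
  qed
qed

section \<open>Continuity of the lifting\<close>

lemma Homeo_subset: "Homeo Z \<subseteq> continuous_maps T T"
  using HomeoD(1,4) unfolding continuous_maps_def by blast

lemma topspace_Homeo_topology: "topspace (Homeo_topology Z) = Homeo Z"
  using Homeo_subset unfolding Homeo_topology_def by auto

lemma openin_Homeo_subbasic: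
  assumes "compactin T C" "openin T U" shows "openin (Homeo_topology Z) {h \<in> Homeo Z. h ` C \<subseteq> U}"
proof -
  have "openin (compact_open_topology T T) {f \<in> continuous_maps T T. f ` C \<subseteq> U}"
    unfolding compact_open_topology_def using assms by (intro topology_generated_by_Basis) blast
  moreover have "{h \<in> Homeo Z. h ` C \<subseteq> U} = Homeo Z \<inter> {f \<in> continuous_maps T T. f ` C \<subseteq> U}"
    using Homeo_subset by auto
  ultimately show ?thesis unfolding Homeo_topology_def by (simp add: openin_subtopology_Int2)
qed

text \<open>Sending a compact half disc around \<open>p0\<close> into a small neighbourhood of
  \<open>z\<close> forces the lifting near the finite fibre of \<open>z\<close>, but does not say
  near which point. A second subbasic condition at a single interior point decides this, and
  connectedness of the half disc spreads the decision over all of it.\<close>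

lemma continuous_map_lifting:
  assumes \<alpha>: "\<alpha> \<in> A"
  shows "continuous_map (prod_topology (subtopology (Homeo_topology Z) (Collect strips_invariant)) (top_of_set (S \<alpha>)))
    (top_of_set (S \<alpha>)) (\<lambda>(h, p). lifting Z h \<alpha> p)"
  (is "continuous_map (prod_topology ?X ?Y) ?Y ?g")
  unfolding continuous_map
proof (intro conjI allI impI)
  note mod = model[OF \<alpha>]
  have X: "topspace ?X = {h \<in> Homeo Z. strips_invariant h}" by (auto simp: topspace_Homeo_topology)
  show "?g ` topspace (prod_topology ?X ?Y) \<subseteq> topspace ?Y"
    using liftingD(2)[OF _ \<alpha>] X by (auto simp: topspace_Homeo_topology)
  fix V assume V: "openin ?Y V"
  let ?O = "{w \<in> topspace (prod_topology ?X ?Y). ?g w \<in> V}"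
  show "openin (prod_topology ?X ?Y) ?O"
    unfolding openin_prod_topology_alt
  proof (intro allI impI)
    fix h0 p0 assume "(h0, p0) \<in> ?O"
    then have h0: "h0 \<in> Homeo Z" "strips_invariant h0" and p0: "p0 \<in> S \<alpha>"
      and gV: "lifting Z h0 \<alpha> p0 \<in> V"
      by (auto simp: topspace_Homeo_topology)
    define q0 where "q0 = lifting Z h0 \<alpha> p0"
    define z where "z = h0 (\<xi> \<alpha> p0)"
    note L0 = liftingD[OF h0(1) \<alpha> h0(2)]
    have q0: "q0 \<in> S \<alpha>" "\<xi> \<alpha> q0 = z" using L0 p0 unfolding q0_def z_def by auto
    let ?F = "{q \<in> S \<alpha>. \<xi> \<alpha> q = z}"
    have zT: "z \<in> topspace T" using q0 chart_in_topspace[OF \<alpha>] by blast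
    obtain \<epsilon>1 where \<epsilon>1: "\<epsilon>1 > 0" "\<forall>p\<in>S \<alpha>. dist p q0 < \<epsilon>1 \<longrightarrow> p \<in> V"
      using V gV unfolding openin_euclidean_subtopology_iff q0_def by blast
    obtain \<epsilon>0 where \<epsilon>0: "\<epsilon>0 > 0"
      "\<And>q q'. \<lbrakk>q \<in> S \<alpha>; q' \<in> S \<alpha>; \<xi> \<alpha> q = z; \<xi> \<alpha> q' = z; q \<noteq> q'\<rbrakk> \<Longrightarrow> 2 * \<epsilon>0 \<le> dist q q'"
      "\<And>\<epsilon>. \<epsilon> > 0 \<Longrightarrow> \<exists>U. openin T U \<and> z \<in> U \<and> (\<forall>p\<in>S \<alpha>. \<xi> \<alpha> p \<in> U \<longrightarrow> (\<exists>q\<in>?F. dist p q < \<epsilon>))"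
      using fibre_nhd[OF \<alpha> zT] by blast
    define \<epsilon> where "\<epsilon> = min \<epsilon>0 \<epsilon>1"
    have \<epsilon>: "\<epsilon> > 0" "\<epsilon> \<le> \<epsilon>0" "\<epsilon> \<le> \<epsilon>1" using \<epsilon>0(1) \<epsilon>1(1) by (auto simp: \<epsilon>_def)
    have sep: "2 * \<epsilon> \<le> dist q q'" if "q \<in> ?F" "q' \<in> ?F" "q \<noteq> q'" for q q'
      using \<epsilon>0(2)[of q q'] that \<epsilon>(2) by auto
    obtain U where U: "openin T U" "z \<in> U" "\<forall>p\<in>S \<alpha>. \<xi> \<alpha> p \<in> U \<longrightarrow> (\<exists>q\<in>?F. dist p q < \<epsilon>)"
      using \<epsilon>0(3)[OF \<epsilon>(1)] by blast
    have "continuous_map ?Y T (h0 \<circ> \<xi> \<alpha>)"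
      using continuous_chart[OF \<alpha>] HomeoD(4)[OF h0(1)] by (rule continuous_map_compose)
    then have "openin ?Y {p \<in> S \<alpha>. (h0 \<circ> \<xi> \<alpha>) p \<in> U}" using U(1) unfolding continuous_map by simp
    moreover have "p0 \<in> {p \<in> S \<alpha>. (h0 \<circ> \<xi> \<alpha>) p \<in> U}" using p0 U(2) by (simp add: z_def)
    ultimately obtain d1 where d1: "d1 > 0"
      "\<forall>p\<in>S \<alpha>. dist p p0 < d1 \<longrightarrow> p \<in> {p \<in> S \<alpha>. (h0 \<circ> \<xi> \<alpha>) p \<in> U}"
      unfolding openin_euclidean_subtopology_iff by blast
    obtain d2 where d2: "d2 > 0" "cball p0 d2 \<inter> (UNIV \<times> {-1..1}) \<subseteq> S \<alpha>" using strip_nhd[OF mod p0] .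
    define d where "d = min (d1 / 2) d2"
    have d: "d > 0" "d < d1" "d \<le> d2" using d1(1) d2(1) by (auto simp: d_def min_def)
    let ?D = "cball p0 d \<inter> (UNIV \<times> {-1..1})"
    have DS: "?D \<subseteq> S \<alpha>" using d2(2) d(3) by (auto simp: subset_iff)
    have D_conn: "connected ?D"
      by (intro convex_connected convex_Int convex_cball convex_Times) auto
    have "compact ?D" by (intro compact_Int_closed compact_cball closed_Times) auto
    then have C: "compactin T (\<xi> \<alpha> ` ?D)"
      using image_compactin[OF _ continuous_chart[OF \<alpha>]] DS by (simp add: compactin_subtopology)
    \<comment> \<open>An interior point is taken because there the value of the map determines the
      value of the lifting; at \<open>p0\<close> itself the fibre may have two points.\<close>
    obtain r where r: "r \<in> open_strip" "dist r p0 < d" using open_strip_ball[OF \<alpha> p0 d(1)] .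
    have rD: "r \<in> ?D" using r by (auto simp: dist_commute)
    have p0D: "p0 \<in> ?D" using p0 model_strip_subset[OF mod] d(1) by auto
    let ?V2 = "\<xi> \<alpha> ` (ball q0 \<epsilon> \<inter> open_strip)"
    have V2: "openin T ?V2" using open_open_strip
      by (intro openin_chart_interior[OF \<alpha>] open_Int) auto
    \<comment> \<open>The first condition confines the lifting to the vicinity of the fibre, the
      second selects the point \<open>q0\<close> of the fibre.\<close>
    let ?N = "{h \<in> Homeo Z. h ` \<xi> \<alpha> ` ?D \<subseteq> U} \<inter> {h \<in> Homeo Z. h ` {\<xi> \<alpha> r} \<subseteq> ?V2}"
    have "compactin T {\<xi> \<alpha> r}" using chart_in_topspace[OF \<alpha>] rD DS
      by (intro finite_imp_compactin) auto
    then have N: "openin (Homeo_topology Z) ?N"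
      using C U(1) V2 by (intro openin_Int openin_Homeo_subbasic)
    have stay: "dist (lifting Z h \<alpha> p) q0 < \<epsilon>"
      if h: "h \<in> Homeo Z" "strips_invariant h" "h ` \<xi> \<alpha> ` ?D \<subseteq> U" and c: "c \<in> ?D"
        "dist (lifting Z h \<alpha> c) q0 < \<epsilon>" and p: "p \<in> ?D"
      for h c p
    proof -
      note L = liftingD[OF h(1) \<alpha> h(2)]
      have "connected (lifting Z h \<alpha> ` ?D)"
        using continuous_on_subset[OF L(1) DS] D_conn by (rule connected_continuous_image)
      then show ?thesis
      proof (rule connected_subset_ball[where F = ?F and c = "lifting Z h \<alpha> p"
        and ?c0.0 = "lifting Z h \<alpha> c"])
        show "\<exists>q\<in>?F. dist y q < \<epsilon>" if y: "y \<in> lifting Z h \<alpha> ` ?D" for y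
        proof -
          obtain x where x: "x \<in> ?D" "y = lifting Z h \<alpha> x" using y by blast
          then have xS: "x \<in> S \<alpha>" using DS by blast
          then have "y \<in> S \<alpha>" "\<xi> \<alpha> y = h (\<xi> \<alpha> x)" using L(2,4) x(2) by auto
          moreover have "h (\<xi> \<alpha> x) \<in> U" using h(3) x(1) by blast
          ultimately show ?thesis using U(3) by simp
        qed
      qed (use sep c p q0 in auto)
    qed
    have "h0 ` \<xi> \<alpha> ` ?D \<subseteq> U"
    proof clarify
      fix a b assume ab: "(a, b) \<in> cball p0 d" "b \<in> {-1..1}"
      then have "(a, b) \<in> S \<alpha>" "dist (a, b) p0 < d1" using DS d(2) by (auto simp: dist_commute)
      then show "h0 (\<xi> \<alpha> (a, b)) \<in> U" using d1(2) by auto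
    qed
    \<comment> \<open>That \<open>h0\<close> itself meets the condition at \<open>r\<close> follows
      from \<open>stay\<close> started at the centre \<open>p0\<close>, where its lifting equals
      \<open>q0\<close>.\<close>
    moreover from this have "dist (lifting Z h0 \<alpha> r) q0 < \<epsilon>"
      using stay[OF h0 _ p0D _ rD] \<epsilon>(1) unfolding q0_def by simp
    then have "h0 ` {\<xi> \<alpha> r} \<subseteq> ?V2"
      using L0(4,5)[of r] rD DS r(1)
        by (auto simp: dist_commute intro!: image_eqI[of _ _ "lifting Z h0 \<alpha> r"])
    ultimately have h0N: "h0 \<in> ?N" using h0(1) by blast
    have sub: "(h, p) \<in> ?O" if h: "h \<in> ?N" "strips_invariant h" and p: "p \<in> S \<alpha>" "dist p p0 < d"
      for h p
    proof -
      have hH: "h \<in> Homeo Z" "h ` \<xi> \<alpha> ` ?D \<subseteq> U" "h (\<xi> \<alpha> r) \<in> ?V2" using h by auto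
      note L = liftingD[OF hH(1) \<alpha> h(2)]
      have rS: "r \<in> S \<alpha>" using rD DS by blast
      obtain y where y: "y \<in> ball q0 \<epsilon>" "y \<in> open_strip" "h (\<xi> \<alpha> r) = \<xi> \<alpha> y" using hH(3) by blast
      have "lifting Z h \<alpha> r = y"
        using inj_onD[OF inj_chart_interior, of \<alpha> "lifting Z h \<alpha> r" y] L(4,5)[OF rS] y r(1) by simp
      then have "dist (lifting Z h \<alpha> r) q0 < \<epsilon>" using y(1) by (simp add: dist_commute)
      moreover have "p \<in> ?D" using p model_strip_subset[OF mod] by (auto simp: dist_commute)
      ultimately have "dist (lifting Z h \<alpha> p) q0 < \<epsilon>" using stay[OF hH(1) h(2) hH(2) rD] by blast
      moreover have "lifting Z h \<alpha> p \<in> S \<alpha>" using L(2) p(1) by blast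
      ultimately have "lifting Z h \<alpha> p \<in> V" using \<epsilon>1(2) \<epsilon>(3) by simp
      then show ?thesis using hH(1) h(2) p(1) by (simp add: topspace_Homeo_topology)
    qed
    show "\<exists>U V. openin ?X U \<and> openin ?Y V \<and> h0 \<in> U \<and> p0 \<in> V \<and> U \<times> V \<subseteq> ?O"
    proof (intro exI conjI)
      show "openin ?X (Collect strips_invariant \<inter> ?N)"
        using N by (simp add: openin_subtopology_Int2)
      show "openin ?Y (S \<alpha> \<inter> ball p0 d)" by (simp add: openin_open_Int)
      show "h0 \<in> Collect strips_invariant \<inter> ?N" using h0(2) h0N by blast
      show "p0 \<in> S \<alpha> \<inter> ball p0 d" using p0 d(1) by simp
      show "(Collect strips_invariant \<inter> ?N) \<times> (S \<alpha> \<inter> ball p0 d) \<subseteq> ?O"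
      proof
        fix w assume w: "w \<in> (Collect strips_invariant \<inter> ?N) \<times> (S \<alpha> \<inter> ball p0 d)"
        then show "w \<in> ?O" using sub[of "fst w" "snd w"] by (cases w) (auto simp: dist_commute)
      qed
    qed
  qed
qed

end

section \<open>Foliated homeomorphisms of a model strip\<close>

text \<open>To hit \<open>v\<close>, take \<open>a\<close> with f a = v. Then F a = v + s (a - v)
  and F v = v + (1 - s) (f v - v), and a - v and f v - v have opposite signs because
  \<open>f\<close> is increasing. So \<open>v\<close> lies between two values of \<open>F\<close>
  and the intermediate value theorem applies. Stated for convex \<open>X\<close>, this covers the
  line, open intervals and [-1, 1] at once.\<close>

lemma interpolate_mono_onto:
  fixes f :: "real \<Rightarrow> real"
  assumes X: "convex X" and f: "continuous_on X f" "strict_mono_on X f" "f ` X = X" and s: "0 \<le> s"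
    "s \<le> 1"
  defines "F \<equiv> \<lambda>x. (1 - s) * f x + s * x"
  shows "continuous_on X F" "strict_mono_on X F" "F ` X = X"
proof -
  show cont: "continuous_on X F" unfolding F_def by (intro continuous_intros f(1))
  show "strict_mono_on X F"
  proof (rule strict_mono_onI)
    fix x y assume xy: "x \<in> X" "y \<in> X" "x < y"
    then have "f x < f y" using f(2) by (auto dest: strict_mono_onD)
    then have "0 < (1 - s) * (f y - f x) + s * (y - x)"
      using xy(3) s by (cases "s = 1") (auto intro!: add_pos_nonneg)
    then show "F x < F y" unfolding F_def by (simp add: algebra_simps)
  qed
  show "F ` X = X"
  proof (intro equalityI subsetI)
    fix y assume "y \<in> F ` X"
    then obtain x where x: "x \<in> X" "y = (1 - s) * f x + s * x" unfolding F_def by blast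
    then show "y \<in> X" using convexD[OF X, of "f x" x "1 - s" s] f(3) s by auto
  next
    fix v assume v: "v \<in> X"
    then obtain a where a: "a \<in> X" "f a = v" using f(3) by (metis imageE)
    have seg: "closed_segment a v \<subseteq> X" using closed_segment_subset[OF a(1) v X] .
    have con: "continuous_on (closed_segment a v) F" using continuous_on_subset[OF cont seg] .
    have "v \<in> closed_segment (F a) (F v)"
    proof -
      have Fa: "F a = v + s * (a - v)" and Fv: "F v = v + (1 - s) * (f v - v)"
        unfolding F_def a(2) by (simp_all add: algebra_simps)
      consider "a = v" | "a < v" "v < f v" | "v < a" "f v < v"
        using strict_mono_onD[OF f(2) a(1) v] strict_mono_onD[OF f(2) v a(1)] a(2)
          by (metis linorder_neqE)
      then show ?thesis
      proof cases
        case 1 then show ?thesis using a(2) Fa by simp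
      next
        case 2
        then have "F a \<le> v" "v \<le> F v" unfolding Fa Fv using s by (auto simp: mult_nonneg_nonpos)
        then show ?thesis by (auto simp: closed_segment_eq_real_ivl)
      next
        case 3
        then have "v \<le> F a" "F v \<le> v" unfolding Fa Fv using s by (auto simp: mult_nonneg_nonpos)
        then show ?thesis by (auto simp: closed_segment_eq_real_ivl)
      qed
    qed
    moreover have "connected (F ` closed_segment a v)"
      using con connected_segment connected_continuous_image by blast
    then have "closed_segment (F a) (F v) \<subseteq> F ` closed_segment a v"
      by (intro closed_segment_subset) (auto simp: connected_convex_1[symmetric])
    ultimately show "v \<in> F ` X" using seg by blast
  qed
qed

lemma model_leaves_cases:
  assumes S: "model_strip S" and L: "L \<in> model_leaves S"
  obtains X y where "L = X \<times> {y}" "open X" "convex X" "X \<noteq> {}" "y \<in> {-1..1}" "X \<times> {y} \<subseteq> S"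
proof -
  consider t where "t \<in> {-1<..<1}" "L = UNIV \<times> {t}" | "L \<in> boundary_intervals S"
    using L unfolding model_leaves_def by blast
  then show ?thesis
  proof cases
    case 1
    then have "L \<subseteq> S" using open_strip_subset[OF S] by auto
    then show ?thesis using that[of UNIV t] 1 by auto
  next
    case 2
    obtain a b e where J: "a < b" "e \<in> {-1, 1}" "L = {a<..<b} \<times> {e}" "L \<subseteq> S"
      using boundary_intervals_cases[OF S 2] by metis
    then show ?thesis using that[of "{a<..<b}" e] by auto
  qed
qed

lemma model_leaf_of_point:
  assumes S: "model_strip S" and p: "(x, y) \<in> S"
  obtains X where "X \<times> {y} \<in> model_leaves S" "x \<in> X"
proof (cases "(x, y) \<in> strip_boundary S")
  case True
  then obtain J where J: "J \<in> boundary_intervals S" "(x, y) \<in> J"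
    by (rule boundary_interval_of_point)
  obtain a b e where "J = {a<..<b} \<times> {e}" using boundary_intervals_cases[OF S J(1)] by metis
  then show ?thesis using that[of "{a<..<b}"] J unfolding model_leaves_def by auto
next
  case False
  then have "(x, y) \<in> open_strip" using p strip_boundary_eq[OF S] by blast
  then show ?thesis using that[of UNIV] unfolding model_leaves_def by auto
qed

lemma model_leaf_interior:
  assumes "X \<times> {y} \<in> model_leaves S" "X \<noteq> {}" "y \<in> {-1<..<1}" shows "X = UNIV"
proof -
  have "X \<times> {y} \<notin> boundary_intervals S"
  proof
    assume "X \<times> {y} \<in> boundary_intervals S"
    then have "X \<times> {y} \<subseteq> strip_boundary S" by (rule boundary_intervals_subset)
    then show False using assms(2,3) by (auto simp: mem_strip_boundary)
  qed
  then obtain t where "X \<times> {y} = UNIV \<times> {t}" using assms(1) unfolding model_leaves_def by blast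
  then show ?thesis using assms(2) by (auto simp: times_eq_iff)
qed

lemma model_leaves_unique:
  assumes L: "X \<times> {y} \<in> model_leaves S" "X' \<times> {y} \<in> model_leaves S" and x: "x \<in> X" "x \<in> X'"
  shows "X = X'"
proof (cases "y \<in> {-1<..<1}")
  case True
  then show ?thesis using model_leaf_interior L x by blast
next
  case False
  then have "X \<times> {y} \<in> boundary_intervals S" "X' \<times> {y} \<in> boundary_intervals S"
    using L x unfolding model_leaves_def by (auto simp: times_eq_iff)
  then have "X \<times> {y} = X' \<times> {y}" using boundary_intervals_unique x by blast
  then show ?thesis using x by (auto simp: times_eq_iff)
qed

text \<open>The elements of the identity component turn out to be the maps with such liftings.\<close>

definition good_lift :: "(real \<times> real) set \<Rightarrow> (real \<times> real \<Rightarrow> real \<times> real) \<Rightarrow> bool" where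
  "good_lift S g \<longleftrightarrow> continuous_on S g \<and>
     (\<exists>m. continuous_on {-1..1} m \<and> strict_mono_on {-1..1} m \<and> m ` {-1..1} = {-1..1} \<and>
          (\<forall>p\<in>S. snd (g p) = m (snd p))) \<and>
     (\<forall>X y. X \<times> {y} \<in> model_leaves S \<longrightarrow>
        strict_mono_on X (\<lambda>x. fst (g (x, y))) \<and> (\<lambda>x. fst (g (x, y))) ` X = X)"

lemma mono_onto_ends:
  fixes m :: "real \<Rightarrow> real"
  assumes m: "strict_mono_on {-1..1} m" "m ` {-1..1} = {-1..1}"
  shows "m (-1) = -1" "m 1 = 1" "y \<in> {-1<..<1} \<Longrightarrow> m y \<in> {-1<..<1}"
proof -
  have mono: "x \<in> {-1..1} \<Longrightarrow> y \<in> {-1..1} \<Longrightarrow> x \<le> y \<Longrightarrow> m x \<le> m y" for x y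
    using m(1) by (metis less_eq_real_def strict_mono_onD)
  have rng: "m x \<in> {-1..1}" if "x \<in> {-1..1}" for x using m(2) that by blast
  have "-1 \<in> m ` {-1..1}" "1 \<in> m ` {-1..1}" unfolding m(2) by simp_all
  then obtain a b where ab: "a \<in> {-1..1}" "m a = -1" "b \<in> {-1..1}" "m b = 1" by (metis imageE)
  show m1: "m (-1) = -1" using mono[of "-1" a] ab rng[of "-1"] by auto
  show m2: "m 1 = 1" using mono[of b 1] ab rng[of 1] by auto
  show "m y \<in> {-1<..<1}" if "y \<in> {-1<..<1}"
    using strict_mono_onD[OF m(1), of "-1" y] strict_mono_onD[OF m(1), of y 1] that m1 m2 by simp
qed

definition deform :: "real \<Rightarrow> real \<Rightarrow> (real \<times> real \<Rightarrow> real \<times> real) \<Rightarrow> real \<times> real \<Rightarrow> real \<times> real" where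
  "deform s t g p = ((1 - s) * fst (g p) + s * fst p, (1 - t) * snd (g p) + t * snd p)"

lemma good_lift_deform:
  assumes S: "model_strip S" and g: "good_lift S g" and st: "s \<in> {0..1}" "t \<in> {0..1}"
  shows "good_lift S (deform s t g)"
proof -
  have gc: "continuous_on S g" using g unfolding good_lift_def by blast
  obtain m where m: "continuous_on {-1..1} m" "strict_mono_on {-1..1} m" "m ` {-1..1} = {-1..1}"
    "\<forall>p\<in>S. snd (g p) = m (snd p)"
    using g unfolding good_lift_def by (elim conjE exE) (rule that)
  have "continuous_on S (deform s t g)"
    unfolding deform_def by (intro continuous_intros gc)
  moreover have "\<exists>m. continuous_on {-1..1} m \<and> strict_mono_on {-1..1} m \<and> m ` {-1..1} = {-1..1} \<and>
          (\<forall>p\<in>S. snd (deform s t g p) = m (snd p))"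
    using interpolate_mono_onto[OF _ m(1-3), of t] st(2) m(4)
    by (intro exI[of _ "\<lambda>y. (1 - t) * m y + t * y"]) (auto simp: deform_def)
  moreover have "strict_mono_on X (\<lambda>x. fst (deform s t g (x, y))) \<and> (\<lambda>x. fst (deform s t g (x, y))) ` X = X"
    if L: "X \<times> {y} \<in> model_leaves S" for X y
  proof (cases "X = {}")
    case False
    obtain X' y' where X': "X \<times> {y} = X' \<times> {y'}" "convex X'" "X' \<times> {y'} \<subseteq> S"
      using model_leaves_cases[OF S L] by metis
    then have X: "convex X" "X \<times> {y} \<subseteq> S" using False by (auto simp: times_eq_iff)
    have "continuous_on X (\<lambda>x. fst (g (x, y)))"
      using X(2) by (intro continuous_intros continuous_on_compose2[OF gc]) auto
    then show ?thesis
      using interpolate_mono_onto[OF X(1), of "\<lambda>x. fst (g (x, y))" s] g L st(1)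
      unfolding good_lift_def by (auto simp: deform_def)
  qed auto
  ultimately show ?thesis unfolding good_lift_def by blast
qed

lemma good_liftD:
  assumes S: "model_strip S" and g: "good_lift S g"
  obtains m where "continuous_on {-1..1} m" "strict_mono_on {-1..1} m" "m ` {-1..1} = {-1..1}"
    "\<forall>p\<in>S. snd (g p) = m (snd p)"
    "\<And>X y. X \<times> {y} \<in> model_leaves S \<Longrightarrow> X \<noteq> {} \<Longrightarrow> g ` (X \<times> {y}) = X \<times> {m y} \<and> X \<times> {m y} \<in> model_leaves S"
proof -
  obtain m where m: "continuous_on {-1..1} m" "strict_mono_on {-1..1} m" "m ` {-1..1} = {-1..1}"
    "\<forall>p\<in>S. snd (g p) = m (snd p)"
    using g unfolding good_lift_def by (elim conjE exE) (rule that)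
  have "g ` (X \<times> {y}) = X \<times> {m y} \<and> X \<times> {m y} \<in> model_leaves S" if L: "X \<times> {y} \<in> model_leaves S"
    "X \<noteq> {}" for X y
  proof
    obtain X' y' where X': "X \<times> {y} = X' \<times> {y'}" "X' \<times> {y'} \<subseteq> S" "y' \<in> {-1..1}"
      using model_leaves_cases[OF S L(1)] by metis
    then have sub: "X \<times> {y} \<subseteq> S" "y \<in> {-1..1}" using L(2) by (auto simp: times_eq_iff)
    have onto: "(\<lambda>x. fst (g (x, y))) ` X = X" using g L(1) unfolding good_lift_def by blast
    have g1: "g (x, y) = (fst (g (x, y)), m y)" if "x \<in> X" for x
      using bspec[OF m(4), of "(x, y)"] sub that by (auto simp: prod_eq_iff)
    have "g ` (X \<times> {y}) = (\<lambda>x. g (x, y)) ` X" by auto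
    also have "\<dots> = (\<lambda>x. (fst (g (x, y)), m y)) ` X" using g1 by (intro image_cong) auto
    also have "\<dots> = (\<lambda>u. (u, m y)) ` (\<lambda>x. fst (g (x, y))) ` X" by (simp only: image_image)
    also have "\<dots> = X \<times> {m y}" unfolding onto by auto
    finally show "g ` (X \<times> {y}) = X \<times> {m y}" .
    note ends = mono_onto_ends[OF m(2,3)]
    show "X \<times> {m y} \<in> model_leaves S"
    proof (cases "y \<in> {-1<..<1}")
      case True
      then have "X = UNIV" using model_leaf_interior L by blast
      then show ?thesis using ends(3)[OF True] unfolding model_leaves_def by blast
    next
      case False
      then have "y = -1 \<or> y = 1" using sub(2) by auto
      then show ?thesis using ends(1,2) L(1) by auto
    qed
  qed
  then show ?thesis using that[OF m] by blast
qed

lemma good_lift_fst_mono: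
  assumes "good_lift S g" "X \<times> {y} \<in> model_leaves S" "x \<in> X" "x' \<in> X"
  shows "fst (g (x, y)) < fst (g (x', y)) \<longleftrightarrow> x < x'"
  using assms unfolding good_lift_def by (metis strict_mono_on_less)

text \<open>Bijectivity is checked leaf by leaf. Continuity of the inverse is a squeezing argument,
  uniform in interior and boundary points: the heights are controlled by the inverse of
  \<open>m\<close>, the abscissas by comparing with the images of the two points at distance
  \<delta> on either side.\<close>

lemma good_lift_homeomorphic:
  assumes S: "model_strip S" and g: "good_lift S g"
  shows "homeomorphic_map (top_of_set S) (top_of_set S) g"
proof -
  have gc: "continuous_on S g" using g unfolding good_lift_def by blast
  obtain m where m: "continuous_on {-1..1} m" "strict_mono_on {-1..1} m" "m ` {-1..1} = {-1..1}"
    and m4: "\<forall>p\<in>S. snd (g p) = m (snd p)"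
    and leaf: "\<And>X y. X \<times> {y} \<in> model_leaves S \<Longrightarrow> X \<noteq> {} \<Longrightarrow> g ` (X \<times> {y}) = X \<times> {m y} \<and> X \<times> {m y} \<in> model_leaves S"
    by (rule good_liftD[OF S g]) (rule that)
  note m = m bspec[OF m4]
  have m_inj: "y = y'" if "y \<in> {-1..1}" "y' \<in> {-1..1}" "m y = m y'" for y y'
    using m(2) that by (metis less_irrefl linorder_neqE strict_mono_onD)
  have sndS: "y \<in> {-1..1}" if "(x, y) \<in> S" for x y using model_strip_subset[OF S] that by auto
  have leafS: "X \<times> {y} \<subseteq> S \<and> open X \<and> convex X" if L: "X \<times> {y} \<in> model_leaves S" "X \<noteq> {}" for X y
  proof -
    obtain X' y' where X': "X \<times> {y} = X' \<times> {y'}" "X' \<times> {y'} \<subseteq> S" "open X'" "convex X'"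
      using model_leaves_cases[OF S L(1)] by metis
    then show ?thesis using L(2) by (auto simp: times_eq_iff)
  qed
  have same_leaf: "x' \<in> X"
    if L: "X \<times> {y} \<in> model_leaves S" "x \<in> X" and p': "(x', y) \<in> S" "fst (g (x', y)) \<in> X"
      for X x x' y
  proof -
    obtain X' where X': "X' \<times> {y} \<in> model_leaves S" "x' \<in> X'"
      using model_leaf_of_point[OF S p'(1)] .
    have "g (x', y) \<in> X' \<times> {m y}" using leaf[OF X'(1)] X'(2) by blast
    then have "fst (g (x', y)) \<in> X'" by auto
    moreover have "X' \<times> {m y} \<in> model_leaves S" "X \<times> {m y} \<in> model_leaves S"
      using leaf L X' by blast+
    ultimately have "X' = X" using model_leaves_unique p'(2) by metis
    then show ?thesis using X'(2) by simp
  qed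
  have inj: "inj_on g S"
  proof (rule inj_onI, clarify)
    fix x y x' y' assume p: "(x, y) \<in> S" "(x', y') \<in> S" "g (x, y) = g (x', y')"
    have y: "y = y'" using m_inj[OF sndS[OF p(1)] sndS[OF p(2)]] m(4)[OF p(1)] m(4)[OF p(2)] p(3)
      by simp
    obtain X where X: "X \<times> {y} \<in> model_leaves S" "x \<in> X" using model_leaf_of_point[OF S p(1)] .
    have "g (x, y) \<in> X \<times> {m y}" using leaf[OF X(1)] X(2) by blast
    then have "x' \<in> X" using same_leaf[OF X, of x'] p y by auto
    then have "x = x'"
      using good_lift_fst_mono[OF g X(1), of x x'] good_lift_fst_mono[OF g X(1), of x' x] X(2) p(3) y by auto
    then show "x = x' \<and> y = y'" using y by simp
  qed
  have surj: "g ` S = S"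
  proof (intro equalityI subsetI)
    fix r assume "r \<in> g ` S"
    then obtain x y where r: "(x, y) \<in> S" "r = g (x, y)" by auto
    obtain X where X: "X \<times> {y} \<in> model_leaves S" "x \<in> X" using model_leaf_of_point[OF S r(1)] .
    have "r \<in> X \<times> {m y}" "X \<times> {m y} \<in> model_leaves S" using leaf[OF X(1)] X(2) r(2) by blast+
    then show "r \<in> S" using leafS by blast
  next
    fix r assume "r \<in> S"
    then obtain v w where r: "r = (v, w)" "(v, w) \<in> S" by (cases r) auto
    then have "w \<in> m ` {-1..1}" using m(3) sndS by blast
    then obtain y where y: "y \<in> {-1..1}" "w = m y" by blast
    obtain X where X: "X \<times> {w} \<in> model_leaves S" "v \<in> X" using model_leaf_of_point[OF S r(2)] .
    note ends = mono_onto_ends[OF m(2,3)]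
    have "X \<times> {y} \<in> model_leaves S"
    proof (cases "y \<in> {-1<..<1}")
      case True
      then have "X = UNIV" using model_leaf_interior[OF X(1)] X(2) ends(3) y(2) by blast
      then show ?thesis using True unfolding model_leaves_def by blast
    next
      case False
      then have "y = -1 \<or> y = 1" using y(1) by auto
      then show ?thesis using ends(1,2) X(1) y(2) by auto
    qed
    then have "g ` (X \<times> {y}) = X \<times> {w}" "X \<times> {y} \<subseteq> S"
      using leaf[of X y] leafS[of X y] X(2) y(2) by auto
    then show "r \<in> g ` S" using r(1) X(2) by blast
  qed
  have inv_cont: "\<exists>d>0. \<forall>p\<in>S. dist (g p) (g p0) < d \<longrightarrow> dist p p0 < e" if p0: "p0 \<in> S" and e: "e > 0"
    for p0 e
  proof -
    obtain x0 y0 where xy0: "p0 = (x0, y0)" by (cases p0)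
    have y0: "y0 \<in> {-1..1}" using sndS p0 xy0 by blast
    obtain X where X: "X \<times> {y0} \<in> model_leaves S" "x0 \<in> X"
      using model_leaf_of_point[OF S] p0 xy0 by metis
    note XS = leafS[OF X(1)]
    obtain d0 where d0: "d0 > 0" "cball x0 d0 \<subseteq> X" using XS X(2) open_contains_cball by blast
    define \<delta> where "\<delta> = min d0 (e / 2)"
    have \<delta>: "\<delta> > 0" "\<delta> \<le> e / 2" "x0 - \<delta> \<in> X" "x0 + \<delta> \<in> X"
      using d0 e by (auto simp: \<delta>_def subset_iff dist_real_def)
    let ?f = "\<lambda>x y. fst (g (x, y))"
    have f: "?f (x0 - \<delta>) y0 < ?f x0 y0" "?f x0 y0 < ?f (x0 + \<delta>) y0"
      using good_lift_fst_mono[OF g X(1)] \<delta> X(2) by auto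
    have f_X: "?f (x0 - \<delta>) y0 \<in> X" "?f (x0 + \<delta>) y0 \<in> X"
      using g X(1) \<delta>(3,4) unfolding good_lift_def by blast+
    \<comment> \<open>The levels \<open>c1\<close> and \<open>c2\<close> leave room on both sides:
      the middle value may vary inside them while the two outer values stay outside.\<close>
    obtain c1 where c1: "?f (x0 - \<delta>) y0 < c1" "c1 < ?f x0 y0" using dense[OF f(1)] by blast
    obtain c2 where c2: "?f x0 y0 < c2" "c2 < ?f (x0 + \<delta>) y0" using dense[OF f(2)] by blast
    \<comment> \<open>The heights at which the points over \<open>X\<close> are known to lie in
      \<open>S\<close>: all interior heights and \<open>y0\<close> itself. The opposite side may
      miss them.\<close>
    define Y where "Y = (if y0 \<in> {-1<..<1} then {-1<..<1} else {y. y \<in> {-1<..<1} \<or> y = y0})"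
    have YS: "(x, y) \<in> S" if "x \<in> X" "y \<in> Y" for x y
      using that open_strip_subset[OF S] XS X(2) unfolding Y_def by (auto split: if_splits)
    have y0Y: "y0 \<in> Y" unfolding Y_def by auto
    have ev: "\<exists>\<eta>>0. \<forall>y\<in>Y. \<bar>y - y0\<bar> < \<eta> \<longrightarrow> \<bar>?f x y - ?f x y0\<bar> < \<kappa>" if "x \<in> X" "\<kappa> > 0" for x \<kappa>
    proof -
      have "continuous_on Y (\<lambda>y. ?f x y)"
        using YS that(1) by (intro continuous_intros continuous_on_compose2[OF gc]) auto
      then show ?thesis using y0Y that(2) unfolding continuous_on_iff dist_real_def by blast
    qed
    obtain \<eta>1 where \<eta>1: "\<eta>1 > 0"
      "\<And>y. y \<in> Y \<Longrightarrow> \<bar>y - y0\<bar> < \<eta>1 \<Longrightarrow> \<bar>?f (x0 - \<delta>) y - ?f (x0 - \<delta>) y0\<bar> < c1 - ?f (x0 - \<delta>) y0"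
      using ev[OF \<delta>(3), of "c1 - ?f (x0 - \<delta>) y0"] c1 by auto
    obtain \<eta>2 where \<eta>2: "\<eta>2 > 0"
      "\<And>y. y \<in> Y \<Longrightarrow> \<bar>y - y0\<bar> < \<eta>2 \<Longrightarrow> \<bar>?f (x0 + \<delta>) y - ?f (x0 + \<delta>) y0\<bar> < ?f (x0 + \<delta>) y0 - c2"
      using ev[OF \<delta>(4), of "?f (x0 + \<delta>) y0 - c2"] c2 by auto
    \<comment> \<open>At a side, radius 1 stays away from the opposite side.\<close>
    obtain \<eta>3 where \<eta>3: "\<eta>3 > 0" "\<And>y. y \<in> {-1..1} \<Longrightarrow> \<bar>y - y0\<bar> < \<eta>3 \<Longrightarrow> y \<in> Y"
    proof (cases "y0 \<in> {-1<..<1}")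
      case True
      show ?thesis by (rule that[of "min (1 - y0) (1 + y0)"]) (use True in \<open>auto simp: Y_def\<close>)
    next
      case False
      then have "y0 = -1 \<or> y0 = 1" using y0 by auto
      then show ?thesis by (intro that[of 1]) (auto simp: Y_def)
    qed
    define \<eta> where "\<eta> = min (min \<eta>1 \<eta>2) (min \<eta>3 (e / 2))"
    have \<eta>: "\<eta> > 0" "\<eta> \<le> \<eta>1" "\<eta> \<le> \<eta>2" "\<eta> \<le> \<eta>3" "\<eta> \<le> e / 2"
      using \<eta>1(1) \<eta>2(1) \<eta>3(1) e by (auto simp: \<eta>_def)
    \<comment> \<open>Compactness of [-1, 1] makes the inverse of \<open>m\<close> continuous, so
      close heights of the images force close heights of the points.\<close>
    have "continuous_on (m ` {-1..1}) (inv_into {-1..1} m)"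
      using m_inj by (intro continuous_on_inv m(1)) (auto intro!: inv_into_f_f inj_onI)
    then obtain d1 where d1: "d1 > 0" "\<And>w. w \<in> m ` {-1..1} \<Longrightarrow> dist w (m y0) < d1 \<Longrightarrow>
        dist (inv_into {-1..1} m w) (inv_into {-1..1} m (m y0)) < \<eta>"
      using y0 \<eta>(1) unfolding continuous_on_iff by blast
    have inv_m: "inv_into {-1..1} m (m y) = y" if "y \<in> {-1..1}" for y
      using m_inj that by (intro inv_into_f_f inj_onI) auto
    define d where "d = min d1 (min (?f x0 y0 - c1) (c2 - ?f x0 y0))"
    have "d > 0" using d1(1) c1 c2 by (auto simp: d_def)
    moreover have "dist p p0 < e" if p: "p \<in> S" "dist (g p) (g p0) < d" for p
    proof -
      obtain x y where xy: "p = (x, y)" by (cases p)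
      have y: "y \<in> {-1..1}" using sndS p xy by blast
      have "dist (snd (g p)) (snd (g p0)) < d1"
        using dist_snd_le[of "g p" "g p0"] p(2) by (auto simp: d_def)
      then have "dist (m y) (m y0) < d1" using m(4)[OF p(1)] m(4)[OF p0] xy xy0 by simp
      then have y_near: "\<bar>y - y0\<bar> < \<eta>"
        using d1(2)[of "m y"] y inv_m y0 by (auto simp: dist_real_def)
      have yY: "y \<in> Y" using \<eta>3(2)[OF y] y_near \<eta>(4) by simp
      have "\<bar>?f x y - ?f x0 y0\<bar> < d"
        using dist_fst_le[of "g p" "g p0"] p(2) xy xy0 by (simp add: dist_real_def)
      then have fx: "c1 < ?f x y" "?f x y < c2" by (auto simp: d_def)
      have lo: "?f (x0 - \<delta>) y < c1" using \<eta>1(2)[OF yY] y_near \<eta>(2) by simp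
      have hi: "c2 < ?f (x0 + \<delta>) y" using \<eta>2(2)[OF yY] y_near \<eta>(3) by simp
      \<comment> \<open>The three points have to lie on one leaf before monotonicity can compare
        them. At an interior height this is automatic; at a boundary height the image lies in the
        convex set \<open>X\<close>, which puts \<open>x\<close> into the same interval.\<close>
      obtain X' where X': "X' \<times> {y} \<in> model_leaves S" "x \<in> X'" "x0 - \<delta> \<in> X'" "x0 + \<delta> \<in> X'"
      proof (cases "y \<in> {-1<..<1}")
        case True
        then show ?thesis using that[of UNIV] unfolding model_leaves_def by blast
      next
        case False
        then have yy: "y = y0" using yY unfolding Y_def by (auto split: if_splits)
        have "?f x y \<in> closed_segment (?f (x0 - \<delta>) y0) (?f (x0 + \<delta>) y0)"
          using fx c1 c2 by (auto simp: closed_segment_eq_real_ivl)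
        then have "?f x y \<in> X" using closed_segment_subset[OF f_X] XS X(2) by blast
        then have "x \<in> X" using same_leaf[OF X, of x] p(1) xy yy by simp
        then show ?thesis using that[of X] X(1) \<delta>(3,4) yy by simp
      qed
      have "x0 - \<delta> < x" using good_lift_fst_mono[OF g X'(1,3,2)] lo fx(1) by simp
      moreover have "x < x0 + \<delta>" using good_lift_fst_mono[OF g X'(1,2,4)] hi fx(2) by simp
      ultimately have "\<bar>x - x0\<bar> < e / 2" using \<delta>(2) by linarith
      moreover have "\<bar>y - y0\<bar> < e / 2" using y_near \<eta>(5) by simp
      moreover have "dist p p0 \<le> \<bar>x - x0\<bar> + \<bar>y - y0\<bar>"
        unfolding xy xy0 dist_Pair_Pair dist_real_def using sqrt_sum_squares_le_sum_abs by simp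
      ultimately show ?thesis by simp
    qed
    ultimately show ?thesis by blast
  qed
  have "continuous_on S (inv_into S g)"
    unfolding continuous_on_iff
  proof (intro ballI allI impI)
    fix r0 and e :: real assume r0: "r0 \<in> S" and e: "e > 0"
    have i0: "inv_into S g r0 \<in> S" "g (inv_into S g r0) = r0"
      using r0 surj inv_into_into f_inv_into_f by metis+
    obtain d where d: "d > 0"
      "\<forall>p\<in>S. dist (g p) (g (inv_into S g r0)) < d \<longrightarrow> dist p (inv_into S g r0) < e"
      using inv_cont[OF i0(1) e] by blast
    have "dist (inv_into S g r) (inv_into S g r0) < e" if "r \<in> S" "dist r r0 < d" for r
    proof -
      have "inv_into S g r \<in> S" "g (inv_into S g r) = r"
        using that surj inv_into_into f_inv_into_f by metis+
      then show ?thesis using d(2) i0(2) that(2) by metis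
    qed
    then show "\<exists>d>0. \<forall>x'\<in>S. dist x' r0 < d \<longrightarrow> dist (inv_into S g x') (inv_into S g r0) < e"
      using d(1) by blast
  qed
  then have "homeomorphic_maps (top_of_set S) (top_of_set S) g (inv_into S g)"
    using gc surj inj unfolding homeomorphic_maps_def
    by (auto simp: f_inv_into_f inv_into_into continuous_map_in_subtopology)
  then show ?thesis using homeomorphic_map_maps by blast
qed

lemma model_leaves_subset: "\<lbrakk>model_strip S; L \<in> model_leaves S\<rbrakk> \<Longrightarrow> L \<subseteq> S"
  using model_leaves_cases by metis

lemma good_lift_leaf:
  assumes S: "model_strip S" and g: "good_lift S g" and L: "L \<in> model_leaves S"
  shows "g ` L \<in> model_leaves S" "L \<in> boundary_intervals S \<Longrightarrow> g ` L = L"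
proof -
  obtain m where m: "strict_mono_on {-1..1} m" "m ` {-1..1} = {-1..1}"
    and leaf: "\<And>X y. X \<times> {y} \<in> model_leaves S \<Longrightarrow> X \<noteq> {} \<Longrightarrow> g ` (X \<times> {y}) = X \<times> {m y} \<and> X \<times> {m y} \<in> model_leaves S"
    by (rule good_liftD[OF S g]) (rule that)
  obtain X y where X: "L = X \<times> {y}" "X \<noteq> {}" using model_leaves_cases[OF S L] by metis
  have eq: "g ` L = X \<times> {m y}" and "X \<times> {m y} \<in> model_leaves S" using leaf[of X y] L X by auto
  then show "g ` L \<in> model_leaves S" by simp
  show "g ` L = L" if "L \<in> boundary_intervals S"
  proof -
    have "L \<subseteq> strip_boundary S" using boundary_intervals_subset[OF that] .
    then have "y = -1 \<or> y = 1" using X by (auto simp: mem_strip_boundary)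
    then show ?thesis using eq X(1) mono_onto_ends(1,2)[OF m] by auto
  qed
qed

lemma good_lift_cong:
  assumes S: "model_strip S" and g: "good_lift S g" and eq: "\<And>p. p \<in> S \<Longrightarrow> g' p = g p"
  shows "good_lift S g'"
proof -
  have c: "continuous_on S g" using g unfolding good_lift_def by blast
  obtain m where m: "continuous_on {-1..1} m" "strict_mono_on {-1..1} m" "m ` {-1..1} = {-1..1}"
    "\<forall>p\<in>S. snd (g p) = m (snd p)"
    using g unfolding good_lift_def by (elim conjE exE) (rule that)
  have "continuous_on S g'" using c by (rule continuous_on_eq) (simp add: eq)
  moreover have "\<forall>p\<in>S. snd (g' p) = m (snd p)" using m(4) eq by simp
  moreover have "strict_mono_on X (\<lambda>x. fst (g' (x, y))) \<and> (\<lambda>x. fst (g' (x, y))) ` X = X"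
    if L: "X \<times> {y} \<in> model_leaves S" for X y
  proof -
    have "g' (x, y) = g (x, y)" if "x \<in> X" for x using eq model_leaves_subset[OF S L] that by blast
    then have "(\<lambda>x. fst (g' (x, y))) ` X = (\<lambda>x. fst (g (x, y))) ` X"
      "strict_mono_on X (\<lambda>x. fst (g' (x, y))) = strict_mono_on X (\<lambda>x. fst (g (x, y)))"
      by (auto simp: strict_mono_on_def)
    then show ?thesis using g L unfolding good_lift_def by simp
  qed
  ultimately show ?thesis unfolding good_lift_def using m(1-3) by blast
qed

lemma good_lift_onto: "\<lbrakk>model_strip S; good_lift S g\<rbrakk> \<Longrightarrow> g ` S = S"
  using homeomorphic_imp_surjective_map[OF good_lift_homeomorphic] by simp

lemma good_lift_inj: "\<lbrakk>model_strip S; good_lift S g\<rbrakk> \<Longrightarrow> inj_on g S"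
  using homeomorphic_imp_injective_map[OF good_lift_homeomorphic] by simp

lemma interior_sequence:
  assumes "e \<in> {-1..1::real}"
  obtains t where "\<And>n. t n \<in> {-1<..<1}" "t \<longlonglongrightarrow> e"
proof -
  have "e \<in> closure {-1<..<1}" using assms by simp
  then show ?thesis using that unfolding closure_sequential by blast
qed

text \<open>Serves to refute an exchange of two intervals on one side by an increasing
  lifting.\<close>

lemma disjoint_intervals_less:
  fixes a b a' b' x x' u u' :: real
  assumes disj: "{a<..<b} \<inter> {a'<..<b'} = {}" and "x \<in> {a<..<b}" "x' \<in> {a'<..<b'}" "x < x'"
    and "u \<in> {a<..<b}" "u' \<in> {a'<..<b'}"
  shows "u < u'"
proof -
  have "b \<le> a'"
  proof (rule ccontr)
    assume "\<not> b \<le> a'"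
    then have "max a a' < min b b'" using assms(2-4) by auto
    then obtain c where "max a a' < c" "c < min b b'" using dense by blast
    then have "c \<in> {a<..<b} \<inter> {a'<..<b'}" by auto
    then show False using disj by blast
  qed
  then show ?thesis using assms(5,6) by auto
qed

context reduced_stripped
begin

section \<open>Liftings and compatible families\<close>

lemma chart_eq_interval:
  assumes J: "J \<in> boundary_intervals (S \<alpha>)" "r \<in> J" and eq: "\<xi> \<alpha> r = \<xi> \<beta> p"
  shows "\<beta> = \<alpha> \<and> p = r \<or> (\<exists>J' \<phi>. glued_by Z \<alpha> J \<beta> J' \<phi> \<and> p \<in> J' \<and> p = \<phi> r)"
  using eq unfolding chart_eq_iff
proof (elim disjE exE conjE)
  fix K K' \<phi> assume g: "glued_by Z \<alpha> K \<beta> K' \<phi>" "r \<in> K" "p = \<phi> r"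
  have "K = J" using boundary_intervals_unique[OF glued_by_intervals(3)[OF g(1)] J(1) g(2) J(2)] .
  moreover have "p \<in> K'" using glued_by_bij[OF g(1)] g(2,3) bij_betwE by blast
  ultimately show ?thesis using g by blast
qed simp

text \<open>Invariance of the leaves is given in the surface only; the point is to obtain it in the
  strip. If some point of \<open>J\<close> went into a different interval \<open>J'\<close> glued to
  \<open>J\<close>, both would be on one side, since an increasing \<open>m\<close> fixes -1 and 1.
  By connectedness all of \<open>J\<close> would go into \<open>J'\<close>, and the preimage of a
  point of \<open>J\<close> would lie in \<open>J'\<close>. Then a point of \<open>J\<close> and one
  of \<open>J'\<close> would exchange their order, contrary to monotonicity.\<close>

lemma lifting_good:
  assumes h: "h \<in> Homeo Z" and inv: "strips_invariant h" and \<alpha>: "\<alpha> \<in> A"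
    and coords: "strip_coordinates (S \<alpha>) (lifting Z h \<alpha>) l m" "strict_mono_on {-1..1} m"
      "\<And>y. y \<in> {-1<..<1} \<Longrightarrow> strict_mono (\<lambda>x. l (x, y))"
    and leaf: "\<And>J. J \<in> boundary_intervals (S \<alpha>) \<Longrightarrow> h ` \<xi> \<alpha> ` J = \<xi> \<alpha> ` J"
  shows "good_lift (S \<alpha>) (lifting Z h \<alpha>)"
proof -
  let ?g = "lifting Z h \<alpha>"
  note mod = model[OF \<alpha>]
  note L = liftingD[OF h \<alpha> inv]
  have hm: "homeomorphic_map (top_of_set {-1..1}) (top_of_set {-1..1}) m"
    and co: "\<forall>(x, y)\<in>S \<alpha>. ?g (x, y) = (l (x, y), m y)"
    using coords(1) unfolding strip_coordinates_def by blast+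
  have m: "continuous_on {-1..1} m" "m ` {-1..1} = {-1..1}"
    using homeomorphic_imp_continuous_map[OF hm] homeomorphic_imp_surjective_map[OF hm] by simp_all
  have g: "fst (?g (x, y)) = l (x, y)" "snd (?g (x, y)) = m y" if "(x, y) \<in> S \<alpha>" for x y
    using bspec[OF co that] by simp_all
  have m_inj: "y = y'" if "y \<in> {-1..1}" "y' \<in> {-1..1}" "m y = m y'" for y y'
    using coords(2) that by (metis less_irrefl linorder_neqE strict_mono_onD)
  note ends = mono_onto_ends[OF coords(2) m(2)]
  \<comment> \<open>Monotonicity is known at interior heights only; passing to the limit carries it
    to the sides, even between different intervals, but as a weak inequality.\<close>
  have weak: "fst (?g (x, e)) \<le> fst (?g (x', e))" if xx: "x < x'" "(x, e) \<in> S \<alpha>" "(x', e) \<in> S \<alpha>"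
    for x x' e
  proof -
    have "e \<in> {-1..1}" using model_strip_subset[OF mod] xx(2) by auto
    then obtain t where t: "\<And>n. t n \<in> {-1<..<1}" "t \<longlonglongrightarrow> e" using interior_sequence by blast
    have tS: "(u, t n) \<in> S \<alpha>" for u n using t(1)[of n] open_strip_subset[OF mod] by auto
    have "(\<lambda>n. ?g (u, t n)) \<longlonglongrightarrow> ?g (u, e)" if "(u, e) \<in> S \<alpha>" for u
      by (rule continuous_on_tendsto_compose[OF L(1) _ that]) (use t(2) tS in \<open>auto intro!: tendsto_intros\<close>)
    then have lim: "(\<lambda>n. fst (?g (u, t n))) \<longlonglongrightarrow> fst (?g (u, e))" if "(u, e) \<in> S \<alpha>" for u
      using that tendsto_fst by blast
    have "fst (?g (x, t n)) \<le> fst (?g (x', t n))" for n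
      using strict_monoD[OF coords(3)[OF t(1)[of n]] xx(1)] g(1)[OF tS] by simp
    then show ?thesis by (intro LIMSEQ_le[OF lim[OF xx(2)] lim[OF xx(3)]]) auto
  qed
  \<comment> \<open>Comparison in the surface locates a point only up to gluing: either in
    \<open>J\<close> or in the partner interval of the same strip.\<close>
  have preimage: "r \<in> J \<Longrightarrow> ?g p = r \<Longrightarrow> p \<in> S \<alpha> \<Longrightarrow> p \<in> J \<or> (\<exists>J' \<phi>. glued_by Z \<alpha> J \<alpha> J' \<phi> \<and> p \<in> J')"
    if J: "J \<in> boundary_intervals (S \<alpha>)" for J r p
  proof -
    assume r: "r \<in> J" "?g p = r" and p: "p \<in> S \<alpha>"
    have "\<xi> \<alpha> r \<in> h ` \<xi> \<alpha> ` J" using leaf[OF J] r(1) by blast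
    then obtain s where s: "s \<in> J" "\<xi> \<alpha> r = h (\<xi> \<alpha> s)" by blast
    have sS: "s \<in> S \<alpha>" using s(1) interval_subset_strip[OF J] by blast
    have "h (\<xi> \<alpha> s) = h (\<xi> \<alpha> p)" using L(4)[OF p] r(2) s(2) by simp
    then have "\<xi> \<alpha> s = \<xi> \<alpha> p"
      using inj_onD[OF HomeoD(5)[OF h]] chart_in_topspace[OF \<alpha>] p sS by blast
    then show ?thesis using chart_eq_interval[OF J s(1)] s(1) by blast
  qed
  have image: "p \<in> J \<Longrightarrow> ?g p \<in> J \<or> (\<exists>J' \<phi>. glued_by Z \<alpha> J \<alpha> J' \<phi> \<and> ?g p \<in> J')"
    if J: "J \<in> boundary_intervals (S \<alpha>)" for J p
  proof -
    assume p: "p \<in> J"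
    then have pS: "p \<in> S \<alpha>" using interval_subset_strip[OF J] by blast
    have "h (\<xi> \<alpha> p) \<in> \<xi> \<alpha> ` J" using leaf[OF J] p by blast
    then obtain r where r: "r \<in> J" "\<xi> \<alpha> r = \<xi> \<alpha> (?g p)" using L(4)[OF pS] by (metis imageE)
    then show ?thesis using chart_eq_interval[OF J r] by metis
  qed
  have sub: "?g p \<in> J" if J: "J \<in> boundary_intervals (S \<alpha>)" and p: "p \<in> J" for J p
  proof (rule ccontr)
    assume n: "?g p \<notin> J"
    then obtain J' \<phi> where J': "glued_by Z \<alpha> J \<alpha> J' \<phi>" "?g p \<in> J'" using image[OF J p] by blast
    have J'b: "J' \<in> boundary_intervals (S \<alpha>)" using glued_by_intervals[OF J'(1)] by blast
    obtain a b e where ab: "J = {a<..<b} \<times> {e}" "e \<in> {-1, 1}" "J \<subseteq> S \<alpha>"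
      using boundary_intervals_cases[OF mod J] by metis
    obtain a' b' e' where ab': "J' = {a'<..<b'} \<times> {e'}" "J' \<subseteq> S \<alpha>"
      using boundary_intervals_cases[OF mod J'b] by metis
    obtain x where x: "p = (x, e)" "x \<in> {a<..<b}" using p ab(1) by auto
    have me: "m e = e" using ends(1,2) ab(2) by auto
    have "snd (?g p) = e" using g(2)[of x e] x p ab(3) me by auto
    then have e': "e' = e" using J'(2) ab'(1) by auto
    have JJ': "J \<noteq> J'" using glued_by_distinct[OF J'(1)] by blast
    have disj: "{a<..<b} \<inter> {a'<..<b'} = {}"
    proof -
      have "False" if "c \<in> {a<..<b}" "c \<in> {a'<..<b'}" for c
      proof -
        have "(c, e) \<in> J" "(c, e) \<in> J'" using that ab(1) ab'(1) e' by auto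
        then show False using boundary_intervals_unique[OF J J'b] JJ' by blast
      qed
      then show ?thesis by blast
    qed
    have cov: "?g r \<in> J \<or> ?g r \<in> J'" if "r \<in> J" for r
      using image[OF J that] glued_by_unique[OF J'(1)] by blast
    \<comment> \<open>The vertical slabs over the two disjoint intervals would disconnect the image
      of \<open>J\<close> if it met both.\<close>
    have all: "?g r \<in> J'" if r: "r \<in> J" for r
    proof (rule ccontr)
      assume "?g r \<notin> J'"
      then have rJ: "?g r \<in> J" using cov r by blast
      have c1: "connected (?g ` J)"
        using continuous_on_subset[OF L(1) ab(3)] convex_connected[OF boundary_interval_convex[OF mod J]]
        by (rule connected_continuous_image)
      have c2: "open ({a<..<b} \<times> (UNIV :: real set))" "open ({a'<..<b'} \<times> (UNIV :: real set))"
        by (auto intro!: open_Times)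
      have c3: "?g ` J \<subseteq> {a<..<b} \<times> UNIV \<union> {a'<..<b'} \<times> UNIV"
      proof
        fix v assume "v \<in> ?g ` J"
        then have "v \<in> J \<or> v \<in> J'" using cov by blast
        then show "v \<in> {a<..<b} \<times> UNIV \<union> {a'<..<b'} \<times> UNIV" unfolding ab(1) ab'(1) by auto
      qed
      have c4: "{a<..<b} \<times> UNIV \<inter> {a'<..<b'} \<times> UNIV \<inter> ?g ` J = {}" using disj by auto
      have c5: "{a<..<b} \<times> UNIV \<inter> ?g ` J \<noteq> {}"
      proof -
        have "?g r \<in> {a<..<b} \<times> UNIV" using rJ ab(1) by auto
        from IntI[OF this imageI[OF r, of ?g]] show ?thesis by (metis empty_iff)
      qed
      have c6: "{a'<..<b'} \<times> UNIV \<inter> ?g ` J \<noteq> {}"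
      proof -
        have "?g p \<in> {a'<..<b'} \<times> UNIV" using J'(2) ab'(1) by auto
        from IntI[OF this imageI[OF p, of ?g]] show ?thesis by (metis empty_iff)
      qed
      show False using connectedD[OF c1 c2 c4 c3] c5 c6 by argo
    qed
    obtain p' where p': "p' \<in> S \<alpha>" "?g p' = p" using L(2) p ab(3) by (metis imageE in_mono)
    have "p' \<notin> J"
    proof
      assume "p' \<in> J"
      then have "p \<in> J'" using all p'(2) by blast
      then show False using p disj ab(1) ab'(1) by auto
    qed
    then have "p' \<in> J'" using preimage[OF J p p'(2,1)] glued_by_unique[OF J'(1)] by blast
    then obtain x' where x': "p' = (x', e)" "x' \<in> {a'<..<b'}" using ab'(1) e' by auto
    have gp: "fst (?g p) \<in> {a'<..<b'}" using J'(2) ab'(1) by auto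
    have S2: "(x, e) \<in> S \<alpha>" "(x', e) \<in> S \<alpha>" using x(1) p ab(3) x'(1) p'(1) by auto
    have gp': "fst (?g p') = x" using p'(2) x(1) by simp
    have "x \<noteq> x'" using disj x(2) x'(2) by blast
    then consider "x < x'" | "x' < x" by linarith
    then show False
    proof cases
      case 1
      have "fst (?g p) \<le> x" using weak[OF 1 S2] gp' x(1) x'(1) by simp
      moreover have "x < fst (?g p)" using disjoint_intervals_less[OF disj x(2) x'(2) 1 x(2) gp] .
      ultimately show False by simp
    next
      case 2
      have "x \<le> fst (?g p)" using weak[OF 2 S2(2,1)] gp' x(1) x'(1) by simp
      moreover have "fst (?g p) < x"
        using disjoint_intervals_less[OF _ x'(2) x(2) 2 gp x(2)] disj by blast
      ultimately show False by simp
    qed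
  qed
  have "strict_mono_on X (\<lambda>x. fst (?g (x, y))) \<and> (\<lambda>x. fst (?g (x, y))) ` X = X"
    if XL: "X \<times> {y} \<in> model_leaves (S \<alpha>)" for X y
  proof (cases "X = {}")
    case False
    have XS: "X \<times> {y} \<subseteq> S \<alpha>" using model_leaves_subset[OF mod XL] .
    have y1: "y \<in> {-1..1}"
    proof -
      obtain x where "x \<in> X" using False by blast
      then have "(x, y) \<in> UNIV \<times> {-1..1}" using XS model_strip_subset[OF mod] by blast
      then show ?thesis by simp
    qed
    show ?thesis
    proof (cases "y \<in> {-1<..<1}")
      case True
      have X: "X = UNIV" using model_leaf_interior[OF XL False True] .
      have yS: "(x, y) \<in> S \<alpha>" for x using XS X by auto
      have "u \<in> (\<lambda>x. fst (?g (x, y))) ` UNIV" for u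
      proof -
        have "(u, m y) \<in> S \<alpha>" using ends(3)[OF True] open_strip_subset[OF mod] by auto
        then obtain x' y' where p': "(x', y') \<in> S \<alpha>" "(u, m y) = ?g (x', y')"
          using L(2) by (metis imageE surj_pair)
        have y'1: "y' \<in> {-1..1}" using p'(1) model_strip_subset[OF mod] by auto
        have "m y' = m y" using g(2)[OF p'(1)] p'(2) by (metis snd_conv)
        then have "y' = y" using m_inj y1 y'1 by blast
        then show ?thesis using p'(2) by (metis fst_conv rangeI)
      qed
      then have "(\<lambda>x. fst (?g (x, y))) ` X = X" using X by blast
      moreover have "strict_mono_on X (\<lambda>x. fst (?g (x, y)))"
        using coords(3)[OF True] g(1)[OF yS] X by simp
      ultimately show ?thesis by blast
    next
      case bd: False
      then have J: "X \<times> {y} \<in> boundary_intervals (S \<alpha>)"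
        using XL False unfolding model_leaves_def by (auto simp: times_eq_iff)
      have y: "y = -1 \<or> y = 1" using bd y1 by auto
      have my: "m y = y" using y ends by auto
      have "strict_mono_on X (\<lambda>x. fst (?g (x, y)))"
      proof (rule strict_mono_onI)
        fix x x' assume x: "x \<in> X" "x' \<in> X" "x < x'"
        have xS: "(x, y) \<in> S \<alpha>" "(x', y) \<in> S \<alpha>" using XS x by auto
        \<comment> \<open>Injectivity, together with equal heights, turns the weak inequality into a
          strict one.\<close>
        have "?g (x, y) \<noteq> ?g (x', y)" using inj_onD[OF L(3) _ xS] x(3) by blast
        then have "fst (?g (x, y)) \<noteq> fst (?g (x', y))"
          using g(2)[OF xS(1)] g(2)[OF xS(2)] by (auto simp: prod_eq_iff)
        then show "fst (?g (x, y)) < fst (?g (x', y))" using weak[OF x(3) xS] by simp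
      qed
      moreover have "(\<lambda>x. fst (?g (x, y))) ` X = X"
      proof (intro equalityI subsetI)
        fix u assume "u \<in> (\<lambda>x. fst (?g (x, y))) ` X"
        then obtain x where x: "x \<in> X" "u = fst (?g (x, y))" by blast
        then show "u \<in> X" using sub[OF J, of "(x, y)"] by auto
      next
        fix u assume u: "u \<in> X"
        then have uy: "(u, y) \<in> X \<times> {y}" by simp
        then obtain p' where p': "p' \<in> S \<alpha>" "?g p' = (u, y)" using L(2) XS by (metis imageE in_mono)
        have "p' \<in> X \<times> {y}"
        proof (rule ccontr)
          assume "p' \<notin> X \<times> {y}"
          then obtain J' \<phi> where J': "glued_by Z \<alpha> (X \<times> {y}) \<alpha> J' \<phi>" "p' \<in> J'"
            using preimage[OF J uy p'(2,1)] by blast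
          have J'b: "J' \<in> boundary_intervals (S \<alpha>)" using glued_by_intervals[OF J'(1)] by blast
          have "(u, y) \<in> J'" using sub[OF J'b J'(2)] p'(2) by simp
          then have "J' = X \<times> {y}" using boundary_intervals_unique[OF J'b J _ uy] by blast
          then show False using glued_by_distinct[OF J'(1)] by simp
        qed
        then obtain x where "x \<in> X" "p' = (x, y)" by auto
        then show "u \<in> (\<lambda>x. fst (?g (x, y))) ` X" using p'(2) by (intro image_eqI[of _ _ x]) auto
      qed
      ultimately show ?thesis by blast
    qed
  qed auto
  moreover have "\<forall>p\<in>S \<alpha>. snd (?g p) = m (snd p)" using g(2) by auto
  ultimately show ?thesis unfolding good_lift_def using L(1) m coords(2) by blast
qed

text \<open>The families of strip maps that descend to the surface. As \<open>glued_by\<close> is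
  symmetric, commutation is demanded for each gluing map and for its inverse.\<close>

definition compatible :: "('a \<Rightarrow> real \<times> real \<Rightarrow> real \<times> real) \<Rightarrow> bool" where
  "compatible G \<longleftrightarrow> (\<forall>\<alpha>\<in>A. good_lift (S \<alpha>) (G \<alpha>)) \<and>
     (\<forall>\<alpha> J \<alpha>' J' \<phi> p. glued_by Z \<alpha> J \<alpha>' J' \<phi> \<longrightarrow> p \<in> J \<longrightarrow> G \<alpha>' (\<phi> p) = \<phi> (G \<alpha> p))"

text \<open>A representative is chosen arbitrarily; for compatible families the value does not
  depend on it, by \<open>induced_chart\<close>. The restriction puts the result in the normal form
  of maps that are undefined off the surface.\<close>

definition induced :: "('a \<Rightarrow> real \<times> real \<Rightarrow> real \<times> real) \<Rightarrow> 'a surface_map" where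
  "induced G = restrict (\<lambda>z. case SOME P. P \<in> Sigma A S \<and> q P = z of (\<alpha>, p) \<Rightarrow> \<xi> \<alpha> (G \<alpha> p)) (topspace T)"

text \<open>Invariance of the strips guarantees that \<open>lifting\<close> is meaningful here. The
  set turns out to be the identity component.\<close>

definition liftable :: "'a surface_map set" where
  "liftable = {h \<in> Homeo Z. strips_invariant h \<and> (\<forall>\<alpha>\<in>A. good_lift (S \<alpha>) (lifting Z h \<alpha>))}"

lemma induced_chart:
  assumes G: "compatible G" and p: "\<alpha> \<in> A" "p \<in> S \<alpha>"
  shows "induced G (\<xi> \<alpha> p) = \<xi> \<alpha> (G \<alpha> p)"
proof -
  let ?P = "\<lambda>P. P \<in> Sigma A S \<and> q P = \<xi> \<alpha> p"
  have "?P (\<alpha>, p)" using p by (simp add: chart_def)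
  then have "?P (SOME P. ?P P)" by (rule someI)
  moreover obtain \<beta> r where r1: "(SOME P. ?P P) = (\<beta>, r)" by (meson surj_pair)
  ultimately have r: "(SOME P. ?P P) = (\<beta>, r)" "\<beta> \<in> A" "r \<in> S \<beta>" "\<xi> \<beta> r = \<xi> \<alpha> p"
    by (simp_all add: chart_def)
  have "\<xi> \<beta> (G \<beta> r) = \<xi> \<alpha> (G \<alpha> p)"
    using r(4) unfolding chart_eq_iff[of \<beta> r]
  proof (elim disjE exE conjE)
    fix J J' \<phi> assume g: "glued_by Z \<beta> J \<alpha> J' \<phi>" "r \<in> J" "p = \<phi> r"
    have "G \<beta> ` J = J"
      using good_lift_leaf(2)[OF model[OF r(2)]] G r(2) glued_by_intervals(3)[OF g(1)]
      unfolding compatible_def model_leaves_def by blast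
    then have "G \<beta> r \<in> J" using g(2) by blast
    moreover have "G \<alpha> p = \<phi> (G \<beta> r)" using G g unfolding compatible_def by blast
    ultimately show ?thesis using chart_glued[OF g(1)] by simp
  qed simp
  then show ?thesis using r(1) chart_in_topspace[OF p] unfolding induced_def by simp
qed

text \<open>A continuous closed bijection is a homeomorphism, so no inverse family has to be
  constructed. Closedness is obtained upstairs, by applying the strip maps to the preimages of a
  closed set, and pushed down along the closed quotient map.\<close>

lemma induced_Homeo:
  assumes G: "compatible G"
  shows "induced G \<in> Homeo Z"
proof -
  have gl: "good_lift (S \<alpha>) (G \<alpha>)" if "\<alpha> \<in> A" for \<alpha> using G that unfolding compatible_def by blast
  have GS: "G \<alpha> p \<in> S \<alpha>" if "\<alpha> \<in> A" "p \<in> S \<alpha>" for \<alpha> p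
    using good_lift_onto[OF model gl] that by blast
  have hm: "homeomorphic_map (top_of_set (S \<alpha>)) (top_of_set (S \<alpha>)) (G \<alpha>)" if "\<alpha> \<in> A" for \<alpha>
    using good_lift_homeomorphic[OF model gl] that by blast
  note ch = induced_chart[OF G]
  have "continuous_map T T (induced G)"
  proof (rule continuous_map_surface)
    fix \<alpha> assume \<alpha>: "\<alpha> \<in> A"
    have "continuous_map (top_of_set (S \<alpha>)) T (\<xi> \<alpha> \<circ> G \<alpha>)"
      using homeomorphic_imp_continuous_map[OF hm[OF \<alpha>]] continuous_chart[OF \<alpha>]
        by (rule continuous_map_compose)
    then show "continuous_map (top_of_set (S \<alpha>)) T (induced G \<circ> \<xi> \<alpha>)"
      by (rule continuous_map_eq) (simp add: ch[OF \<alpha>])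
  qed
  moreover have "closed_map T T (induced G)"
    unfolding closed_map_def
  proof (intro allI impI)
    fix C assume C: "closedin T C"
    let ?D = "Sigma A (\<lambda>\<alpha>. G \<alpha> ` {p \<in> S \<alpha>. \<xi> \<alpha> p \<in> C})"
    have "closedin (top_of_set (S \<alpha>)) (G \<alpha> ` {p \<in> S \<alpha>. \<xi> \<alpha> p \<in> C})" if \<alpha>: "\<alpha> \<in> A" for \<alpha>
    proof -
      have "closedin (top_of_set (S \<alpha>)) {p \<in> S \<alpha>. \<xi> \<alpha> p \<in> C}"
        using closedin_continuous_map_preimage[OF continuous_chart[OF \<alpha>] C] by simp
      then show ?thesis using homeomorphic_imp_closed_map[OF hm[OF \<alpha>]]
        unfolding closed_map_def by blast
    qed
    then have "closedin \<D> ?D" by (simp add: closedin_disjoint_union)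
    then have cl: "closedin T (q ` ?D)" using closed_map_proj unfolding closed_map_def by blast
    have "induced G ` C = q ` ?D"
    proof (intro equalityI subsetI)
      fix z assume "z \<in> induced G ` C"
      then obtain y where y: "y \<in> C" "z = induced G y" by blast
      then obtain \<alpha> p where p: "\<alpha> \<in> A" "p \<in> S \<alpha>" "y = \<xi> \<alpha> p"
        using closedin_subset[OF C] unfolding topspace_surface by blast
      have "z = q (\<alpha>, G \<alpha> p)" using y(2) p ch by (simp add: chart_def)
      moreover have "(\<alpha>, G \<alpha> p) \<in> ?D" using p y(1) by blast
      ultimately show "z \<in> q ` ?D" by blast
    next
      fix z assume "z \<in> q ` ?D"
      then obtain \<alpha> p where p: "\<alpha> \<in> A" "p \<in> S \<alpha>" "\<xi> \<alpha> p \<in> C" "z = q (\<alpha>, G \<alpha> p)" by blast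
      then have "z = induced G (\<xi> \<alpha> p)" using ch by (simp add: chart_def)
      then show "z \<in> induced G ` C" using p(3) by blast
    qed
    then show "closedin T (induced G ` C)" using cl by simp
  qed
  moreover have "induced G ` topspace T = topspace T"
  proof (intro equalityI subsetI)
    fix z assume "z \<in> induced G ` topspace T"
    then obtain \<alpha> p where p: "\<alpha> \<in> A" "p \<in> S \<alpha>" "z = induced G (\<xi> \<alpha> p)"
      unfolding topspace_surface by blast
    then show "z \<in> topspace T" using ch chart_in_topspace GS by simp
  next
    fix z assume "z \<in> topspace T"
    then obtain \<alpha> p where p: "\<alpha> \<in> A" "p \<in> S \<alpha>" "z = \<xi> \<alpha> p" unfolding topspace_surface by blast
    then have "p \<in> G \<alpha> ` S \<alpha>" using good_lift_onto[OF model gl] by simp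
    then obtain r where "r \<in> S \<alpha>" "p = G \<alpha> r" by blast
    then have "z = induced G (\<xi> \<alpha> r)" "\<xi> \<alpha> r \<in> topspace T" using p ch chart_in_topspace by simp_all
    then show "z \<in> induced G ` topspace T" by blast
  qed
  moreover have "inj_on (induced G) (topspace T)"
  proof (rule inj_onI)
    fix y z assume "y \<in> topspace T" "z \<in> topspace T" and eq: "induced G y = induced G z"
    then obtain \<alpha> p \<beta> r where p: "\<alpha> \<in> A" "p \<in> S \<alpha>" "y = \<xi> \<alpha> p" and r: "\<beta> \<in> A" "r \<in> S \<beta>" "z = \<xi> \<beta> r"
      unfolding topspace_surface by blast
    have "\<xi> \<alpha> (G \<alpha> p) = \<xi> \<beta> (G \<beta> r)" using eq p r ch by simp
    then show "y = z" unfolding chart_eq_iff[of \<alpha> "G \<alpha> p"]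
    proof (elim disjE exE conjE)
      assume "\<alpha> = \<beta>" "G \<alpha> p = G \<beta> r"
      then have "p = r" using inj_onD[OF good_lift_inj[OF model gl]] p r by metis
      then show ?thesis using p(3) r(3) \<open>\<alpha> = \<beta>\<close> by simp
    next
      fix J J' \<phi> assume g: "glued_by Z \<alpha> J \<beta> J' \<phi>" "G \<alpha> p \<in> J" "G \<beta> r = \<phi> (G \<alpha> p)"
      have J: "J \<in> boundary_intervals (S \<alpha>)" using glued_by_intervals[OF g(1)] by blast
      have "G \<alpha> ` J = J"
        using good_lift_leaf(2)[OF model[OF p(1)] gl[OF p(1)]] J unfolding model_leaves_def by blast
      then obtain p' where p': "p' \<in> J" "G \<alpha> p' = G \<alpha> p" using g(2) by (metis imageE)
      have "p' = p"
        using inj_onD[OF good_lift_inj[OF model[OF p(1)] gl[OF p(1)]] p'(2)] p'(1) p(2) interval_subset_strip[OF J] by blast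
      then have pJ: "p \<in> J" using p'(1) by simp
      have \<phi>p: "\<phi> p \<in> S \<beta>"
        using glued_by_bij[OF g(1)] bij_betwE pJ interval_subset_strip[OF glued_by_intervals(4)[OF g(1)]] by blast
      have "G \<beta> (\<phi> p) = \<phi> (G \<alpha> p)" using G g(1) pJ unfolding compatible_def by blast
      then have "G \<beta> r = G \<beta> (\<phi> p)" using g(3) by simp
      then have "r = \<phi> p" using inj_onD[OF good_lift_inj[OF model[OF r(1)] gl[OF r(1)]]] r(2) \<phi>p
        by blast
      then show ?thesis using chart_glued[OF g(1) pJ] p(3) r(3) by simp
    qed
  qed
  ultimately have "homeomorphic_map T T (induced G)"
    by (intro bijective_closed_imp_homeomorphic_map)
  moreover have "induced G ` w \<in> leaves Z" if w: "w \<in> leaves Z" for w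
  proof -
    obtain \<alpha> L where L: "\<alpha> \<in> A" "L \<in> model_leaves (S \<alpha>)" "w = \<xi> \<alpha> ` L" using w
      unfolding leaves_def by blast
    have LS: "L \<subseteq> S \<alpha>" using model_leaves_subset[OF model] L by blast
    have "induced G ` w = (\<lambda>p. induced G (\<xi> \<alpha> p)) ` L" unfolding L(3) by (simp add: image_image)
    also have "\<dots> = (\<lambda>p. \<xi> \<alpha> (G \<alpha> p)) ` L" using LS ch[OF L(1)] by (intro image_cong) auto
    also have "\<dots> = \<xi> \<alpha> ` (G \<alpha> ` L)" by (simp add: image_image)
    finally show ?thesis using good_lift_leaf(1)[OF model[OF L(1)] gl[OF L(1)] L(2)] L(1)
      unfolding leaves_def by blast
  qed
  moreover have "induced G \<in> extensional (topspace T)" unfolding induced_def by simp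
  ultimately show ?thesis unfolding Homeo_def by blast
qed

text \<open>The given family consists of liftings of the induced map, so uniqueness identifies them;
  \<open>restrict\<close> matches the normal form in \<open>is_lifting\<close>.\<close>

lemma induced_liftable:
  assumes G: "compatible G"
  shows "induced G \<in> liftable" "\<And>\<alpha>. \<alpha> \<in> A \<Longrightarrow> lifting Z (induced G) \<alpha> = restrict (G \<alpha>) (S \<alpha>)"
proof -
  have gl: "good_lift (S \<alpha>) (G \<alpha>)" if "\<alpha> \<in> A" for \<alpha> using G that unfolding compatible_def by blast
  note ch = induced_chart[OF G]
  have inv: "strips_invariant (induced G)"
  proof
    fix \<alpha> assume \<alpha>: "\<alpha> \<in> A"
    have "induced G ` surface_strip Z \<alpha> = (\<lambda>p. induced G (\<xi> \<alpha> p)) ` S \<alpha>"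
      unfolding surface_strip_def by (simp add: image_image)
    also have "\<dots> = (\<lambda>p. \<xi> \<alpha> (G \<alpha> p)) ` S \<alpha>" using ch[OF \<alpha>] by (intro image_cong) auto
    also have "\<dots> = \<xi> \<alpha> ` (G \<alpha> ` S \<alpha>)" by (simp add: image_image)
    finally show "induced G ` surface_strip Z \<alpha> = surface_strip Z \<alpha>"
      unfolding good_lift_onto[OF model[OF \<alpha>] gl[OF \<alpha>]] surface_strip_def .
  qed
  have H: "induced G \<in> Homeo Z" using induced_Homeo[OF G] .
  show lift: "lifting Z (induced G) \<alpha> = restrict (G \<alpha>) (S \<alpha>)" if \<alpha>: "\<alpha> \<in> A" for \<alpha>
  proof (rule lifting_unique[OF H \<alpha> inv])
    have "homeomorphic_map (top_of_set (S \<alpha>)) (top_of_set (S \<alpha>)) (G \<alpha>)"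
      using good_lift_homeomorphic[OF model[OF \<alpha>] gl[OF \<alpha>]] .
    then have "homeomorphic_map (top_of_set (S \<alpha>)) (top_of_set (S \<alpha>)) (restrict (G \<alpha>) (S \<alpha>))"
      by (rule homeomorphic_map_eq) simp
    then show "is_lifting Z (induced G) \<alpha> (restrict (G \<alpha>) (S \<alpha>))"
      using ch[OF \<alpha>] unfolding is_lifting_def by simp
  qed
  have "good_lift (S \<alpha>) (lifting Z (induced G) \<alpha>)" if \<alpha>: "\<alpha> \<in> A" for \<alpha>
    unfolding lift[OF \<alpha>] by (rule good_lift_cong[OF model[OF \<alpha>] gl[OF \<alpha>]]) simp
  then show "induced G \<in> liftable" unfolding liftable_def using H inv by blast
qed

lemma liftableD:
  assumes "h \<in> liftable"
  shows "h \<in> Homeo Z" "strips_invariant h" "\<And>\<alpha>. \<alpha> \<in> A \<Longrightarrow> good_lift (S \<alpha>) (lifting Z h \<alpha>)"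
    "\<And>\<alpha> p. \<alpha> \<in> A \<Longrightarrow> p \<in> S \<alpha> \<Longrightarrow> h (\<xi> \<alpha> p) = \<xi> \<alpha> (lifting Z h \<alpha> p)"
proof -
  show 1: "h \<in> Homeo Z" "strips_invariant h" "\<And>\<alpha>. \<alpha> \<in> A \<Longrightarrow> good_lift (S \<alpha>) (lifting Z h \<alpha>)"
    using assms unfolding liftable_def by blast+
  show "h (\<xi> \<alpha> p) = \<xi> \<alpha> (lifting Z h \<alpha> p)" if "\<alpha> \<in> A" "p \<in> S \<alpha>" for \<alpha> p
    using liftingD(4)[OF 1(1) that(1) 1(2) that(2)] by simp
qed

text \<open>Gluing maps are affine, so they commute with the linear interpolation.\<close>

lemma compatible_deform:
  assumes h: "h \<in> liftable" and st: "s \<in> {0..1}" "t \<in> {0..1}"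
  shows "compatible (\<lambda>\<alpha>. deform s t (lifting Z h \<alpha>))"
  unfolding compatible_def
proof (intro conjI ballI allI impI)
  note hD = liftableD[OF h]
  fix \<alpha> assume "\<alpha> \<in> A"
  then show "good_lift (S \<alpha>) (deform s t (lifting Z h \<alpha>))"
    using good_lift_deform[OF model hD(3) st] by blast
next
  note hD = liftableD[OF h]
  fix \<alpha> J \<alpha>' J' \<phi> p assume g: "glued_by Z \<alpha> J \<alpha>' J' \<phi>" and p: "p \<in> J"
  note I = glued_by_intervals[OF g]
  let ?g = "lifting Z h \<alpha>" and ?g' = "lifting Z h \<alpha>'"
  have J: "?g ` J = J" "?g' ` J' = J'"
    using good_lift_leaf(2)[OF model[OF I(1)] hD(3)[OF I(1)]] good_lift_leaf(2)[OF model[OF I(2)] hD(3)[OF I(2)]] I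
    unfolding model_leaves_def by blast+
  have gp: "?g p \<in> J" using J(1) p by blast
  have bij: "r \<in> J \<Longrightarrow> \<phi> r \<in> J'" for r using glued_by_bij[OF g] bij_betwE by blast
  \<comment> \<open>The liftings commute with \<phi> before any deformation: both sides lie over the
    same point of the surface and in the interval \<open>J'\<close>, on which the chart is
    injective.\<close>
  have "\<xi> \<alpha>' (?g' (\<phi> p)) = h (\<xi> \<alpha>' (\<phi> p))"
    by (rule hD(4)[OF I(2) subsetD[OF interval_subset_strip[OF I(4)] bij[OF p]], symmetric])
  also have "\<dots> = h (\<xi> \<alpha> p)" using chart_glued[OF g p] by simp
  also have "\<dots> = \<xi> \<alpha> (?g p)" by (rule hD(4)[OF I(1) subsetD[OF interval_subset_strip[OF I(3)] p]])
  also have "\<dots> = \<xi> \<alpha>' (\<phi> (?g p))" using chart_glued[OF g gp] by simp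
  finally have "\<xi> \<alpha>' (?g' (\<phi> p)) = \<xi> \<alpha>' (\<phi> (?g p))" .
  moreover have "?g' (\<phi> p) \<in> J'" "\<phi> (?g p) \<in> J'" using J(2) bij p gp by blast+
  ultimately have comm: "?g' (\<phi> p) = \<phi> (?g p)"
    using inj_onD[OF chart_inj_interval[OF I(4)]] by blast
  obtain c d e' where "J' \<subseteq> UNIV \<times> {e'}" "bij_betw \<phi> J J'"
    and \<phi>: "\<And>p. p \<in> J \<Longrightarrow> \<phi> p = (c * fst p + d, e')"
    by (rule glued_by_affine[OF g]) (rule that)
  obtain a b e where e: "J = {a<..<b} \<times> {e}" "J \<subseteq> S \<alpha>"
    using boundary_intervals_cases[OF model[OF I(1)] I(3)] by metis
  have se: "snd p = e" "snd (?g p) = e" using p gp e by auto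
  \<comment> \<open>The affine formula for \<phi> is available on \<open>J\<close> only; convexity
    of the interval keeps the interpolated point there.\<close>
  have compatible_point: "deform s t ?g p \<in> J"
  proof -
    have "fst p \<in> {a<..<b}" "fst (?g p) \<in> {a<..<b}" using p gp e(1) by auto
    then have "(1 - s) *\<^sub>R fst (?g p) + s *\<^sub>R fst p \<in> {a<..<b}"
      using convexD_alt[of "{a<..<b}" "fst (?g p)" "fst p" s] st(1) by simp
    then show ?thesis unfolding deform_def e(1) se by (simp add: algebra_simps)
  qed
  have "deform s t ?g' (\<phi> p) = ((1 - s) * fst (\<phi> (?g p)) + s * fst (\<phi> p), (1 - t) * snd (\<phi> (?g p)) + t * snd (\<phi> p))"
    unfolding deform_def comm ..
  also have "\<dots> = (c * fst (deform s t ?g p) + d, e')"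
    unfolding \<phi>[OF p] \<phi>[OF gp] deform_def by (simp add: algebra_simps)
  also have "\<dots> = \<phi> (deform s t ?g p)" using \<phi>[OF compatible_point] by simp
  finally show "deform s t ?g' (\<phi> p) = \<phi> (deform s t ?g p)" .
qed

definition deform_map :: "real \<Rightarrow> real \<Rightarrow> 'a surface_map \<Rightarrow> 'a surface_map" where
  "deform_map s t h = induced (\<lambda>\<alpha>. deform s t (lifting Z h \<alpha>))"

lemma deform_map:
  assumes h: "h \<in> liftable" and st: "s \<in> {0..1}" "t \<in> {0..1}"
  shows "deform_map s t h \<in> liftable"
    "\<And>\<alpha> p. \<alpha> \<in> A \<Longrightarrow> p \<in> S \<alpha> \<Longrightarrow> lifting Z (deform_map s t h) \<alpha> p = deform s t (lifting Z h \<alpha>) p"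
    "\<And>\<alpha> p. \<alpha> \<in> A \<Longrightarrow> p \<in> S \<alpha> \<Longrightarrow> deform_map s t h (\<xi> \<alpha> p) = \<xi> \<alpha> (deform s t (lifting Z h \<alpha>) p)"
  using induced_liftable[OF compatible_deform[OF assms]] induced_chart[OF compatible_deform[OF assms]]
  unfolding deform_map_def by simp_all

lemma surface_map_eqI:
  assumes "f \<in> extensional (topspace T)" "g \<in> extensional (topspace T)"
    and "\<And>\<alpha> p. \<alpha> \<in> A \<Longrightarrow> p \<in> S \<alpha> \<Longrightarrow> f (\<xi> \<alpha> p) = g (\<xi> \<alpha> p)"
  shows "f = g"
proof (rule extensionalityI[OF assms(1,2)])
  fix z assume "z \<in> topspace T"
  then show "f z = g z" using assms(3) unfolding topspace_surface by blast
qed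

end

section \<open>Monotone parametrizations and maps into the compact-open topology\<close>

lemma line_homeomorphic_interval:
  fixes X :: "real set"
  assumes "X = UNIV \<or> (\<exists>a b. a < b \<and> X = {a<..<b})"
  obtains \<theta> where "homeomorphic_map (top_of_set X) euclideanreal \<theta>"
proof -
  have "X homeomorphic (UNIV :: real set)"
    using assms
  proof (elim disjE exE conjE)
    fix a b :: real assume ab: "a < b" "X = {a<..<b}"
    have "X = ball ((a + b) / 2) ((b - a) / 2)"
      unfolding ab(2) ball_eq_greaterThanLessThan by (simp add: field_simps)
    moreover have "0 < (b - a) / 2" using ab(1) by simp
    ultimately show ?thesis using homeomorphic_ball_UNIV by metis
  qed (simp add: homeomorphic_refl)
  then obtain f and g :: "real \<Rightarrow> real" where "homeomorphism X UNIV f g"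
    unfolding homeomorphic_def by blast
  then have "homeomorphic_maps (top_of_set X) euclideanreal f g"
    by (auto simp: homeomorphic_maps_def homeomorphism_def continuous_map_in_subtopology)
  then show ?thesis using that homeomorphic_map_maps by blast
qed

text \<open>A parametrization is increasing or decreasing; conjugation by either preserves increasing maps.\<close>

lemma conjugate_strict_mono:
  fixes \<theta> :: "real \<Rightarrow> real"
  assumes X: "convex X" and \<theta>: "continuous_on X \<theta>" "inj_on \<theta> X"
    and x: "x \<in> X" "x' \<in> X" "u \<in> X" "u' \<in> X" and eq: "\<theta> x < \<theta> x' \<Longrightarrow> \<theta> u < \<theta> u'"
      "\<theta> x' < \<theta> x \<Longrightarrow> \<theta> u' < \<theta> u"
    and less: "x < x'"
  shows "u < u'"
proof -
  have "strict_mono_on X \<theta> \<or> strict_antimono_on X \<theta>"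
    using injective_eq_monotone_map[of X \<theta>] X \<theta> by (simp add: is_interval_convex_1)
  then show ?thesis
  proof
    assume "strict_mono_on X \<theta>"
    then have "\<theta> a < \<theta> b \<longleftrightarrow> a < b" if "a \<in> X" "b \<in> X" for a b
      using that by (rule strict_mono_on_less)
    then show ?thesis using eq(1) x less by blast
  next
    assume anti: "strict_antimono_on X \<theta>"
    have ord: "\<theta> b < \<theta> a \<longleftrightarrow> a < b" if "a \<in> X" "b \<in> X" for a b
      using anti that unfolding monotone_on_def by (metis less_asym linorder_neqE)
    then show ?thesis using eq(2) x less by blast
  qed
qed

text \<open>By the tube lemma, compactness of \<open>K\<close> provides a neighbourhood of
  \<open>x\<close> whose product with \<open>K\<close> stays in the preimage of the open set. This
  direction of the exponential law holds for arbitrary spaces.\<close>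

lemma continuous_map_into_compact_open:
  assumes F: "continuous_map (prod_topology X S) T (\<lambda>(x, s). f x s)"
    and f: "\<And>x. x \<in> topspace X \<Longrightarrow> f x \<in> continuous_maps S T"
  shows "continuous_map X (compact_open_topology S T) f"
  unfolding compact_open_topology_def
proof (rule continuous_on_generated_topo)
  fix U assume "U \<in> {{f \<in> continuous_maps S T. f ` K \<subseteq> U} |K U. compactin S K \<and> openin T U}"
  then obtain K V where KV: "U = {f \<in> continuous_maps S T. f ` K \<subseteq> V}" "compactin S K" "openin T V"
    by blast
  let ?W = "{w \<in> topspace (prod_topology X S). (case w of (x, s) \<Rightarrow> f x s) \<in> V}"
  have W: "openin (prod_topology X S) ?W" using F KV(3) unfolding continuous_map by blast
  show "openin X (f -` U \<inter> topspace X)"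
  proof (subst openin_subopen, intro ballI)
    fix x assume x: "x \<in> f -` U \<inter> topspace X"
    have sub: "{x} \<times> K \<subseteq> ?W" using x compactin_subset_topspace[OF KV(2)] unfolding KV(1) by auto
    have "x \<in> topspace X" using x by blast
    from tube_lemma_right[OF W KV(2) this sub]
    obtain N M where N: "openin X N" "x \<in> N" "K \<subseteq> M" "N \<times> M \<subseteq> ?W"
      by (elim exE conjE) (rule that)
    have "N \<subseteq> f -` U \<inter> topspace X"
    proof
      fix y assume y: "y \<in> N"
      then have "y \<in> topspace X" using openin_subset[OF N(1)] by blast
      moreover have "f y s \<in> V" if "s \<in> K" for s
      proof -
        have "(y, s) \<in> ?W" by (rule subsetD[OF N(4) SigmaI[OF y subsetD[OF N(3) that]]])
        then show ?thesis by simp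
      qed
      then have "f y ` K \<subseteq> V" by blast
      ultimately show "y \<in> f -` U \<inter> topspace X" using f unfolding KV(1) by simp
    qed
    then show "\<exists>N. openin X N \<and> x \<in> N \<and> N \<subseteq> f -` U \<inter> topspace X" using N by blast
  qed
next
  have "continuous_maps S T \<in> {{f \<in> continuous_maps S T. f ` K \<subseteq> U} |K U. compactin S K \<and> openin T U}"
    by (intro CollectI exI[of _ "{}"]) auto
  then show "f ` topspace X \<subseteq> \<Union> {{f \<in> continuous_maps S T. f ` K \<subseteq> U} |K U. compactin S K \<and> openin T U}"
    using f by blast
qed

context reduced_stripped
begin

section \<open>Orientation of leaves\<close>

text \<open>Lines and boundary intervals are closed in the strip and the chart is injective on each,
  so the closed chart embeds them; the abscissa becomes a parameter on the leaf.\<close>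

lemma leaf_parametrization:
  assumes \<alpha>: "\<alpha> \<in> A" and L: "X \<times> {y} \<in> model_leaves (S \<alpha>)" and ne: "X \<noteq> {}"
  shows "homeomorphic_map (top_of_set X) (subtopology T (\<xi> \<alpha> ` (X \<times> {y}))) (\<lambda>x. \<xi> \<alpha> (x, y))"
    "X = UNIV \<or> (\<exists>a b. a < b \<and> X = {a<..<b})"
proof -
  note mod = model[OF \<alpha>]
  have LS: "X \<times> {y} \<subseteq> S \<alpha>" using model_leaves_subset[OF mod L] .
  have emb: "homeomorphic_map (top_of_set (X \<times> {y})) (subtopology T (\<xi> \<alpha> ` (X \<times> {y}))) (\<xi> \<alpha>)
      \<and> (X = UNIV \<or> (\<exists>a b. a < b \<and> X = {a<..<b}))"
  proof (cases "X \<times> {y} \<in> boundary_intervals (S \<alpha>)")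
    case True
    obtain a b e where "a < b" "X \<times> {y} = {a<..<b} \<times> {e}"
      using boundary_intervals_cases[OF mod True] by metis
    then have "X = {a<..<b}" using ne by (auto simp: times_eq_iff)
    then show ?thesis
      using embedding_chart_closed[OF \<alpha> boundary_interval_closedin(1)[OF mod True] chart_inj_interval[OF True]] \<open>a < b\<close>
      by blast
  next
    case False
    then obtain t where t: "t \<in> {-1<..<1}" "X \<times> {y} = UNIV \<times> {t}" using L
      unfolding model_leaves_def by blast
    then have X: "X = UNIV" "y = t" using ne by (auto simp: times_eq_iff)
    have "closedin (top_of_set (S \<alpha>)) (X \<times> {y})"
      using LS unfolding X by (intro closed_subset closed_Times) auto
    moreover have "X \<times> {y} \<subseteq> open_strip" using t by auto
    then have "inj_on (\<xi> \<alpha>) (X \<times> {y})" by (rule inj_on_subset[OF inj_chart_interior])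
    ultimately show ?thesis using embedding_chart_closed[OF \<alpha>] X by blast
  qed
  then show "X = UNIV \<or> (\<exists>a b. a < b \<and> X = {a<..<b})" by blast
  have "homeomorphic_maps (top_of_set X) (top_of_set (X \<times> {y})) (\<lambda>x. (x, y)) fst"
    unfolding homeomorphic_maps_def by (auto intro!: continuous_intros)
  then have "homeomorphic_map (top_of_set X) (top_of_set (X \<times> {y})) (\<lambda>x. (x, y))"
    using homeomorphic_map_maps by blast
  then show "homeomorphic_map (top_of_set X) (subtopology T (\<xi> \<alpha> ` (X \<times> {y}))) (\<lambda>x. \<xi> \<alpha> (x, y))"
    using homeomorphic_map_compose[OF _ conjunct1[OF emb]] by (auto simp: comp_def)
qed

text \<open>\<open>preserves_orientation\<close> speaks of some parametrization by the line, the
  right-hand side of the abscissa. The change of parameter is continuous and injective on an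
  interval, hence monotone, and both directions follow by conjugation.\<close>

lemma preserves_orientation_iff:
  assumes \<alpha>: "\<alpha> \<in> A" and L: "X \<times> {y} \<in> model_leaves (S \<alpha>)" and ne: "X \<noteq> {}"
    and f: "f ` X = X" "\<And>x. x \<in> X \<Longrightarrow> h (\<xi> \<alpha> (x, y)) = \<xi> \<alpha> (f x, y)"
  shows "preserves_orientation T h (\<xi> \<alpha> ` (X \<times> {y})) \<longleftrightarrow> strict_mono_on X f"
proof -
  let ?w = "\<xi> \<alpha> ` (X \<times> {y})"
  let ?c = "\<lambda>x. \<xi> \<alpha> (x, y)"
  note P = leaf_parametrization[OF \<alpha> L ne]
  have X: "convex X" using P(2) by auto
  have fX: "f x \<in> X" if "x \<in> X" for x using f(1) that by blast
  have w_eq: "?w = ?c ` X" by auto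
  have c_inj: "inj_on ?c X" using homeomorphic_imp_injective_map[OF P(1)] by simp
  show ?thesis
  proof
    assume "preserves_orientation T h ?w"
    then obtain f0 \<phi> where f0: "homeomorphic_map euclideanreal (subtopology T ?w) f0"
      "strict_mono (\<phi> :: real \<Rightarrow> real)"
      "\<forall>s. h (f0 s) = f0 (\<phi> s)" unfolding preserves_orientation_def by blast
    then obtain k where k: "homeomorphic_maps euclideanreal (subtopology T ?w) f0 k"
      using homeomorphic_map_maps by blast
    have kf: "k (f0 s) = s" for s using k unfolding homeomorphic_maps_def by simp
    have wT: "topspace (subtopology T ?w) = ?w"
      using leaf_subset[of ?w] L \<alpha> unfolding leaves_def by auto
    have fk: "f0 (k z) = z" if "z \<in> ?w" for z using k that wT
      unfolding homeomorphic_maps_def by metis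
    \<comment> \<open>The change from the abscissa to the given parametrization; it conjugates
      \<open>f\<close> to \<phi>.\<close>
    define \<theta> where "\<theta> = k \<circ> ?c"
    have "continuous_map (top_of_set X) euclideanreal \<theta>"
      unfolding \<theta>_def using homeomorphic_imp_continuous_map[OF P(1)] k
        unfolding homeomorphic_maps_def
      by (blast intro: continuous_map_compose)
    then have \<theta>c: "continuous_on X \<theta>" by simp
    have \<theta>i: "inj_on \<theta> X"
    proof (rule inj_onI)
      fix x x' assume x: "x \<in> X" "x' \<in> X" "\<theta> x = \<theta> x'"
      then have "f0 (k (?c x)) = f0 (k (?c x'))" unfolding \<theta>_def by simp
      then have "?c x = ?c x'" using fk x unfolding w_eq by simp
      then show "x = x'" using inj_onD[OF c_inj] x by blast
    qed
    have \<theta>f: "\<theta> (f x) = \<phi> (\<theta> x)" if x: "x \<in> X" for x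
    proof -
      have "?c (f x) = h (f0 (\<theta> x))" using f(2)[OF x] fk[of "?c x"] x unfolding \<theta>_def by simp
      then have "?c (f x) = f0 (\<phi> (\<theta> x))" using f0(3) by simp
      then show ?thesis using kf unfolding \<theta>_def by simp
    qed
    show "strict_mono_on X f"
    proof (rule strict_mono_onI)
      fix x x' assume x: "x \<in> X" "x' \<in> X" "x < x'"
      show "f x < f x'"
        by (rule conjugate_strict_mono[OF X \<theta>c \<theta>i x(1,2) fX[OF x(1)] fX[OF x(2)] _ _ x(3)])
          (simp_all add: \<theta>f x strict_monoD[OF f0(2)])
    qed
  next
    assume mono: "strict_mono_on X f"
    obtain \<theta> where \<theta>: "homeomorphic_map (top_of_set X) euclideanreal \<theta>"
      using line_homeomorphic_interval[OF P(2)] .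
    then obtain \<psi> where \<psi>: "homeomorphic_maps (top_of_set X) euclideanreal \<theta> \<psi>"
      using homeomorphic_map_maps by blast
    have \<psi>': "homeomorphic_map euclideanreal (top_of_set X) \<psi>"
      using \<psi> homeomorphic_maps_map homeomorphic_maps_sym by blast
    have \<psi>X: "\<psi> s \<in> X" for s using homeomorphic_imp_surjective_map[OF \<psi>'] by auto
    have \<psi>\<theta>: "\<psi> (\<theta> x) = x" if "x \<in> X" for x using \<psi> that unfolding homeomorphic_maps_def by auto
    have \<theta>\<psi>: "\<theta> (\<psi> s) = s" for s using \<psi> unfolding homeomorphic_maps_def by auto
    define \<phi> where "\<phi> = \<theta> \<circ> f \<circ> \<psi>"
    have "strict_mono \<phi>"
    proof (rule strict_monoI)
      fix s s' :: real assume s: "s < s'"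
      have inv: "inj_on \<psi> UNIV" "continuous_on UNIV \<psi>"
        using homeomorphic_imp_injective_map[OF \<psi>'] homeomorphic_imp_continuous_map[OF \<psi>']
        by (simp_all add: continuous_map_in_subtopology)
      show "\<phi> s < \<phi> s'"
        by (rule conjugate_strict_mono[OF convex_UNIV inv(2,1) UNIV_I UNIV_I UNIV_I UNIV_I _ _ s])
          (simp_all add: \<phi>_def \<psi>\<theta> fX \<psi>X strict_mono_onD[OF mono])
    qed
    moreover have "homeomorphic_map euclideanreal (subtopology T ?w) (?c \<circ> \<psi>)"
      using \<psi>' P(1) by (rule homeomorphic_map_compose)
    moreover have "h ((?c \<circ> \<psi>) s) = (?c \<circ> \<psi>) (\<phi> s)" for s
      using f(2)[OF \<psi>X] \<psi>\<theta>[OF fX[OF \<psi>X]] unfolding \<phi>_def by simp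
    moreover have "h ` ?w = ?w"
    proof -
      have "h ` ?w = (\<lambda>x. ?c (f x)) ` X" unfolding w_eq image_image
        using f(2) by (intro image_cong) auto
      also have "\<dots> = ?c ` f ` X" by (simp only: image_image)
      finally show ?thesis unfolding f(1) w_eq .
    qed
    ultimately show "preserves_orientation T h ?w" unfolding preserves_orientation_def by blast
  qed
qed

lemma liftable_leaf:
  assumes h: "h \<in> liftable" and \<alpha>: "\<alpha> \<in> A" and L: "X \<times> {y} \<in> model_leaves (S \<alpha>)" and ne: "X \<noteq> {}"
    and y: "\<And>x. x \<in> X \<Longrightarrow> snd (lifting Z h \<alpha> (x, y)) = y"
  shows "h ` \<xi> \<alpha> ` (X \<times> {y}) = \<xi> \<alpha> ` (X \<times> {y}) \<and> preserves_orientation T h (\<xi> \<alpha> ` (X \<times> {y}))"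
proof -
  let ?f = "\<lambda>x. fst (lifting Z h \<alpha> (x, y))"
  have g: "strict_mono_on X ?f" "?f ` X = X"
    using liftableD(3)[OF h \<alpha>] L unfolding good_lift_def by blast+
  have "h (\<xi> \<alpha> (x, y)) = \<xi> \<alpha> (?f x, y)" if x: "x \<in> X" for x
  proof -
    have "(x, y) \<in> S \<alpha>" using model_leaves_subset[OF model[OF \<alpha>] L] x by blast
    then have "h (\<xi> \<alpha> (x, y)) = \<xi> \<alpha> (lifting Z h \<alpha> (x, y))" by (rule liftableD(4)[OF h \<alpha>])
    also have "lifting Z h \<alpha> (x, y) = (?f x, y)" using y[OF x] by (simp add: prod_eq_iff)
    finally show ?thesis .
  qed
  then have "preserves_orientation T h (\<xi> \<alpha> ` (X \<times> {y}))"
    using preserves_orientation_iff[OF \<alpha> L ne g(2)] g(1) by blast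
  then show ?thesis unfolding preserves_orientation_def by blast
qed

text \<open>The conditions of the theorem describe \<open>liftable\<close>:
  \<open>subset_Sigma_leaves_iff\<close> turns (c) into invariance of the boundary intervals, from
  which \<open>lifting_good\<close> starts. Conversely the height map of a good lift is a
  homeomorphism by compactness of [-1, 1].\<close>

lemma liftable_iff:
  assumes h: "h \<in> Homeo Z"
  shows "h \<in> liftable \<longleftrightarrow>
    (\<forall>\<alpha>\<in>strip_index Z. h ` surface_strip Z \<alpha> = surface_strip Z \<alpha>) \<and>
    (\<forall>\<alpha>\<in>strip_index Z. \<exists>l m. strip_coordinates (strip Z \<alpha>) (lifting Z h \<alpha>) l m \<and>
       strict_mono_on {-1..1} m \<and> (\<forall>y\<in>{-1<..<1}. strict_mono (\<lambda>x. l (x, y)))) \<and>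
    (\<forall>w\<in>leaves Z. w \<subseteq> Sigma_leaves Z \<longrightarrow>
       h ` w = w \<and> preserves_orientation (surface Z) h w)"
  (is "_ \<longleftrightarrow> ?a \<and> ?b \<and> ?c")
proof
  assume l: "h \<in> liftable"
  note hD = liftableD[OF l]
  have ?b
  proof
    fix \<alpha> assume \<alpha>: "\<alpha> \<in> A"
    let ?g = "lifting Z h \<alpha>"
    note gl = hD(3)[OF \<alpha>]
    have gc: "continuous_on (S \<alpha>) ?g" using gl unfolding good_lift_def by blast
    obtain m where m: "continuous_on {-1..1} m" "strict_mono_on {-1..1} m" "m ` {-1..1} = {-1..1}"
      "\<forall>p\<in>S \<alpha>. snd (?g p) = m (snd p)"
      using gl unfolding good_lift_def by (elim conjE exE) (rule that)
    have "homeomorphic_map (top_of_set {-1..1}) (top_of_set {-1..1}) m"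
      using m(1,3) strict_mono_on_imp_inj_on[OF m(2)]
      by (intro continuous_imp_homeomorphic_map)
        (auto simp: compact_space_subtopology Hausdorff_space_subtopology)
    moreover have "continuous_on (S \<alpha>) (fst \<circ> ?g)"
      unfolding comp_def by (intro continuous_intros gc)
    moreover have "\<forall>(x, y)\<in>S \<alpha>. ?g (x, y) = ((fst \<circ> ?g) (x, y), m y)"
      using m(4) by (auto simp: prod_eq_iff)
    ultimately have "strip_coordinates (S \<alpha>) ?g (fst \<circ> ?g) m"
      unfolding strip_coordinates_def by blast
    moreover have "strict_mono (\<lambda>x. (fst \<circ> ?g) (x, y))" if "y \<in> {-1<..<1}" for y
    proof -
      have "UNIV \<times> {y} \<in> model_leaves (S \<alpha>)" using that unfolding model_leaves_def by blast
      then show ?thesis using gl unfolding good_lift_def by auto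
    qed
    ultimately show "\<exists>l m. strip_coordinates (S \<alpha>) ?g l m \<and> strict_mono_on {-1..1} m \<and> (\<forall>y\<in>{-1<..<1}. strict_mono (\<lambda>x. l (x, y)))"
      using m(2) by blast
  qed
  moreover have ?c
  proof (intro ballI impI)
    fix w assume w: "w \<in> leaves Z" "w \<subseteq> Sigma_leaves Z"
    then obtain \<alpha> J where \<alpha>: "\<alpha> \<in> A" and J: "J \<in> boundary_intervals (S \<alpha>)" "w = \<xi> \<alpha> ` J"
      using subset_Sigma_leaves_iff by blast
    obtain a b e where ab: "a < b" "J = {a<..<b} \<times> {e}" "J \<subseteq> S \<alpha>"
      using boundary_intervals_cases[OF model[OF \<alpha>] J(1)] by metis
    have L: "J \<in> model_leaves (S \<alpha>)" using J(1) unfolding model_leaves_def by blast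
    have "lifting Z h \<alpha> ` J = J" using good_lift_leaf(2)[OF model[OF \<alpha>] hD(3)[OF \<alpha>] L J(1)] .
    then have "snd (lifting Z h \<alpha> (x, e)) = e" if "x \<in> {a<..<b}" for x
    proof -
      have "lifting Z h \<alpha> (x, e) \<in> J" using \<open>lifting Z h \<alpha> ` J = J\<close> that ab(2) by blast
      then show ?thesis using ab(2) by auto
    qed
    then show "h ` w = w \<and> preserves_orientation T h w"
      using liftable_leaf[OF l \<alpha>, of "{a<..<b}" e] L ab(1) unfolding J(2) ab(2) by simp
  qed
  ultimately show "?a \<and> ?b \<and> ?c" using hD(2) by blast
next
  assume c: "?a \<and> ?b \<and> ?c"
  have "good_lift (S \<alpha>) (lifting Z h \<alpha>)" if \<alpha>: "\<alpha> \<in> A" for \<alpha>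
  proof -
    from bspec[OF conjunct1[OF conjunct2[OF c]] \<alpha>]
    obtain l m where lm: "strip_coordinates (S \<alpha>) (lifting Z h \<alpha>) l m" "strict_mono_on {-1..1} m"
      "\<forall>y\<in>{-1<..<1}. strict_mono (\<lambda>x. l (x, y))"
      by (elim exE conjE) (rule that)
    have invariant: "h ` \<xi> \<alpha> ` J = \<xi> \<alpha> ` J" if J: "J \<in> boundary_intervals (S \<alpha>)" for J
    proof -
      have "\<xi> \<alpha> ` J \<subseteq> Sigma_leaves Z"
        using subset_Sigma_leaves_iff[OF interval_leaf[OF \<alpha> J]] \<alpha> J by blast
      then show ?thesis using conjunct2[OF conjunct2[OF c]] interval_leaf[OF \<alpha> J] by simp
    qed
    show ?thesis by (rule lifting_good[OF h conjunct1[OF c] \<alpha> lm(1,2) bspec[OF lm(3)] invariant])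
  qed
  then show "h \<in> liftable" unfolding liftable_def using h conjunct1[OF c] by blast
qed

section \<open>The subgroup fixing every leaf\<close>

text \<open>A map fixing every leaf keeps each strip, a union of leaves. Its lifting preserves
  heights over the open strip by injectivity of the chart, and on the boundary by density.
  Orientation on internal leaves then supplies the monotonicity that \<open>lifting_good\<close>
  asks for, with the identity as \<open>m\<close>.\<close>

lemma Homeo0'_iff:
  "h \<in> Homeo0' Z \<longleftrightarrow> h \<in> liftable \<and> (\<forall>\<alpha>\<in>A. \<forall>p\<in>S \<alpha>. snd (lifting Z h \<alpha> p) = snd p)"
proof
  assume "h \<in> liftable \<and> (\<forall>\<alpha>\<in>A. \<forall>p\<in>S \<alpha>. snd (lifting Z h \<alpha> p) = snd p)"
  then have h: "h \<in> liftable" and y: "\<And>\<alpha> p. \<alpha> \<in> A \<Longrightarrow> p \<in> S \<alpha> \<Longrightarrow> snd (lifting Z h \<alpha> p) = snd p"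
    by blast+
  have "h ` w = w \<and> preserves_orientation T h w" if w: "w \<in> leaves Z" for w
  proof -
    obtain \<alpha> L where L: "\<alpha> \<in> A" "L \<in> model_leaves (S \<alpha>)" "w = \<xi> \<alpha> ` L" using w
      unfolding leaves_def by blast
    obtain X y where X: "L = X \<times> {y}" "X \<noteq> {}" "X \<times> {y} \<subseteq> S \<alpha>"
      using model_leaves_cases[OF model[OF L(1)] L(2)] by metis
    have "snd (lifting Z h \<alpha> (x, y)) = y" if "x \<in> X" for x
      using y[OF L(1), of "(x, y)"] X(3) that by auto
    then show ?thesis using liftable_leaf[OF h L(1), of X y] L(2,3) X(1,2) by simp
  qed
  then show "h \<in> Homeo0' Z" unfolding Homeo0'_def using liftableD(1)[OF h] by blast
next
  assume "h \<in> Homeo0' Z"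
  then have h: "h \<in> Homeo Z" and fix_leaf: "\<And>w. w \<in> leaves Z \<Longrightarrow> h ` w = w" and
    po: "\<And>w. w \<in> leaves Z \<Longrightarrow> preserves_orientation T h w" unfolding Homeo0'_def by blast+
  have inv: "strips_invariant h"
  proof
    fix \<alpha> assume \<alpha>: "\<alpha> \<in> A"
    have "S \<alpha> = \<Union> (model_leaves (S \<alpha>))"
    proof (intro equalityI subsetI)
      fix p assume "p \<in> S \<alpha>"
      then obtain X where "X \<times> {snd p} \<in> model_leaves (S \<alpha>)" "fst p \<in> X"
        using model_leaf_of_point[OF model[OF \<alpha>], of "fst p" "snd p"] by auto
      then show "p \<in> \<Union> (model_leaves (S \<alpha>))"
        by (intro UnionI[of "X \<times> {snd p}"]) (auto simp: mem_Times_iff)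
    qed (use model_leaves_subset[OF model[OF \<alpha>]] in blast)
    then have eq: "surface_strip Z \<alpha> = (\<Union>L\<in>model_leaves (S \<alpha>). \<xi> \<alpha> ` L)"
      unfolding surface_strip_def by (metis image_Union)
    have "h ` surface_strip Z \<alpha> = (\<Union>L\<in>model_leaves (S \<alpha>). h ` \<xi> \<alpha> ` L)" unfolding eq by blast
    also have "\<dots> = (\<Union>L\<in>model_leaves (S \<alpha>). \<xi> \<alpha> ` L)"
    proof (rule SUP_cong[OF refl])
      fix L assume "L \<in> model_leaves (S \<alpha>)"
      then have "\<xi> \<alpha> ` L \<in> leaves Z" using \<alpha> unfolding leaves_def by blast
      then show "h ` \<xi> \<alpha> ` L = \<xi> \<alpha> ` L" by (rule fix_leaf)
    qed
    finally show "h ` surface_strip Z \<alpha> = surface_strip Z \<alpha>" unfolding eq .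
  qed
  have snd_eq: "snd (lifting Z h \<alpha> p) = snd p" if \<alpha>: "\<alpha> \<in> A" and p: "p \<in> S \<alpha>" for \<alpha> p
  proof -
    note L = liftingD[OF h \<alpha> inv]
    \<comment> \<open>The dummy coordinate 0 gives the height functions values in the plane, as
      \<open>continuous_eq_on_strip\<close> is stated for such maps.\<close>
    have "(0 :: real, snd (lifting Z h \<alpha> p)) = (0, snd p)"
    proof (rule continuous_eq_on_strip[OF \<alpha> _ _ _ p])
      show "continuous_on (S \<alpha>) (\<lambda>p. (0 :: real, snd (lifting Z h \<alpha> p)))"
        by (intro continuous_intros L(1))
      show "continuous_on (S \<alpha>) (\<lambda>p. (0 :: real, snd p))" by (intro continuous_intros)
      fix r assume r: "r \<in> open_strip"
      then have rS: "r \<in> S \<alpha>" using open_strip_subset[OF model[OF \<alpha>]] by (rule subsetD[rotated])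
      have bds: "-1 < snd r" "snd r < 1" using r by auto
      let ?w = "\<xi> \<alpha> ` (UNIV \<times> {snd r})"
      have "r \<in> UNIV \<times> {snd r}" by (simp add: mem_Times_iff)
      then have "h (\<xi> \<alpha> r) \<in> h ` ?w" by (intro imageI)
      then have "h (\<xi> \<alpha> r) \<in> ?w" unfolding fix_leaf[OF internal_leaf[OF \<alpha> bds]] .
      then obtain x where x: "\<xi> \<alpha> (lifting Z h \<alpha> r) = \<xi> \<alpha> (x, snd r)" using L(4)[OF rS] by auto
      have "lifting Z h \<alpha> r \<in> open_strip" using L(5)[OF rS] r by blast
      then have "(x, snd r) = lifting Z h \<alpha> r" using chart_eq_interior[OF x] by simp
      then have "snd (lifting Z h \<alpha> r) = snd r" by (metis snd_conv)
      then show "(0 :: real, snd (lifting Z h \<alpha> r)) = (0, snd r)" by simp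
    qed
    then show ?thesis by simp
  qed
  have "good_lift (S \<alpha>) (lifting Z h \<alpha>)" if \<alpha>: "\<alpha> \<in> A" for \<alpha>
  proof (rule lifting_good[OF h inv \<alpha>, of "fst \<circ> lifting Z h \<alpha>" "\<lambda>y. y"])
    note L = liftingD[OF h \<alpha> inv]
    have "homeomorphic_map (top_of_set {-1..1}) (top_of_set {-1..1}) (\<lambda>y :: real. y)"
      using homeomorphic_map_id[of "top_of_set {-1..1::real}" "top_of_set {-1..1}"]
        by (simp add: id_def)
    moreover have "continuous_on (S \<alpha>) (fst \<circ> lifting Z h \<alpha>)"
      unfolding comp_def by (intro continuous_intros L(1))
    moreover have "\<forall>(x, y)\<in>S \<alpha>. lifting Z h \<alpha> (x, y) = ((fst \<circ> lifting Z h \<alpha>) (x, y), y)"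
      using snd_eq[OF \<alpha>] by (auto simp: prod_eq_iff)
    ultimately show "strip_coordinates (S \<alpha>) (lifting Z h \<alpha>) (fst \<circ> lifting Z h \<alpha>) (\<lambda>y. y)"
      unfolding strip_coordinates_def by blast
    show "strict_mono_on {-1..1::real} (\<lambda>y. y)" by (simp add: strict_mono_on_def)
    show "h ` \<xi> \<alpha> ` J = \<xi> \<alpha> ` J" if "J \<in> boundary_intervals (S \<alpha>)" for J
      using fix_leaf interval_leaf[OF \<alpha> that] by blast
    fix y :: real assume y: "y \<in> {-1<..<1}"
    let ?f = "\<lambda>x. fst (lifting Z h \<alpha> (x, y))"
    let ?w = "\<xi> \<alpha> ` (UNIV \<times> {y})"
    have w: "?w \<in> leaves Z" using internal_leaf[OF \<alpha>] y by simp
    have line: "UNIV \<times> {y} \<in> model_leaves (S \<alpha>)" using y unfolding model_leaves_def by blast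
    have yS: "(x, y) \<in> S \<alpha>" for x using model_leaves_subset[OF model[OF \<alpha>] line] by blast
    have gf: "lifting Z h \<alpha> (x, y) = (?f x, y)" for x
      using snd_eq[OF \<alpha> yS[of x]] by (simp add: prod_eq_iff)
    have hf: "h (\<xi> \<alpha> (x, y)) = \<xi> \<alpha> (?f x, y)" for x using L(4)[OF yS[of x]] gf[of x] by simp
    have "u \<in> ?f ` UNIV" for u
    proof -
      have "\<xi> \<alpha> (u, y) \<in> h ` ?w" unfolding fix_leaf[OF w] by blast
      then obtain x where "\<xi> \<alpha> (u, y) = \<xi> \<alpha> (?f x, y)" using hf by auto
      then have "(?f x, y) = (u, y)" using chart_eq_interior[of \<alpha> "(u, y)"] y by auto
      then show ?thesis by auto
    qed
    then have onto: "?f ` UNIV = UNIV" by blast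
    show "strict_mono (\<lambda>x. (fst \<circ> lifting Z h \<alpha>) (x, y))"
      using preserves_orientation_iff[OF \<alpha> line _ onto, of h] hf po[OF w] by simp
  qed
  then show "h \<in> liftable \<and> (\<forall>\<alpha>\<in>A. \<forall>p\<in>S \<alpha>. snd (lifting Z h \<alpha> p) = snd p)"
    unfolding liftable_def using h inv snd_eq by blast
qed

section \<open>The deformation\<close>

lemma deform_map_start:
  assumes h: "h \<in> liftable" shows "deform_map 0 0 h = h"
proof (rule surface_map_eqI)
  have 01: "0 \<in> {0..1::real}" by simp
  show "deform_map 0 0 h \<in> extensional (topspace T)" "h \<in> extensional (topspace T)"
    using HomeoD(1) liftableD(1) deform_map(1)[OF h 01 01] h by blast+
  show "deform_map 0 0 h (\<xi> \<alpha> p) = h (\<xi> \<alpha> p)" if "\<alpha> \<in> A" "p \<in> S \<alpha>" for \<alpha> p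
    using deform_map(3)[OF h 01 01 that] liftableD(4)[OF h that] by (simp add: deform_def)
qed

lemma deform_map_end:
  assumes h: "h \<in> liftable" shows "deform_map 1 1 h = restrict (\<lambda>z. z) (topspace T)"
proof (rule surface_map_eqI)
  have 1: "1 \<in> {0..1::real}" by simp
  show "deform_map 1 1 h \<in> extensional (topspace T)"
    using HomeoD(1) liftableD(1) deform_map(1)[OF h 1 1] by blast
  show "deform_map 1 1 h (\<xi> \<alpha> p) = restrict (\<lambda>z. z) (topspace T) (\<xi> \<alpha> p)" if "\<alpha> \<in> A" "p \<in> S \<alpha>"
    for \<alpha> p
    using deform_map(3)[OF h 1 1 that] chart_in_topspace[OF that] by (simp add: deform_def)
qed simp

lemma deform_map_Homeo0'_fixed:
  assumes h: "h \<in> Homeo0' Z" and t: "t \<in> {0..1}" shows "deform_map 0 t h = h"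
proof (rule surface_map_eqI)
  have l: "h \<in> liftable" and y: "\<And>\<alpha> p. \<alpha> \<in> A \<Longrightarrow> p \<in> S \<alpha> \<Longrightarrow> snd (lifting Z h \<alpha> p) = snd p"
    using h unfolding Homeo0'_iff by blast+
  have 0: "0 \<in> {0..1::real}" by simp
  show "deform_map 0 t h \<in> extensional (topspace T)" "h \<in> extensional (topspace T)"
    using HomeoD(1) liftableD(1) deform_map(1)[OF l 0 t] l by blast+
  show "deform_map 0 t h (\<xi> \<alpha> p) = h (\<xi> \<alpha> p)" if \<alpha>: "\<alpha> \<in> A" "p \<in> S \<alpha>" for \<alpha> p
  proof -
    have "deform 0 t (lifting Z h \<alpha>) p = lifting Z h \<alpha> p"
      unfolding deform_def using y[OF \<alpha>] by (simp add: prod_eq_iff algebra_simps)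
    then show ?thesis using deform_map(3)[OF l 0 t \<alpha>] liftableD(4)[OF l \<alpha>] by simp
  qed
qed

lemma deform_map_Homeo0':
  assumes h: "h \<in> liftable" shows "deform_map 0 1 h \<in> Homeo0' Z"
proof -
  have 01: "0 \<in> {0..1::real}" "1 \<in> {0..1::real}" by simp_all
  show ?thesis unfolding Homeo0'_iff using deform_map(1,2)[OF h 01] by (simp add: deform_def)
qed

abbreviation "liftable_topology \<equiv> subtopology (Homeo_topology Z) liftable"

lemma topspace_liftable: "topspace liftable_topology = liftable"
  using liftableD(1) by (auto simp: topspace_Homeo_topology)

text \<open>Continuity is proved once, jointly on the square of both parameters; the retracting and
  the contracting homotopy are restrictions to segments in it. The compact-open topology reduces the
  claim to the product with the surface, and \<open>continuous_map_prod_surface\<close> to the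
  product with a strip, where a formula in the lifting is available.\<close>

lemma continuous_map_deform_map:
  "continuous_map (prod_topology (top_of_set ({0..1} \<times> {0..1})) liftable_topology) liftable_topology
     (\<lambda>(st, h). deform_map (fst st) (snd st) h)"
  (is "continuous_map ?X _ ?F")
proof -
  have X: "topspace ?X = ({0..1} \<times> {0..1}) \<times> liftable"
    using topspace_liftable by (simp del: topspace_subtopology)
  have F: "?F x \<in> liftable" if "x \<in> topspace ?X" for x
  proof -
    obtain s t h where x: "x = ((s, t), h)" by (metis surj_pair)
    then show ?thesis using that deform_map(1)[of h s t] unfolding X by simp
  qed
  have "continuous_map (prod_topology ?X T) T (\<lambda>(x, z). ?F x z)"
  proof (rule continuous_map_prod_surface)
    fix \<alpha> assume \<alpha>: "\<alpha> \<in> A"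
    let ?Y = "prod_topology ?X (top_of_set (S \<alpha>))"
    let ?g = "\<lambda>w. lifting Z (snd (fst w)) \<alpha> (snd w)"
    have Y: "topspace ?Y = (({0..1} \<times> {0..1}) \<times> liftable) \<times> S \<alpha>"
      using X by (simp only: topspace_prod_topology topspace_euclidean_subtopology)
    have fst: "continuous_map ?Y ?X fst" by (rule continuous_map_fst)
    have "continuous_map liftable_topology (Homeo_topology Z) (\<lambda>h. h)"
      using continuous_map_from_subtopology[OF continuous_map_id] by (simp add: id_def)
    moreover have "(\<lambda>h. h) \<in> topspace liftable_topology \<rightarrow> Collect strips_invariant"
      unfolding topspace_liftable using liftableD(2) by blast
    ultimately have incl: "continuous_map liftable_topology
        (subtopology (Homeo_topology Z) (Collect strips_invariant)) (\<lambda>h. h)"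
      by (simp add: continuous_map_in_subtopology del: topspace_subtopology)
    have "continuous_map ?Y liftable_topology (snd \<circ> fst)"
      using fst continuous_map_snd by (rule continuous_map_compose)
    from continuous_map_compose[OF this incl]
    have "continuous_map ?Y (subtopology (Homeo_topology Z) (Collect strips_invariant)) (snd \<circ> fst)"
      by (simp add: comp_def)
    then have "continuous_map ?Y (prod_topology (subtopology (Homeo_topology Z) (Collect strips_invariant)) (top_of_set (S \<alpha>)))
        (\<lambda>w. ((snd \<circ> fst) w, snd w))"
      using continuous_map_snd by (rule continuous_map_pairedI)
    from continuous_map_compose[OF this continuous_map_lifting[OF \<alpha>]]
    have g: "continuous_map ?Y euclidean ?g"
      by (simp add: comp_def case_prod_unfold continuous_map_in_subtopology)
    have st: "continuous_map ?Y euclidean (fst \<circ> fst)"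
      using continuous_map_compose[OF fst continuous_map_fst]
        by (simp add: continuous_map_in_subtopology)
    have p: "continuous_map ?Y euclidean snd"
      using continuous_map_snd[of ?X "top_of_set (S \<alpha>)"]
        by (simp add: continuous_map_in_subtopology)
    have triple: "continuous_map ?Y euclidean (\<lambda>w. ((fst \<circ> fst) w, ?g w, snd w))"
      using continuous_map_pairedI[OF st continuous_map_pairedI[OF g p]] by simp
    \<comment> \<open>The deformation is a polynomial in the parameters, the value of the lifting
      and the point; this separates its continuity from that of the lifting.\<close>
    let ?I = "\<lambda>v :: (real \<times> real) \<times> (real \<times> real) \<times> (real \<times> real).
        ((1 - fst (fst v)) * fst (fst (snd v)) + fst (fst v) * fst (snd (snd v)),
         (1 - snd (fst v)) * snd (fst (snd v)) + snd (fst v) * snd (snd (snd v)))"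
    have "continuous_on UNIV ?I" by (intro continuous_intros)
    then have "continuous_map euclidean euclidean ?I" by simp
    from continuous_map_compose[OF triple this]
    have "continuous_map ?Y euclidean (\<lambda>w. deform (fst (fst (fst w))) (snd (fst (fst w))) (lifting Z (snd (fst w)) \<alpha>) (snd w))"
      by (simp add: deform_def comp_def)
    moreover have into: "deform (fst (fst (fst w))) (snd (fst (fst w))) (lifting Z (snd (fst w)) \<alpha>) (snd w) \<in> S \<alpha>"
      if "w \<in> topspace ?Y" for w
    proof -
      obtain s t h p where w: "w = (((s, t), h), p)" by (metis surj_pair)
      have *: "h \<in> liftable" "s \<in> {0..1}" "t \<in> {0..1}" "p \<in> S \<alpha>" using that unfolding Y w by auto
      have "deform s t (lifting Z h \<alpha>) ` S \<alpha> = S \<alpha>"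
        using good_lift_onto[OF model[OF \<alpha>] good_lift_deform[OF model[OF \<alpha>] liftableD(3)[OF *(1) \<alpha>] *(2,3)]] .
      then show ?thesis unfolding w using *(4) by auto
    qed
    ultimately have "continuous_map ?Y (top_of_set (S \<alpha>)) (\<lambda>w. deform (fst (fst (fst w))) (snd (fst (fst w))) (lifting Z (snd (fst w)) \<alpha>) (snd w))"
      by (auto simp: continuous_map_in_subtopology)
    from continuous_map_compose[OF this continuous_chart[OF \<alpha>]]
    show "continuous_map ?Y T (\<lambda>(x, p). case (x, \<xi> \<alpha> p) of (x, z) \<Rightarrow> ?F x z)"
    proof (rule continuous_map_eq)
      fix w assume "w \<in> topspace ?Y"
      then obtain s t h p where w: "w = (((s, t), h), p)" and *: "h \<in> liftable" "s \<in> {0..1}"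
        "t \<in> {0..1}" "p \<in> S \<alpha>"
        unfolding Y by auto
      show "(\<xi> \<alpha> \<circ> (\<lambda>w. deform (fst (fst (fst w))) (snd (fst (fst w))) (lifting Z (snd (fst w)) \<alpha>) (snd w))) w =
          (case w of (x, p) \<Rightarrow> case (x, \<xi> \<alpha> p) of (x, z) \<Rightarrow> ?F x z)"
        unfolding w using deform_map(3)[OF *(1-3) \<alpha> *(4)] by simp
    qed
  qed
  then have "continuous_map ?X (compact_open_topology T T) ?F"
    by (rule continuous_map_into_compact_open) (use F liftableD(1) Homeo_subset in blast)
  moreover have "?F x \<in> Homeo Z" if "x \<in> topspace ?X" for x using F[OF that] liftableD(1) by blast
  ultimately show ?thesis
    using F unfolding Homeo_topology_def by (auto simp: continuous_map_in_subtopology)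
qed

lemma continuous_map_deform_map_along:
  assumes f: "continuous_on {0..1} f" "f ` {0..1} \<subseteq> {0..1} \<times> {0..1}"
  shows "continuous_map (prod_topology (top_of_set {0..1::real}) liftable_topology) liftable_topology
     (\<lambda>(t, h). deform_map (fst (f t)) (snd (f t)) h)"
proof -
  have "continuous_map (top_of_set {0..1}) (top_of_set ({0..1} \<times> {0..1})) f"
    using f by (auto simp: continuous_map_in_subtopology)
  then have "continuous_map (prod_topology (top_of_set {0..1}) liftable_topology)
      (prod_topology (top_of_set ({0..1} \<times> {0..1})) liftable_topology) (\<lambda>(t, h). (f t, h))"
    by (simp add: continuous_map_prod_top)
  from continuous_map_compose[OF this continuous_map_deform_map] show ?thesis
    by (simp add: comp_def case_prod_unfold)
qed

lemma
  shows continuous_map_retracting: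
    "continuous_map (prod_topology (top_of_set {0..1::real}) liftable_topology) liftable_topology
       (\<lambda>(t, h). deform_map 0 t h)"
    and continuous_map_contracting:
    "continuous_map (prod_topology (top_of_set {0..1::real}) liftable_topology) liftable_topology
       (\<lambda>(t, h). deform_map t t h)"
proof -
  have 1: "continuous_on {0..1} (\<lambda>t. (0 :: real, t :: real))"
    "continuous_on {0..1} (\<lambda>t. (t :: real, t))"
    by (intro continuous_intros)+
  have 2: "(\<lambda>t. (0 :: real, t :: real)) ` {0..1} \<subseteq> {0..1} \<times> {0..1}"
    "(\<lambda>t. (t :: real, t)) ` {0..1} \<subseteq> {0..1} \<times> {0..1}" by auto
  show
    "continuous_map (prod_topology (top_of_set {0..1::real}) liftable_topology) liftable_topology
       (\<lambda>(t, h). deform_map 0 t h)"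
    "continuous_map (prod_topology (top_of_set {0..1::real}) liftable_topology) liftable_topology
       (\<lambda>(t, h). deform_map t t h)"
    using continuous_map_deform_map_along[OF 1(1) 2(1)] continuous_map_deform_map_along[OF 1(2) 2(2)]
    by simp_all
qed

lemma liftable_strong_deformation_retract: "strong_deformation_retract (Homeo0' Z) liftable_topology"
  unfolding strong_deformation_retract_def
proof (intro conjI exI)
  show sub: "Homeo0' Z \<subseteq> topspace liftable_topology"
    unfolding topspace_liftable using Homeo0'_iff by blast
  note hom = continuous_map_retracting
  show "homotopic_with (\<lambda>f. \<forall>s\<in>Homeo0' Z. f s = s) liftable_topology liftable_topology id (deform_map 0 1)"
  proof (subst homotopic_with)
    show "(\<forall>s\<in>Homeo0' Z. h s = s) = (\<forall>s\<in>Homeo0' Z. k s = s)"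
      if "\<And>x. x \<in> topspace liftable_topology \<Longrightarrow> h x = k x"
        for h k :: "'a surface_map \<Rightarrow> 'a surface_map"
    proof (rule ball_cong[OF refl])
      fix s assume "s \<in> Homeo0' Z"
      then show "(h s = s) = (k s = s)"
        using that sub by (simp add: subset_iff del: topspace_subtopology)
    qed
    show "\<exists>h. continuous_map (prod_topology (top_of_set {0..1::real}) liftable_topology) liftable_topology h \<and>
        (\<forall>x\<in>topspace liftable_topology. h (0, x) = id x) \<and>
        (\<forall>x\<in>topspace liftable_topology. h (1, x) = deform_map 0 1 x) \<and>
        (\<forall>t\<in>{0..1}. \<forall>s\<in>Homeo0' Z. h (t, s) = s)"
    proof (rule exI[of _ "\<lambda>(t, h). deform_map 0 t h"], intro conjI ballI)
      show "continuous_map (prod_topology (top_of_set {0..1::real}) liftable_topology) liftable_topology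
          (\<lambda>(t, h). deform_map 0 t h)" by (rule hom)
    qed (simp_all add: topspace_liftable deform_map_start deform_map_Homeo0'_fixed del: topspace_subtopology)
  qed
  have "continuous_map liftable_topology (prod_topology (top_of_set {0..1::real}) liftable_topology) (\<lambda>h. (1, h))"
    by (intro continuous_map_pairedI) auto
  from continuous_map_compose[OF this hom]
  have "continuous_map liftable_topology liftable_topology (deform_map 0 1)" by (simp add: comp_def)
  then have "continuous_map liftable_topology (subtopology liftable_topology (Homeo0' Z)) (deform_map 0 1)"
    using deform_map_Homeo0' by (auto simp: continuous_map_in_subtopology topspace_liftable)
  moreover have "continuous_map (subtopology liftable_topology (Homeo0' Z)) liftable_topology id"
    using continuous_map_from_subtopology[OF continuous_map_id] by blast
  moreover have "\<forall>h\<in>topspace (subtopology liftable_topology (Homeo0' Z)). deform_map 0 1 (id h) = h"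
    using deform_map_Homeo0'_fixed[of _ 1] by simp
  ultimately show "retraction_maps liftable_topology (subtopology liftable_topology (Homeo0' Z)) (deform_map 0 1) id"
    unfolding retraction_maps_def by blast
qed

lemma contractible_liftable: "contractible_space liftable_topology"
  unfolding contractible_space_def
proof (rule exI, subst homotopic_with)
  show "\<exists>h. continuous_map (prod_topology (top_of_set {0..1::real}) liftable_topology) liftable_topology h \<and>
        (\<forall>x\<in>topspace liftable_topology. h (0, x) = id x) \<and>
        (\<forall>x\<in>topspace liftable_topology. h (1, x) = restrict (\<lambda>z. z) (topspace T)) \<and> (\<forall>t\<in>{0..1}. True)"
  proof (rule exI[of _ "\<lambda>(t, h). deform_map t t h"], intro conjI ballI)
    show "continuous_map (prod_topology (top_of_set {0..1::real}) liftable_topology) liftable_topology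
        (\<lambda>(t, h). deform_map t t h)" by (rule continuous_map_contracting)
  qed (simp_all add: topspace_liftable deform_map_start deform_map_end del: topspace_subtopology)
qed simp

lemma liftable_subset_Homeo0: "liftable \<subseteq> Homeo0 Z"
proof
  fix h assume h: "h \<in> liftable"
  have "continuous_map (top_of_set {0..1}) (top_of_set {0..1::real}) (\<lambda>t. t)" by simp
  moreover have "continuous_map (top_of_set {0..1::real}) liftable_topology (\<lambda>t. h)"
    using h topspace_liftable by (simp del: topspace_subtopology)
  ultimately have "continuous_map (top_of_set {0..1}) (prod_topology (top_of_set {0..1::real}) liftable_topology) (\<lambda>t. (t, h))"
    by (rule continuous_map_pairedI)
  from continuous_map_compose[OF this continuous_map_contracting]
  have "continuous_map (top_of_set {0..1}) liftable_topology (\<lambda>t. deform_map t t h)"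
    by (simp add: comp_def)
  then have "pathin (Homeo_topology Z) (\<lambda>t. deform_map t t h)"
    unfolding pathin_def by (simp add: continuous_map_in_subtopology)
  then have "path_component_of (Homeo_topology Z) h (restrict (\<lambda>z. z) (topspace T))"
    unfolding path_component_of_def using deform_map_start[OF h] deform_map_end[OF h] by blast
  then show "h \<in> Homeo0 Z" unfolding Homeo0_def using path_component_of_sym by auto
qed

end

lemma positive_by_continuity:
  fixes f :: "real \<Rightarrow> real"
  assumes f: "continuous_on {0..1} f" "f 0 > 0" "\<And>t. t \<in> {0..1} \<Longrightarrow> f t \<noteq> 0"
  shows "f 1 > 0"
proof (rule ccontr)
  assume "\<not> f 1 > 0"
  then obtain t where "0 \<le> t" "t \<le> 1" "f t = 0" using IVT2'[of f 1 0 0] f(1,2) by auto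
  then show False using f(3)[of t] by simp
qed

context reduced_stripped
begin

section \<open>The identity component\<close>

text \<open>Stated for open and for closed pairs: open strips are kept apart by open sets, a
  singular leaf and the other singular leaves by closed sets.\<close>

lemma connected_stays:
  assumes C: "connectedin T C" "C \<subseteq> U \<union> V" "U \<inter> V = {}" and z: "z \<in> C" "z \<in> U"
    and UV: "openin T U \<and> openin T V \<or> closedin T U \<and> closedin T V"
  shows "C \<subseteq> U"
proof -
  have "V \<inter> C = {}"
    using UV
  proof
    assume "openin T U \<and> openin T V"
    then show ?thesis using C z unfolding connectedin by (metis Int_empty_left disjoint_iff)
  next
    assume "closedin T U \<and> closedin T V"
    then show ?thesis using C z
      unfolding connectedin_closedin by (metis Int_empty_left disjoint_iff)
  qed
  then show ?thesis using C(2) by blast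
qed

text \<open>Closed sets of the strips are pushed down along the closed quotient map. In each strip
  the rest of the singular set is the boundary with the intervals over the given leaf removed, an
  intersection of closed sets.\<close>

lemma singular_leaf_closedin:
  assumes \<alpha>: "\<alpha> \<in> A" and J: "J \<in> boundary_intervals (S \<alpha>)"
  shows "closedin T (\<xi> \<alpha> ` J)" "closedin T (singular - \<xi> \<alpha> ` J)"
proof -
  show "closedin T (\<xi> \<alpha> ` J)"
    using closed_map_chart[OF \<alpha>] boundary_interval_closedin(1)[OF model[OF \<alpha>] J]
      unfolding closed_map_def by blast
  let ?w = "\<xi> \<alpha> ` J"
  let ?D = "Sigma A (\<lambda>\<beta>. {p \<in> strip_boundary (S \<beta>). \<xi> \<beta> p \<notin> ?w})"
  have "closedin (top_of_set (S \<beta>)) {p \<in> strip_boundary (S \<beta>). \<xi> \<beta> p \<notin> ?w}" if \<beta>: "\<beta> \<in> A" for \<beta>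
  proof -
    \<comment> \<open>Inserting the whole boundary keeps the family nonempty when no interval of the
      strip lies over the leaf.\<close>
    let ?K = "insert (strip_boundary (S \<beta>)) {strip_boundary (S \<beta>) - K |K. K \<in> boundary_intervals (S \<beta>) \<and> \<xi> \<beta> ` K = ?w}"
    have "{p \<in> strip_boundary (S \<beta>). \<xi> \<beta> p \<notin> ?w} = \<Inter> ?K"
    proof (intro equalityI subsetI)
      fix p assume "p \<in> {p \<in> strip_boundary (S \<beta>). \<xi> \<beta> p \<notin> ?w}"
      then show "p \<in> \<Inter> ?K" by blast
    next
      fix p assume p: "p \<in> \<Inter> ?K"
      then have pb: "p \<in> strip_boundary (S \<beta>)" by blast
      then obtain K where K: "K \<in> boundary_intervals (S \<beta>)" "p \<in> K"
        by (rule boundary_interval_of_point)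
      have "\<xi> \<beta> p \<notin> ?w"
      proof
        assume "\<xi> \<beta> p \<in> ?w"
        then have "\<xi> \<beta> ` K = ?w"
          using leaves_unique[OF interval_leaf[OF \<beta> K(1)] interval_leaf[OF \<alpha> J]] K(2) by blast
        then show False using p K by blast
      qed
      then show "p \<in> {p \<in> strip_boundary (S \<beta>). \<xi> \<beta> p \<notin> ?w}" using pb by blast
    qed
    moreover have "closedin (top_of_set (S \<beta>)) (\<Inter> ?K)"
      using boundary_interval_closedin(2)[OF model[OF \<beta>]]
      by (intro closedin_Inter) (auto simp: strip_boundary_closedin[OF model[OF \<beta>]])
    ultimately show ?thesis by simp
  qed
  then have "closedin \<D> ?D" by (simp add: closedin_disjoint_union)
  then have "closedin T (q ` ?D)" using closed_map_proj unfolding closed_map_def by blast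
  moreover have "q ` ?D = singular - ?w" unfolding singular_def by (auto simp: chart_def)
  ultimately show "closedin T (singular - ?w)" by simp
qed

text \<open>Evaluation at a point is continuous in the compact-open topology because a singleton is
  compact; so each point moves along a connected orbit.\<close>

lemma path_point:
  assumes \<gamma>: "pathin (Homeo_topology Z) \<gamma>" and z: "z \<in> topspace T"
  shows "connectedin T ((\<lambda>t. \<gamma> t z) ` {0..1})"
proof -
  have c: "continuous_map (top_of_set {0..1}) (Homeo_topology Z) \<gamma>" using \<gamma> unfolding pathin_def .
  have H: "\<gamma> t \<in> Homeo Z" if "t \<in> {0..1}" for t
    using continuous_map_funspace[OF c] that by (auto simp: topspace_Homeo_topology)
  have "continuous_map (top_of_set {0..1}) T (\<lambda>t. \<gamma> t z)"
    unfolding continuous_map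
  proof (intro conjI allI impI)
    show "(\<lambda>t. \<gamma> t z) ` topspace (top_of_set {0..1}) \<subseteq> topspace T"
    proof (rule image_subsetI)
      fix t :: real assume "t \<in> topspace (top_of_set {0..1})"
      then show "\<gamma> t z \<in> topspace T" using HomeoD(6)[OF H, of t] z by (auto dest: equalityD1)
    qed
    fix U assume U: "openin T U"
    have "compactin T {z}" using z by (intro finite_imp_compactin) auto
    then have "openin (Homeo_topology Z) {h \<in> Homeo Z. h ` {z} \<subseteq> U}"
      using U by (rule openin_Homeo_subbasic)
    then have "openin (top_of_set {0..1}) {t \<in> topspace (top_of_set {0..1}). \<gamma> t \<in> {h \<in> Homeo Z. h ` {z} \<subseteq> U}}"
      using c unfolding continuous_map by blast
    moreover have "{t \<in> topspace (top_of_set {0..1}). \<gamma> t \<in> {h \<in> Homeo Z. h ` {z} \<subseteq> U}} =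
        {t \<in> topspace (top_of_set {0..1}). \<gamma> t z \<in> U}" using H by auto
    ultimately show "openin (top_of_set {0..1}) {t \<in> topspace (top_of_set {0..1}). \<gamma> t z \<in> U}"
      by simp
  qed
  then show ?thesis
    by (rule connectedin_continuous_map_image) (simp add: connectedin_absolute)
qed

section \<open>Orbits along an isotopy that starts at the identity\<close>

context
  fixes \<gamma> assumes \<gamma>: "pathin (Homeo_topology Z) \<gamma>" and start: "\<gamma> 0 = restrict (\<lambda>z. z) (topspace T)"
begin

lemma path_Homeo: "t \<in> {0..1} \<Longrightarrow> \<gamma> t \<in> Homeo Z"
  using continuous_map_funspace[OF \<gamma>[unfolded pathin_def]] by (auto simp: topspace_Homeo_topology)

lemma path_start: "z \<in> topspace T \<Longrightarrow> z \<in> (\<lambda>t. \<gamma> t z) ` {0..1}"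
  by (rule image_eqI[of _ _ 0]) (simp_all add: start)

text \<open>The images of the open strips are disjoint open sets that cover the complement of the
  singular set. The orbit of a nonsingular point never becomes singular, so, being connected, it
  remains in one of them.\<close>

lemma path_interior:
  assumes \<alpha>: "\<alpha> \<in> A" and z: "z \<in> \<xi> \<alpha> ` open_strip" and t: "t \<in> {0..1}"
  shows "\<gamma> t z \<in> \<xi> \<alpha> ` open_strip"
proof -
  let ?V = "\<Union>\<beta>\<in>A - {\<alpha>}. \<xi> \<beta> ` open_strip"
  have op: "openin T (\<xi> \<beta> ` open_strip)" if "\<beta> \<in> A" for \<beta>
    using openin_chart_interior[OF that open_open_strip] by simp
  have zT: "z \<in> topspace T" using openin_subset[OF op[OF \<alpha>]] z by blast
  have zs: "z \<notin> singular" using z unfolding strip_minus_singular[OF \<alpha>] by blast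
  have cov: "\<gamma> s z \<in> \<xi> \<alpha> ` open_strip \<union> ?V" if s: "s \<in> {0..1}" for s
  proof -
    have "\<gamma> s z \<in> topspace T" using HomeoD(6)[OF path_Homeo[OF s]] zT by blast
    then obtain \<beta> where \<beta>: "\<beta> \<in> A" "\<gamma> s z \<in> surface_strip Z \<beta>"
      unfolding topspace_surface surface_strip_def by blast
    moreover have "\<gamma> s z \<notin> singular" using Homeo_singular_iff[OF path_Homeo[OF s] zT] zs by blast
    ultimately have "\<gamma> s z \<in> \<xi> \<beta> ` open_strip" unfolding strip_minus_singular[OF \<beta>(1)] by blast
    then show ?thesis using \<beta>(1) by blast
  qed
  have "(\<lambda>t. \<gamma> t z) ` {0..1} \<subseteq> \<xi> \<alpha> ` open_strip"
  proof (rule connected_stays[OF path_point[OF \<gamma> zT] _ _ path_start[OF zT] z])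
    show "(\<lambda>t. \<gamma> t z) ` {0..1} \<subseteq> \<xi> \<alpha> ` open_strip \<union> ?V" using cov by (rule image_subsetI)
    show "\<xi> \<alpha> ` open_strip \<inter> ?V = {}"
    proof (rule ccontr)
      assume "\<xi> \<alpha> ` open_strip \<inter> ?V \<noteq> {}"
      then obtain p \<beta> r where "p \<in> open_strip" "\<beta> \<noteq> \<alpha>" "\<xi> \<alpha> p = \<xi> \<beta> r" by blast
      then show False using chart_eq_interior by metis
    qed
    show "openin T (\<xi> \<alpha> ` open_strip) \<and> openin T ?V \<or> closedin T (\<xi> \<alpha> ` open_strip) \<and> closedin T ?V"
      using op \<alpha> by (intro disjI1 conjI openin_Union) auto
  qed
  then show ?thesis using t by (rule subsetD[OF _ imageI])
qed

text \<open>The orbit of a singular point stays singular, and there the leaf and the remainder are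
  disjoint closed sets. Since the image of the leaf is again a leaf, it equals the original one as
  soon as they meet.\<close>

lemma path_interval:
  assumes \<alpha>: "\<alpha> \<in> A" and J: "J \<in> boundary_intervals (S \<alpha>)" and t: "t \<in> {0..1}"
  shows "\<gamma> t ` \<xi> \<alpha> ` J = \<xi> \<alpha> ` J"
proof -
  have sub: "\<gamma> t z \<in> \<xi> \<alpha> ` J" if z: "z \<in> \<xi> \<alpha> ` J" for z
  proof -
    have zT: "z \<in> topspace T" using leaf_subset[OF interval_leaf[OF \<alpha> J]] z by blast
    have zs: "z \<in> singular" using z \<alpha> boundary_intervals_subset[OF J]
      unfolding singular_def by blast
    have "(\<lambda>t. \<gamma> t z) ` {0..1} \<subseteq> \<xi> \<alpha> ` J"
    proof (rule connected_stays[OF path_point[OF \<gamma> zT] _ _ path_start[OF zT] z])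
      show "(\<lambda>t. \<gamma> t z) ` {0..1} \<subseteq> \<xi> \<alpha> ` J \<union> (singular - \<xi> \<alpha> ` J)"
        using Homeo_singular_iff[OF path_Homeo zT] zs by blast
      show "openin T (\<xi> \<alpha> ` J) \<and> openin T (singular - \<xi> \<alpha> ` J) \<or>
          closedin T (\<xi> \<alpha> ` J) \<and> closedin T (singular - \<xi> \<alpha> ` J)"
        using singular_leaf_closedin[OF \<alpha> J] by blast
    qed blast
    then show ?thesis using t by (rule subsetD[OF _ imageI])
  qed
  obtain z where z: "z \<in> \<xi> \<alpha> ` J" using leaf_nonempty[OF interval_leaf[OF \<alpha> J]] by blast
  show ?thesis
    by (rule leaves_unique[OF HomeoD(3)[OF path_Homeo[OF t] interval_leaf[OF \<alpha> J]] interval_leaf[OF \<alpha> J] imageI[OF z] sub[OF z]])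
qed

lemma path_strips_invariant:
  assumes t: "t \<in> {0..1}" shows "strips_invariant (\<gamma> t)"
proof
  fix \<alpha> assume \<alpha>: "\<alpha> \<in> A"
  note H = path_Homeo[OF t]
  have split: "surface_strip Z \<beta> = \<xi> \<beta> ` open_strip \<union> (\<Union>J\<in>boundary_intervals (S \<beta>). \<xi> \<beta> ` J)"
    if \<beta>: "\<beta> \<in> A" for \<beta>
  proof -
    have "S \<beta> = open_strip \<union> strip_boundary (S \<beta>)"
      using strip_boundary_eq[OF model[OF \<beta>]] open_strip_subset[OF model[OF \<beta>]] by blast
    moreover have "strip_boundary (S \<beta>) = \<Union> (boundary_intervals (S \<beta>))"
      unfolding boundary_intervals_def by (simp only: Union_components)
    ultimately have "S \<beta> = open_strip \<union> \<Union> (boundary_intervals (S \<beta>))" by simp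
    then have "\<xi> \<beta> ` S \<beta> = \<xi> \<beta> ` (open_strip \<union> \<Union> (boundary_intervals (S \<beta>)))" by simp
    then show ?thesis unfolding surface_strip_def by (simp only: image_Un image_Union)
  qed
  have sub: "\<gamma> t z \<in> surface_strip Z \<beta>" if \<beta>: "\<beta> \<in> A" and z: "z \<in> surface_strip Z \<beta>" for \<beta> z
    using z unfolding split[OF \<beta>]
  proof
    assume "z \<in> \<xi> \<beta> ` open_strip"
    then show "\<gamma> t z \<in> \<xi> \<beta> ` open_strip \<union> (\<Union>J\<in>boundary_intervals (S \<beta>). \<xi> \<beta> ` J)"
      using path_interior[OF \<beta> _ t] by blast
  next
    assume "z \<in> (\<Union>J\<in>boundary_intervals (S \<beta>). \<xi> \<beta> ` J)"
    then obtain J where J: "J \<in> boundary_intervals (S \<beta>)" "z \<in> \<xi> \<beta> ` J" by blast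
    then have "\<gamma> t z \<in> \<xi> \<beta> ` J" using path_interval[OF \<beta> J(1) t] by blast
    then show "\<gamma> t z \<in> \<xi> \<beta> ` open_strip \<union> (\<Union>J\<in>boundary_intervals (S \<beta>). \<xi> \<beta> ` J)"
      using J(1) by blast
  qed
  show "\<gamma> t ` surface_strip Z \<alpha> = surface_strip Z \<alpha>"
  proof (intro equalityI subsetI)
    fix y assume "y \<in> \<gamma> t ` surface_strip Z \<alpha>"
    then show "y \<in> surface_strip Z \<alpha>" using sub[OF \<alpha>] by blast
  next
    fix y assume y: "y \<in> surface_strip Z \<alpha>"
    then show "y \<in> \<gamma> t ` surface_strip Z \<alpha>" unfolding split[OF \<alpha>]
    proof
      assume yi: "y \<in> \<xi> \<alpha> ` open_strip"
      \<comment> \<open>The preimage \<open>z\<close> of \<open>y\<close> is nonsingular, so it lies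
        over some open strip; that strip is kept by the map and therefore is the one containing
        \<open>y\<close>.\<close>
      have yT: "y \<in> topspace T" using y \<alpha> unfolding surface_strip_def topspace_surface by blast
      then have "y \<in> \<gamma> t ` topspace T" using HomeoD(6)[OF H] by simp
      then obtain z where z: "z \<in> topspace T" "\<gamma> t z = y" by blast
      have "y \<notin> singular" using yi unfolding strip_minus_singular[OF \<alpha>] by blast
      then have "z \<notin> singular" using Homeo_singular_iff[OF H z(1)] z(2) by simp
      moreover obtain \<beta> where \<beta>: "\<beta> \<in> A" "z \<in> surface_strip Z \<beta>"
        using z(1) unfolding topspace_surface surface_strip_def by blast
      ultimately have zi: "z \<in> \<xi> \<beta> ` open_strip" unfolding strip_minus_singular[OF \<beta>(1)] by blast
      have "y \<in> \<xi> \<beta> ` open_strip" using path_interior[OF \<beta>(1) zi t] z(2) by simp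
      then obtain p r where "p \<in> open_strip" "\<xi> \<alpha> p = \<xi> \<beta> r" using yi by blast
      then have "\<beta> = \<alpha>" using chart_eq_interior by metis
      then show "y \<in> \<gamma> t ` (\<xi> \<alpha> ` open_strip \<union> (\<Union>J\<in>boundary_intervals (S \<alpha>). \<xi> \<alpha> ` J))"
        using zi z(2) by blast
    next
      assume "y \<in> (\<Union>J\<in>boundary_intervals (S \<alpha>). \<xi> \<alpha> ` J)"
      then obtain J where J: "J \<in> boundary_intervals (S \<alpha>)" "y \<in> \<xi> \<alpha> ` J" by blast
      then have "y \<in> \<gamma> t ` \<xi> \<alpha> ` J" using path_interval[OF \<alpha> J(1) t] by simp
      then show "y \<in> \<gamma> t ` (\<xi> \<alpha> ` open_strip \<union> (\<Union>J\<in>boundary_intervals (S \<alpha>). \<xi> \<alpha> ` J))"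
        using J(1) by blast
    qed
  qed
qed

lemma path_lifting_continuous:
  assumes \<alpha>: "\<alpha> \<in> A" and p: "p \<in> S \<alpha>"
  shows "continuous_on {0..1} (\<lambda>t. lifting Z (\<gamma> t) \<alpha> p)"
proof -
  have "continuous_map (top_of_set {0..1}) (subtopology (Homeo_topology Z) (Collect strips_invariant)) \<gamma>"
    using \<gamma> path_strips_invariant unfolding pathin_def by (auto simp: continuous_map_in_subtopology)
  moreover have "continuous_map (top_of_set {0..1::real}) (top_of_set (S \<alpha>)) (\<lambda>t. p)"
    using p by simp
  ultimately have "continuous_map (top_of_set {0..1})
      (prod_topology (subtopology (Homeo_topology Z) (Collect strips_invariant)) (top_of_set (S \<alpha>))) (\<lambda>t. (\<gamma> t, p))"
    by (rule continuous_map_pairedI)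
  from continuous_map_compose[OF this continuous_map_lifting[OF \<alpha>]]
  show ?thesis by (simp add: comp_def continuous_map_in_subtopology)
qed

lemma path_lifting_start:
  assumes \<alpha>: "\<alpha> \<in> A" and p: "p \<in> open_strip"
  shows "lifting Z (\<gamma> 0) \<alpha> p = p"
proof -
  have pS: "p \<in> S \<alpha>" by (rule subsetD[OF open_strip_subset[OF model[OF \<alpha>]] p])
  have 0: "0 \<in> {0..1::real}" by simp
  have "\<xi> \<alpha> p = \<xi> \<alpha> (lifting Z (\<gamma> 0) \<alpha> p)"
    using liftingD(4)[OF path_Homeo[OF 0] \<alpha> path_strips_invariant[OF 0] pS] chart_in_topspace[OF \<alpha> pS] by (simp add: start)
  then show ?thesis using chart_eq_interior p by metis
qed

text \<open>Order relations between values of the lifting cannot change along the path: at time 0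
  the lifting is the identity over the open strip, and a change would require a time at which two
  values coincide, against injectivity. This gives both monotonicities over the open strip; limits
  and \<open>lifting_good\<close> take care of the boundary.\<close>

lemma path_end_liftable: "\<gamma> 1 \<in> liftable"
proof -
  have one: "1 \<in> {0..1::real}" and zero: "0 \<in> {0..1::real}" by simp_all
  note H = path_Homeo and inv = path_strips_invariant
  have "good_lift (S \<alpha>) (lifting Z (\<gamma> 1) \<alpha>)" if \<alpha>: "\<alpha> \<in> A" for \<alpha>
  proof -
    let ?g = "\<lambda>t. lifting Z (\<gamma> t) \<alpha>"
    note mod = model[OF \<alpha>]
    note L = liftingD[OF H \<alpha> inv]
    have IS: "p \<in> S \<alpha>" if "p \<in> open_strip" for p
      by (rule subsetD[OF open_strip_subset[OF mod] that])
    have in_I: "(x, y) \<in> open_strip" if "y \<in> {-1<..<1}" for x y :: real using that by simp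
    \<comment> \<open>Leaves go to leaves and the open strip is invariant; injectivity of the chart
      there turns this into a statement about horizontal lines.\<close>
    have line: "\<exists>s\<in>{-1<..<1}. ?g t ` (UNIV \<times> {y}) = UNIV \<times> {s}" if y: "y \<in> {-1<..<1}"
      and t: "t \<in> {0..1}" for y t
    proof -
      let ?w = "\<xi> \<alpha> ` (UNIV \<times> {y})"
      have yS: "UNIV \<times> {y} \<subseteq> S \<alpha>" using IS in_I[OF y] by auto
      have image_leaf: "\<gamma> t ` ?w \<in> leaves Z"
        using HomeoD(3)[OF H[OF t] internal_leaf[OF \<alpha>]] y by simp
      define s where "s = snd (?g t (0, y))"
      have g0: "?g t (0, y) \<in> open_strip" using L(5)[OF t t IS[OF in_I[OF y]]] in_I[OF y] by simp
      then have s: "s \<in> {-1<..<1}" unfolding s_def by auto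
      then have target_leaf: "\<xi> \<alpha> ` (UNIV \<times> {s}) \<in> leaves Z" using internal_leaf[OF \<alpha>] by simp
      have "\<gamma> t (\<xi> \<alpha> (0, y)) = \<xi> \<alpha> (?g t (0, y))" using L(4)[OF t t IS[OF in_I[OF y]]] by simp
      then have "\<gamma> t (\<xi> \<alpha> (0, y)) \<in> \<xi> \<alpha> ` (UNIV \<times> {s})"
        unfolding s_def by (simp add: mem_Times_iff)
      moreover have "\<gamma> t (\<xi> \<alpha> (0, y)) \<in> \<gamma> t ` ?w" by blast
      ultimately have eq: "\<gamma> t ` ?w = \<xi> \<alpha> ` (UNIV \<times> {s})"
        using leaves_unique[OF image_leaf target_leaf] by blast
      have "\<gamma> t ` ?w = \<xi> \<alpha> ` (?g t ` (UNIV \<times> {y}))"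
        unfolding image_image using L(4)[OF t t] yS by (intro image_cong) auto
      then have eq2: "\<xi> \<alpha> ` (?g t ` (UNIV \<times> {y})) = \<xi> \<alpha> ` (UNIV \<times> {s})" using eq by simp
      have sub1: "?g t ` (UNIV \<times> {y}) \<subseteq> open_strip"
      proof (rule image_subsetI)
        fix p :: "real \<times> real" assume "p \<in> UNIV \<times> {y}"
        then have "p \<in> open_strip" using y by auto
        then show "?g t p \<in> open_strip" using L(5)[OF t t IS] by simp
      qed
      have sub2: "UNIV \<times> {s} \<subseteq> open_strip" using s by auto
      have "?g t ` (UNIV \<times> {y}) = UNIV \<times> {s}"
        using eq2 inj_on_image_eq_iff[OF inj_chart_interior sub1 sub2] by simp
      then show ?thesis using s by blast
    qed
    have row: "snd (?g t (x, y)) = snd (?g t (0, y))" if y: "y \<in> {-1<..<1}" and t: "t \<in> {0..1}"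
      for x y t
    proof -
      obtain s where s: "?g t ` (UNIV \<times> {y}) = UNIV \<times> {s}" using line[OF y t] by blast
      have "?g t (u, y) \<in> UNIV \<times> {s}" for u unfolding s[symmetric] by (rule imageI) simp
      then have "snd (?g t (u, y)) = s" for u by (metis mem_Times_iff singletonD)
      then show ?thesis by simp
    qed
    have start_g: "?g 0 p = p" if "p \<in> open_strip" for p using path_lifting_start[OF \<alpha> that] .
    have cont: "continuous_on {0..1} (\<lambda>t. ?g t p)" if "p \<in> open_strip" for p
      using path_lifting_continuous[OF \<alpha> IS[OF that]] .
    have fst_mono: "fst (?g 1 (x, y)) < fst (?g 1 (x', y))" if y: "y \<in> {-1<..<1}" and x: "x < x'"
      for x x' y
    proof -
      let ?f = "\<lambda>t. fst (?g t (x', y)) - fst (?g t (x, y))"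
      have "0 < ?f 1"
      proof (rule positive_by_continuity)
        show "continuous_on {0..1} ?f" using cont[OF in_I[OF y]] by (intro continuous_intros)
        show "0 < ?f 0" using x start_g in_I[OF y] by simp
        fix t :: real assume t: "t \<in> {0..1}"
        show "?f t \<noteq> 0"
        proof
          assume "?f t = 0"
          then have "?g t (x', y) = ?g t (x, y)"
            using row[OF y t, of x] row[OF y t, of x'] by (simp add: prod_eq_iff)
          then have "(x', y) = (x, y)"
            by (rule inj_onD[OF L(3)[OF t t]]) (use IS in_I[OF y] in blast)+
          then show False using x by simp
        qed
      qed
      then show ?thesis by simp
    qed
    \<comment> \<open>Extended by the identity, \<open>M\<close> is an increasing map of the line
      onto itself and hence continuous. It fixes -1 and 1, which provides the height map on [-1, 1]
      even where the strip has no points on a side.\<close>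
    define M where "M y = (if y \<in> {-1<..<1} then snd (?g 1 (0, y)) else y)" for y
    have M_in: "M y \<in> {-1<..<1}" if "y \<in> {-1<..<1}" for y
    proof -
      have "?g 1 (0, y) \<in> open_strip"
        using L(5)[OF one one IS[OF in_I[OF that]]] in_I[OF that] by simp
      then show ?thesis using that unfolding M_def by auto
    qed
    have M_mono_in: "M y < M y'" if y: "y \<in> {-1<..<1}" "y' \<in> {-1<..<1}" "y < y'" for y y'
    proof -
      \<comment> \<open>Equal heights at time \<open>t\<close> would put the image of the point at
        height y' on the image of the whole line at height \<open>y\<close>, which injectivity
        forbids.\<close>
      let ?f = "\<lambda>t. snd (?g t (0, y')) - snd (?g t (0, y))"
      have "0 < ?f 1"
      proof (rule positive_by_continuity)
        show "continuous_on {0..1} ?f"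
          using cont[OF in_I[OF y(1)]] cont[OF in_I[OF y(2)]] by (intro continuous_intros)
        show "0 < ?f 0" using y(3) start_g in_I y by simp
        fix t :: real assume t: "t \<in> {0..1}"
        show "?f t \<noteq> 0"
        proof
          assume eq: "?f t = 0"
          obtain s where s: "?g t ` (UNIV \<times> {y}) = UNIV \<times> {s}" using line[OF y(1) t] by blast
          have "?g t (0, y) \<in> UNIV \<times> {s}" unfolding s[symmetric] by (rule imageI) simp
          then have "snd (?g t (0, y')) = s" using eq by (auto simp: mem_Times_iff)
          then have "?g t (0, y') \<in> ?g t ` (UNIV \<times> {y})" unfolding s by (simp add: mem_Times_iff)
          then obtain x where x: "?g t (0, y') = ?g t (x, y)" by auto
          have "(0, y') = (x, y)" by (rule inj_onD[OF L(3)[OF t t] x]) (use IS in_I y in blast)+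
          then show False using y(3) by simp
        qed
      qed
      then show ?thesis using y unfolding M_def by simp
    qed
    have M_fix: "M y = y" if "y \<notin> {-1<..<1}" for y using that unfolding M_def by (rule if_not_P)
    have M_mono: "M y < M y'" if less: "y < y'" for y y'
    proof (cases "y \<in> {-1<..<1}"; cases "y' \<in> {-1<..<1}")
      assume y: "y \<in> {-1<..<1}" "y' \<in> {-1<..<1}"
      then show ?thesis using M_mono_in less by blast
    next
      assume y: "y \<in> {-1<..<1}" "y' \<notin> {-1<..<1}"
      then show ?thesis using M_in[OF y(1)] M_fix[OF y(2)] less by auto
    next
      assume y: "y \<notin> {-1<..<1}" "y' \<in> {-1<..<1}"
      then show ?thesis using M_in[OF y(2)] M_fix[OF y(1)] less by auto
    next
      assume y: "y \<notin> {-1<..<1}" "y' \<notin> {-1<..<1}"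
      then show ?thesis using M_fix[OF y(1)] M_fix[OF y(2)] less by simp
    qed
    have M_onto_in: "M ` {-1<..<1} = {-1<..<1}"
    proof (intro equalityI subsetI)
      fix v :: real assume v: "v \<in> {-1<..<1}"
      have "(0, v) \<in> S \<alpha>" using IS in_I[OF v] by blast
      then obtain x y where p: "(x, y) \<in> S \<alpha>" "?g 1 (x, y) = (0, v)"
        using L(2)[OF one one] by (metis imageE surj_pair)
      have "(x, y) \<in> open_strip" using L(5)[OF one one p(1)] p(2) v by simp
      then have y: "y \<in> {-1<..<1}" by simp
      have "M y = v" using row[OF y one, of x] p(2) y unfolding M_def by simp
      then show "v \<in> M ` {-1<..<1}" using y by blast
    qed (use M_in in blast)
    have M_onto: "v \<in> M ` UNIV" for v
    proof (cases "v \<in> {-1<..<1}")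
      case True then show ?thesis using M_onto_in by blast
    next
      case False then show ?thesis using M_fix[OF False] by (metis rangeI)
    qed
    then have "M ` UNIV = UNIV" by blast
    then have M_cont: "continuous_on UNIV M"
      using M_mono by (intro continuous_onI_mono) (auto simp: le_less)
    have M_img: "M ` {-1..1} = {-1..1}"
    proof -
      have "{-1..1::real} = insert (-1) (insert 1 {-1<..<1})" by auto
      then show ?thesis using M_onto_in M_fix[of "-1"] M_fix[of 1] by (simp add: image_insert)
    qed
    have M_strict: "strict_mono_on {-1..1} M" using M_mono by (simp add: strict_mono_on_def)
    have M_homeo: "homeomorphic_map (top_of_set {-1..1}) (top_of_set {-1..1}) M"
      using continuous_on_subset[OF M_cont] M_img strict_mono_on_imp_inj_on[OF M_strict]
      by (intro continuous_imp_homeomorphic_map)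
        (auto simp: compact_space_subtopology Hausdorff_space_subtopology)
    \<comment> \<open>At interior heights this is the definition of \<open>M\<close>; at boundary
      points it follows by a limit along the vertical line through the point.\<close>
    have snd_M: "snd (?g 1 (x, y)) = M y" if p: "(x, y) \<in> S \<alpha>" for x y
    proof -
      have "y \<in> {-1..1}" using model_strip_subset[OF mod] p by auto
      then obtain u where u: "\<And>n. u n \<in> {-1<..<1}" "u \<longlonglongrightarrow> y" using interior_sequence by blast
      have uS: "(x, u n) \<in> S \<alpha>" for n using IS in_I[OF u(1)] by blast
      have "(\<lambda>n. (x, u n)) \<longlonglongrightarrow> (x, y)" using u(2) by (intro tendsto_intros)
      then have "(\<lambda>n. ?g 1 (x, u n)) \<longlonglongrightarrow> ?g 1 (x, y)"
        by (rule continuous_on_tendsto_compose[OF L(1)[OF one one] _ p]) (simp add: uS)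
      then have lim1: "(\<lambda>n. snd (?g 1 (x, u n))) \<longlonglongrightarrow> snd (?g 1 (x, y))" by (rule tendsto_snd)
      have "(\<lambda>n. M (u n)) \<longlonglongrightarrow> M y"
        by (rule continuous_on_tendsto_compose[OF M_cont u(2)]) auto
      moreover have "M (u n) = snd (?g 1 (x, u n))" for n
        using row[OF u(1)[of n] one, of x] u(1)[of n] unfolding M_def by simp
      ultimately have "(\<lambda>n. snd (?g 1 (x, u n))) \<longlonglongrightarrow> M y" by simp
      then show ?thesis using lim1 LIMSEQ_unique by blast
    qed
    show ?thesis
    proof (rule lifting_good[OF H[OF one] inv[OF one] \<alpha>, of "fst \<circ> ?g 1" M])
      have "continuous_on (S \<alpha>) (fst \<circ> ?g 1)"
        unfolding comp_def by (intro continuous_intros L(1)[OF one one])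
      moreover have "\<forall>(x, y)\<in>S \<alpha>. ?g 1 (x, y) = ((fst \<circ> ?g 1) (x, y), M y)"
        using snd_M by (auto simp: prod_eq_iff)
      ultimately show "strip_coordinates (S \<alpha>) (?g 1) (fst \<circ> ?g 1) M"
        using M_homeo unfolding strip_coordinates_def by blast
      show "strict_mono (\<lambda>x. (fst \<circ> ?g 1) (x, y))" if "y \<in> {-1<..<1}" for y
        using fst_mono[OF that] by (simp add: strict_mono_def)
      show "\<gamma> 1 ` \<xi> \<alpha> ` J = \<xi> \<alpha> ` J" if "J \<in> boundary_intervals (S \<alpha>)" for J
        using path_interval[OF \<alpha> that one] .
    qed (rule M_strict)
  qed
  then show ?thesis unfolding liftable_def using H[OF one] inv[OF one] by blast
qed

end

lemma Homeo0_eq_liftable: "Homeo0 Z = liftable"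
proof
  show "Homeo0 Z \<subseteq> liftable"
  proof
    fix h assume "h \<in> Homeo0 Z"
    then obtain \<gamma> where "pathin (Homeo_topology Z) \<gamma>" "\<gamma> 0 = restrict (\<lambda>z. z) (topspace T)"
      "\<gamma> 1 = h"
      unfolding Homeo0_def path_component_of_def by blast
    then show "h \<in> liftable" using path_end_liftable by blast
  qed
qed (rule liftable_subset_Homeo0)

end

(* The first conjunct states the existence and uniqueness of the liftings to which the second
   condition in the characterization of Homeo0 refers. *)
theorem theorem4p4:
  fixes Z :: "('a, 'b) gluing"
  assumes "stripped_surface Z"
    and "connected_space (surface Z)"
    and "reduced Z"
  shows
    "(\<forall>h\<in>Homeo Z.
        (\<forall>\<alpha>\<in>strip_index Z. h ` surface_strip Z \<alpha> = surface_strip Z \<alpha>) \<longrightarrow>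
        (\<forall>\<alpha>\<in>strip_index Z. \<exists>!g. is_lifting Z h \<alpha> g)) \<and>
     (\<forall>h\<in>Homeo Z. h \<in> Homeo0 Z \<longleftrightarrow>
        (\<forall>\<alpha>\<in>strip_index Z. h ` surface_strip Z \<alpha> = surface_strip Z \<alpha>) \<and>
        (\<forall>\<alpha>\<in>strip_index Z. \<exists>l m. strip_coordinates (strip Z \<alpha>) (lifting Z h \<alpha>) l m \<and>
           strict_mono_on {-1..1} m \<and> (\<forall>y\<in>{-1<..<1}. strict_mono (\<lambda>x. l (x, y)))) \<and>
        (\<forall>w\<in>leaves Z. w \<subseteq> Sigma_leaves Z \<longrightarrow>
           h ` w = w \<and> preserves_orientation (surface Z) h w)) \<and>
     strong_deformation_retract (Homeo0' Z) (subtopology (Homeo_topology Z) (Homeo0 Z)) \<and>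
     contractible_space (subtopology (Homeo_topology Z) (Homeo0 Z))"
proof -
  interpret reduced_stripped Z using assms(1,3) by unfold_locales
  show ?thesis
    unfolding Homeo0_eq_liftable
    using ex1_lifting liftable_iff liftable_strong_deformation_retract contractible_liftable by simp
qed

end
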